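(* Let $\Gamma\subset\mathbb{R}^2$ and let $\{\eta_\gamma\}_{\gamma\in\Gamma}$ be a well-spread family of non-negative symbols on $\mathbb{R}^2$ with $\sum_{\gamma\in\Gamma}\eta_\gamma(z)\approx 1$. Let $\{\phi_i\}_{i\in\mathcal{I}}\subset L^2(\mathbb{R})$ be a collection of windows satisfying one of the following two conditions: (a) $\mathcal{I}=\{1,2\}$, $\|\phi_1\|_2=\|\phi_2\|_2=1$ and $\|\phi_1-\phi_2\|_2<\frac12$; or (b) there are constants $C>0$ and $s>1$ such that $\big(|\mathcal{V}_{\varphi_0}\phi_i|\ast|\mathcal{V}_{\varphi_0}\phi_i|\big)(z)\le C(1+|z|^2)^{-s}$ for all $z\in\mathbb{R}^2$ and all $i\in\mathcal{I}$, and there is a constant $C_0$ with $2\,C_0\,\|\mathcal{V}_{\varphi_0}\varphi_0\|_1<1$ such that $|\mathcal{V}_{\varphi_0}\varphi_0(z)-\mathcal{V}_{\varphi_0}\phi_i(z)|<C_0\,|\mathcal{V}_{\varphi_0}\varphi_0(z)|$ for all $z\in\mathbb{R}^2$ and all $i\in\mathcal{I}$. For $\gamma\in\Gamma$ and $i\in\mathcal{I}$ let $H_{\eta_\gamma,\phi_i}f=\sum_{k\ge1}\lambda_k^{\gamma,i}\langle f,\phi_k^{\gamma,i}\rangle\phi_k^{\gamma,i}$ be the spectral decomposition of $H_{\eta_\gamma,\phi_i}$. Then there exists an $\varepsilon>0$ such that, for each fixed $i\in\mathcal{I}$, the family $$\mathcal{F}_i=\{\phi_k^{\gamma,i} : \gamma\in\Gamma,\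 \lambda_k^{\gamma,i}>\varepsilon\}$$ of all eigenfunctions of the operators $H_{\eta_\gamma,\phi_i}$, $\gamma\in\Gamma$, corresponding to eigenvalues bigger than $\varepsilon$ is a (multi-window Gabor) frame for $L^2(\mathbb{R})$, and all these frames $\mathcal{F}_i$, $i\in\mathcal{I}$, are woven; that is, for every partition $\{\sigma_i\}_{i\in\mathcal{I}}$ of $\Gamma$, the family $\bigcup_{i\in\mathcal{I}}\{\phi_k^{\gamma,i}:\gamma\in\sigma_i,\ \lambda_k^{\gamma,i}>\varepsilon\}$ is a frame for $L^2(\mathbb{R})$.
   Context: For $\gamma=(x,\omega)\in\mathbb{R}\times\mathbb{R}$, the time-frequency shift is $\pi(\gamma)\phi(t)=e^{2\pi i\omega t}\phi(t-x)$. For $\phi,f\in L^2(\mathbb{R})$ the short-time Fourier transform is $\mathcal{V}_\phi f(\gamma)=\langle f,\pi(\gamma)\phi\rangle$. For a symbol $m\colon\mathbb{R}^2\to\mathbb{R}$ the time-frequency localization operator is $H_{m,\phi}f(t)=\int_{\mathbb{R}^2}\mathcal{V}_\phi f(\gamma)\,m(\gamma)\,\pi(\gamma)\phi(t)\,d\gamma$, formally $H_{m,\phi}f=\mathcal{V}_\phi^*(m\,\mathcal{V}_\phi f)$. The standard Gaussian is $\varphi_0(t)=2^{1/4}e^{-\pi t^2}$. The symbol $\ast$ denotes convolution on $\mathbb{R}^2$, and $\|\cdot\|_1$ is the norm of $L^1(\mathbb{R}^2)$. A family of symbols $\{\eta_\gamma\colon\mathbb{R}^2\to\mathbb{R}\mid\gamma\in\Gamma\}$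 with $\eta_\gamma\in L^1(\mathbb{R}^2)$ is called well-spread if $\Gamma\subset\mathbb{R}^2$ is a discrete set without accumulation points and there exists a continuous function $g\in L^2(\mathbb{R}^2)$ with polynomial decay such that $|\eta_\gamma(\xi)|\le g(\xi-\gamma)$ for all $\xi\in\mathbb{R}^2$, $\gamma\in\Gamma$. The notation $f\approx g$ means that there are constants $0<A\le B<\infty$ with $Ag\le f\le Bg$. For non-negative well-spread symbols, each $H_{\eta_\gamma,\phi}$ is positive and trace class, so it can be diagonalized as $H_{\eta_\gamma,\phi}f=\sum_{k\ge1}\lambda_k^\gamma\langle f,\phi_k^\gamma\rangle\phi_k^\gamma$, where $(\phi_k^\gamma)_k$ is an orthonormal family of eigenfunctions and $(\lambda_k^\gamma)_k$ is a non-increasing sequence of non-negative reals. A countable family $\{h_n\}$ in $L^2(\mathbb{R})$ is a frame if there are constants $0<A\le B<\infty$ with $A\|f\|_2^2\le\sum_n|\langle f,h_n\rangle|^2\le B\|f\|_2^2$ for all $f\in L^2(\mathbb{R})$. The paper calls a family of multi-window Gabor frames $\{\pi(\gamma)\phi_k^j\}_{\gamma\in\Gamma,k}$, $j=1,\dots,M$, woven if for every partition $\{\sigma_j\}$ of $\Gamma$ the union over $j$ of $\{\pi(\gamma)\phi_k^j\}_{\gamma\in\sigma_j,k}$ is a frame for $L^2(\mathbb{R})$; here the elements attached to $\gamma\in\Gamma$ in the $i$-th frame are the eigenfunctions $\phi_k^{\gamma,i}$ with $\lambda_k^{\gamma,i}>\varepsilon$.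
   Formalization: Instead of only having no accumulation points, Γ is required to be relatively separated (boundedly many points in every unit ball), and the polynomial decay of g is taken to be of order s > 2; without either condition the claim fails. *)

theory Defs
  imports "HOL-Analysis.Analysis"
begin

text \<open>
  Elements of \<open>L\<^sup>2(\<real>)\<close> are represented by Borel measurable functions, so equalities between
  them hold almost everywhere only.
\<close>

definition square_integrable :: "(real \<Rightarrow> complex) set" where
  "square_integrable =
     {f \<in> borel_measurable lborel. integrable lborel (\<lambda>t. (cmod (f t))\<^sup>2)}"

definition l2_inner :: "(real \<Rightarrow> complex) \<Rightarrow> (real \<Rightarrow> complex) \<Rightarrow> complex" where
  "l2_inner f g = (LINT t|lborel. f t * cnj (g t))"

definition l2_norm :: "(real \<Rightarrow> complex) \<Rightarrow> real" where
  "l2_norm f = sqrt (LINT t|lborel. (cmod (f t))\<^sup>2)"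

definition tf_shift :: "real \<times> real \<Rightarrow> (real \<Rightarrow> complex) \<Rightarrow> real \<Rightarrow> complex" where
  "tf_shift = (\<lambda>(x, \<omega>) \<phi> t. exp (2 * of_real pi * \<i> * of_real \<omega> * of_real t) * \<phi> (t - x))"

definition stft :: "(real \<Rightarrow> complex) \<Rightarrow> (real \<Rightarrow> complex) \<Rightarrow> real \<times> real \<Rightarrow> complex" where
  "stft \<phi> f z = l2_inner f (tf_shift z \<phi>)"

text \<open>
  For \<open>m \<in> L\<^sup>1\<close> and \<open>\<phi>, f \<in> L\<^sup>2\<close> the integral converges absolutely for almost every \<open>t\<close>,
  since the short-time Fourier transform is bounded and \<open>L\<^sup>1 * L\<^sup>2 \<subseteq> L\<^sup>2\<close>; on the
  exceptional null set the Bochner integral is \<open>0\<close> by convention.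
\<close>

definition loc_op ::
  "(real \<times> real \<Rightarrow> real) \<Rightarrow> (real \<Rightarrow> complex) \<Rightarrow> (real \<Rightarrow> complex) \<Rightarrow> real \<Rightarrow> complex" where
  "loc_op m \<phi> f t = (LINT z|lborel. stft \<phi> f z * of_real (m z) * tf_shift z \<phi> t)"

definition std_gaussian :: "real \<Rightarrow> complex" where
  "std_gaussian t = of_real (2 powr (1 / 4) * exp (- pi * t\<^sup>2))"

text \<open>
  Convolution on the plane; it is only applied to \<open>F = G = \<bar>V f\<bar>\<close>, which is in \<open>L\<^sup>2\<close>, so that
  the integral exists for every \<open>z\<close>.
\<close>

definition plane_conv ::
  "(real \<times> real \<Rightarrow> real) \<Rightarrow> (real \<times> real \<Rightarrow> real) \<Rightarrow> real \<times> real \<Rightarrow> real" where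
  "plane_conv F G z = (LINT w|lborel. F w * G (z - w))"

text \<open>
  Decay of order \<open>s > 2\<close>, that is, polynomial decay that is integrable over the plane: the
  envelopes of well-spread families stand for elements of the amalgam space
  \<open>W(L\<^sup>\<infinity>, L\<^sup>1)\<close>.  Square integrability alone would only correspond to \<open>s > 1\<close>, which is too
  weak for frames of eigenfunctions: on \<open>\<int>\<^sup>2\<close> with \<open>R(z) = 1 + ln (1 + \<bar>z\<bar>)\<close>, the symbols
  \<open>\<eta>\<^sub>\<gamma>(z) = R(z)\<^sup>-\<^sup>2\<close> for \<open>\<bar>z - \<gamma>\<bar> \<le> R(z)\<close> and \<open>0\<close> elsewhere add up to a function
  \<open>\<approx> 1\<close> and have an envelope of order \<open>2\<close>, but their suprema, hence the eigenvalues, tend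
  to \<open>0\<close> as \<open>\<gamma>\<close> tends to infinity.
\<close>

definition polynomial_decay :: "(real \<times> real \<Rightarrow> real) \<Rightarrow> bool" where
  "polynomial_decay g \<longleftrightarrow> (\<exists>C s. s > 2 \<and> (\<forall>z. \<bar>g z\<bar> \<le> C * (1 + norm z) powr (- s)))"

definition relatively_separated :: "(real \<times> real) set \<Rightarrow> bool" where
  "relatively_separated \<Gamma> \<longleftrightarrow> (\<exists>N. \<forall>z. finite (\<Gamma> \<inter> ball z 1) \<and> card (\<Gamma> \<inter> ball z 1) \<le> N)"

text \<open>
  That the discrete set \<open>\<Gamma>\<close> does not accumulate is meant uniformly over the plane, as usual for
  node sets of well-spread families: \<open>\<Gamma>\<close> is relatively separated.  Mere local finiteness does
  not give frames.  If a partition of unity \<open>b(\<cdot> - n)\<close>, \<open>n \<in> \<int>\<^sup>2\<close>, with \<open>b\<close> continuous and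
  compactly supported, is replaced by \<open>N(n) = 1 + \<bar>n\<^sub>1\<bar> + \<bar>n\<^sub>2\<bar>\<close> copies of \<open>b(\<cdot> - n) / N(n)\<close>
  attached to \<open>N(n)\<close> distinct points close to \<open>n\<close>, then the symbols still add up to \<open>1\<close> and have
  a common compactly supported envelope, but for a normalised window the eigenvalues are at
  most \<open>1 / N(n)\<close>, so only finitely many of them exceed a given \<open>\<epsilon>\<close>.
\<close>

definition well_spread ::
  "(real \<times> real) set \<Rightarrow> (real \<times> real \<Rightarrow> real \<times> real \<Rightarrow> real) \<Rightarrow> bool" where
  "well_spread \<Gamma> \<eta> \<longleftrightarrow>
     (\<forall>\<gamma>\<in>\<Gamma>. integrable lborel (\<eta> \<gamma>)) \<and>
     (\<forall>z. \<not> z islimpt \<Gamma>) \<and> relatively_separated \<Gamma> \<and>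
     (\<exists>g :: real \<times> real \<Rightarrow> real.
        continuous_on UNIV g \<and> integrable lborel (\<lambda>z. (g z)\<^sup>2) \<and> polynomial_decay g \<and>
        (\<forall>\<gamma>\<in>\<Gamma>. \<forall>\<xi>. \<bar>\<eta> \<gamma> \<xi>\<bar> \<le> g (\<xi> - \<gamma>)))"

definition l2_sums :: "(nat \<Rightarrow> real \<Rightarrow> complex) \<Rightarrow> (real \<Rightarrow> complex) \<Rightarrow> bool" where
  "l2_sums u f \<longleftrightarrow> (\<forall>k. u k \<in> square_integrable) \<and> f \<in> square_integrable \<and>
     (\<lambda>n. l2_norm (\<lambda>t. f t - (\<Sum>k<n. u k t))) \<longlonglongrightarrow> 0"

text \<open>
  Eigenvalues are counted from \<open>0\<close>; a finite-rank operator is covered by continuing its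
  eigenfunctions with an orthonormal sequence in the kernel.
\<close>

definition spectral_decomposition ::
  "((real \<Rightarrow> complex) \<Rightarrow> real \<Rightarrow> complex) \<Rightarrow> (nat \<Rightarrow> real) \<Rightarrow> (nat \<Rightarrow> real \<Rightarrow> complex) \<Rightarrow> bool" where
  "spectral_decomposition T \<mu> e \<longleftrightarrow>
     (\<forall>k. e k \<in> square_integrable) \<and>
     (\<forall>j k. l2_inner (e j) (e k) = (if j = k then 1 else 0)) \<and>
     (\<forall>k. 0 \<le> \<mu> k) \<and> decseq \<mu> \<and>
     (\<forall>k. AE t in lborel. T (e k) t = of_real (\<mu> k) * e k t) \<and>
     (\<forall>f\<in>square_integrable. l2_sums (\<lambda>k t. of_real (\<mu> k) * l2_inner f (e k) * e k t) (T f))"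

text \<open>Families are indexed, so repeated elements are counted with multiplicity.\<close>

definition l2_frame :: "'n set \<Rightarrow> ('n \<Rightarrow> real \<Rightarrow> complex) \<Rightarrow> bool" where
  "l2_frame J h \<longleftrightarrow> countable J \<and> (\<forall>n\<in>J. h n \<in> square_integrable) \<and>
     (\<exists>A B. 0 < A \<and> A \<le> B \<and>
        (\<forall>f\<in>square_integrable.
           (\<lambda>n. (cmod (l2_inner f (h n)))\<^sup>2) summable_on J \<and>
           A * (l2_norm f)\<^sup>2 \<le> (\<Sum>\<^sub>\<infinity>n\<in>J. (cmod (l2_inner f (h n)))\<^sup>2) \<and>
           (\<Sum>\<^sub>\<infinity>n\<in>J. (cmod (l2_inner f (h n)))\<^sup>2) \<le> B * (l2_norm f)\<^sup>2))"

text \<open>Parts may be empty, as usual for woven frames.\<close>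

definition indexed_partition :: "'i set \<Rightarrow> ('i \<Rightarrow> 'a set) \<Rightarrow> 'a set \<Rightarrow> bool" where
  "indexed_partition I \<sigma> \<Gamma> \<longleftrightarrow> disjoint_family_on \<sigma> I \<and> (\<Union>i\<in>I. \<sigma> i) = \<Gamma>"

end

theory Submission
  imports Defs "HOL-Probability.Probability"
begin

text \<open>
  Write \<open>q\<^sub>\<gamma>(f) = \<integral> \<eta>\<^sub>\<gamma> \<bar>V\<^bsub>\<phi>\<^esub> f\<bar>\<^sup>2 = \<Sum>\<^sub>k \<lambda>\<^sub>k \<bar>\<langle>f, \<phi>\<^sub>k\<rangle>\<bar>\<^sup>2\<close>, where the window may depend on \<open>\<gamma>\<close>.  All the
  transforms \<open>V\<^bsub>\<phi>\<^esub> f\<close> differ from a single one by at most a function \<open>D\<close> with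
  \<open>\<parallel>D\<parallel>\<^sub>2 \<le> \<parallel>f\<parallel>\<^sub>2 / 2\<close> (in case (b), \<open>D = C\<^sub>0 \<bar>V\<^sub>g f\<bar> * \<bar>V\<^sub>g g\<bar>\<close> with the Gaussian \<open>g\<close>, by the
  reproducing formula and Young's inequality); by Moyal's identity, \<open>\<Sum>\<^sub>\<gamma> q\<^sub>\<gamma>(f) \<approx> \<parallel>f\<parallel>\<^sub>2\<^sup>2\<close> for every choice of the windows.

  It remains to see that the eigenvalues up to \<open>\<epsilon>\<close> contribute little to this sum.  Tile the plane
  by squares of a large side \<open>R\<close> and let \<open>u\<^sub>\<gamma> = V\<^sub>g\<^sup>* (1\<^sub>Q V\<^sub>g f)\<close>, where \<open>Q\<close>
  is the block of nine squares around \<open>\<gamma>\<close>.  By Bessel's inequality the small eigenvalues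
  contribute at most \<open>2 \<epsilon> \<parallel>u\<^sub>\<gamma>\<parallel>\<^sup>2 + 2 q\<^sub>\<gamma>(f - u\<^sub>\<gamma>)\<close> to \<open>q\<^sub>\<gamma>(f)\<close>.  The second term is small after summation,
  for \<open>R\<close> large, because \<open>f - u\<^sub>\<gamma>\<close> lives far away from \<open>\<gamma>\<close>; and \<open>\<Sum>\<^sub>\<gamma> \<parallel>u\<^sub>\<gamma>\<parallel>\<^sup>2 \<le> N \<parallel>f\<parallel>\<^sup>2\<close> with \<open>N\<close>
  depending only on \<open>R\<close>, so that a small \<open>\<epsilon>\<close> takes care of the first one.
\<close>

section \<open>Square-integrable functions\<close>

text \<open>The constants have to be chosen without a circle. A window that is merely in L2 need not
  have an integrable transform, so windows are split into a part below an integrable kernel and a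
  perturbation. The kernel, hence the side R and the number N of indices near a point, depends on
  how small the perturbation is; so the perturbation must be controlled by a constant that does not
  see R. This is why the approximant of f depends on \<open>\<gamma>\<close> only through its
  square: the error is summed over squares instead of indices, and the blocks overlap at most nine
  times whatever R is. The bound N is left to \<open>\<epsilon>\<close>, which is chosen last. A
  partition of the index set is a map that assigns a window to every \<open>\<gamma>\<close>, and a
  single frame is the constant map. All estimates are uniform in this map, which forces majorants of
  the transforms that do not depend on the window. The frame bounds then come from the eigenvalues
  kept: they lie above \<open>\<epsilon>\<close>, and below a common bound because each is the value
  of a quadratic form at a normalized eigenfunction.\<close>

definition L2 :: "'a measure \<Rightarrow> ('a \<Rightarrow> complex) set" where
  "L2 M = {f \<in> borel_measurable M. integrable M (\<lambda>x. (cmod (f x))\<^sup>2)}"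

definition ip :: "'a measure \<Rightarrow> ('a \<Rightarrow> complex) \<Rightarrow> ('a \<Rightarrow> complex) \<Rightarrow> complex" where
  "ip M f g = (LINT x|M. f x * cnj (g x))"

text \<open>The square of the norm: Moyal's identity, Bessel's inequality and the frame inequalities
  are all quadratic, so square roots stay away. The measure is a parameter because the line carries
  the functions and the plane their transforms.\<close>

definition sqnorm :: "'a measure \<Rightarrow> ('a \<Rightarrow> complex) \<Rightarrow> real" where
  "sqnorm M f = (LINT x|M. (cmod (f x))\<^sup>2)"

lemma borel_measurable_cnj [measurable (raw)]:
  "f \<in> borel_measurable M \<Longrightarrow> (\<lambda>x. cnj (f x)) \<in> borel_measurable M"
  by (rule borel_measurable_continuous_on[of cnj]) (auto intro: continuous_intros)

lemma square_integrable_eq_L2: "square_integrable = L2 lborel"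
  by (simp add: square_integrable_def L2_def)

lemma l2_inner_eq_ip: "l2_inner = ip lborel"
  by (intro ext) (simp add: l2_inner_def ip_def)

lemma L2_measurable [measurable_dest]: "f \<in> L2 M \<Longrightarrow> f \<in> borel_measurable M"
  by (simp add: L2_def)

lemma L2_integrable: "f \<in> L2 M \<Longrightarrow> integrable M (\<lambda>x. (cmod (f x))\<^sup>2)"
  by (simp add: L2_def)

lemma sqnorm_nonneg [simp]: "0 \<le> sqnorm M f"
  by (simp add: sqnorm_def)

lemma sqnorm_l2_norm: "(l2_norm f)\<^sup>2 = sqnorm lborel f"
  by (simp add: l2_norm_def sqnorm_def)

lemma nn_integral_sqnorm:
  "f \<in> L2 M \<Longrightarrow> (\<integral>\<^sup>+x. ennreal ((cmod (f x))\<^sup>2) \<partial>M) = ennreal (sqnorm M f)"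
  unfolding sqnorm_def by (rule nn_integral_eq_integral) (auto simp: L2_integrable)

lemma L2I_nn_integral:
  assumes [measurable]: "f \<in> borel_measurable M"
    and "(\<integral>\<^sup>+x. ennreal ((cmod (f x))\<^sup>2) \<partial>M) < \<infinity>"
  shows "f \<in> L2 M"
  using assms by (auto simp: L2_def integrable_iff_bounded)

lemma norm_add_power2_le:
  fixes a b :: "'a :: real_normed_vector"
  shows "(norm (a + b))\<^sup>2 \<le> 2 * (norm a)\<^sup>2 + 2 * (norm b)\<^sup>2"
proof -
  have "(norm (a + b))\<^sup>2 \<le> (norm a + norm b)\<^sup>2"
    by (intro power_mono norm_triangle_ineq) auto
  also have "\<dots> \<le> 2 * (norm a)\<^sup>2 + 2 * (norm b)\<^sup>2"
    using sum_squares_bound[of "norm a" "norm b"] by (simp add: power2_sum)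
  finally show ?thesis .
qed

lemma L2_add:
  assumes "f \<in> L2 M" "g \<in> L2 M"
  shows "(\<lambda>x. f x + g x) \<in> L2 M"
proof -
  note [measurable] = assms
  have "integrable M (\<lambda>x. (cmod (f x + g x))\<^sup>2)"
  proof (rule Bochner_Integration.integrable_bound)
    show "integrable M (\<lambda>x. 2 * (cmod (f x))\<^sup>2 + 2 * (cmod (g x))\<^sup>2)"
      using assms by (auto simp: L2_integrable)
    show "AE x in M. norm ((cmod (f x + g x))\<^sup>2) \<le> norm (2 * (cmod (f x))\<^sup>2 + 2 * (cmod (g x))\<^sup>2)"
      using norm_add_power2_le by (intro AE_I2) simp
  qed measurable
  then show ?thesis by (simp add: L2_def)
qed

lemma L2_cmult: "f \<in> L2 M \<Longrightarrow> (\<lambda>x. c * f x) \<in> L2 M"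
  by (auto simp: L2_def norm_mult power_mult_distrib)

lemma L2_diff: "f \<in> L2 M \<Longrightarrow> g \<in> L2 M \<Longrightarrow> (\<lambda>x. f x - g x) \<in> L2 M"
  using L2_add[of f M "\<lambda>x. (-1) * g x"] L2_cmult[of g M "-1"] by simp

lemma L2_zero: "(\<lambda>x. 0) \<in> L2 M"
  by (simp add: L2_def)

lemma L2_sum: "(\<And>i. i \<in> A \<Longrightarrow> f i \<in> L2 M) \<Longrightarrow> (\<lambda>x. \<Sum>i\<in>A. f i x) \<in> L2 M"
  by (induction A rule: infinite_finite_induct) (auto intro: L2_zero L2_add)

lemma L2_integrable_mult:
  assumes "f \<in> L2 M" "g \<in> L2 M"
  shows "integrable M (\<lambda>x. f x * cnj (g x))"
proof (rule Bochner_Integration.integrable_bound)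
  note [measurable] = assms
  show "integrable M (\<lambda>x. (cmod (f x))\<^sup>2 + (cmod (g x))\<^sup>2)"
    using assms by (auto simp: L2_integrable)
  show "(\<lambda>x. f x * cnj (g x)) \<in> borel_measurable M" by measurable
  have "a * b \<le> a\<^sup>2 + b\<^sup>2" for a b :: real
    using sum_squares_bound[of a b] zero_le_power2[of a] zero_le_power2[of b] by linarith
  then show "AE x in M. norm (f x * cnj (g x)) \<le> norm ((cmod (f x))\<^sup>2 + (cmod (g x))\<^sup>2)"
    by (intro AE_I2) (simp add: norm_mult)
qed

lemma ip_commute: "cnj (ip M f g) = ip M g f"
  unfolding ip_def by (subst Bochner_Integration.integral_cnj[symmetric]) (simp add: mult.commute)

lemma ip_self: "ip M f f = of_real (sqnorm M f)"
proof -
  have "ip M f f = (LINT x|M. of_real ((cmod (f x))\<^sup>2))"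
    unfolding ip_def by (intro Bochner_Integration.integral_cong) (auto simp: complex_norm_square simp del: of_real_power)
  then show ?thesis by (simp add: sqnorm_def del: of_real_power)
qed

lemma ip_add_left:
  assumes "f \<in> L2 M" "g \<in> L2 M" "h \<in> L2 M"
  shows "ip M (\<lambda>x. f x + g x) h = ip M f h + ip M g h"
  using assms by (simp add: ip_def ring_distribs L2_integrable_mult)

lemma ip_diff_left:
  assumes "f \<in> L2 M" "g \<in> L2 M" "h \<in> L2 M"
  shows "ip M (\<lambda>x. f x - g x) h = ip M f h - ip M g h"
  using assms by (simp add: ip_def ring_distribs L2_integrable_mult)

lemma ip_cmult_left: "ip M (\<lambda>x. c * f x) h = c * ip M f h"
  by (simp add: ip_def mult.assoc)

lemma ip_add_right:
  assumes "f \<in> L2 M" "g \<in> L2 M" "h \<in> L2 M"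
  shows "ip M h (\<lambda>x. f x + g x) = ip M h f + ip M h g"
  using arg_cong[OF ip_add_left[OF assms], of cnj] by (simp add: ip_commute)

lemma ip_diff_right:
  assumes "f \<in> L2 M" "g \<in> L2 M" "h \<in> L2 M"
  shows "ip M h (\<lambda>x. f x - g x) = ip M h f - ip M h g"
  using arg_cong[OF ip_diff_left[OF assms], of cnj] by (simp add: ip_commute)

lemma ip_cmult_right: "ip M h (\<lambda>x. c * f x) = cnj c * ip M h f"
  using arg_cong[OF ip_cmult_left[of M c f h], of cnj] by (simp add: ip_commute)

lemma ip_sum_left:
  assumes "\<And>i. i \<in> A \<Longrightarrow> f i \<in> L2 M" "h \<in> L2 M"
  shows "ip M (\<lambda>x. \<Sum>i\<in>A. f i x) h = (\<Sum>i\<in>A. ip M (f i) h)"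
  using assms
  by (induction A rule: infinite_finite_induct) (auto simp: ip_add_left L2_sum, auto simp: ip_def)

lemma ip_sum_right:
  assumes "\<And>i. i \<in> A \<Longrightarrow> f i \<in> L2 M" "h \<in> L2 M"
  shows "ip M h (\<lambda>x. \<Sum>i\<in>A. f i x) = (\<Sum>i\<in>A. ip M h (f i))"
proof -
  have "cnj (ip M (\<lambda>x. \<Sum>i\<in>A. f i x) h) = (\<Sum>i\<in>A. cnj (ip M (f i) h))"
    by (simp add: ip_sum_left[OF assms])
  then show ?thesis by (simp add: ip_commute)
qed

text \<open>Cauchy-Schwarz for the integral of the absolute values, as an extended real: this form
  also serves as the finiteness test in Fubini's theorem.\<close>

lemma sqnorm_mult_le:
  assumes "f \<in> L2 M" "g \<in> L2 M"
  shows "(\<integral>\<^sup>+x. ennreal (cmod (f x) * cmod (g x)) \<partial>M)\<^sup>2 \<le> ennreal (sqnorm M f * sqnorm M g)"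
proof -
  note [measurable] = assms
  have "(\<integral>\<^sup>+x. ennreal (cmod (f x)) * ennreal (cmod (g x)) \<partial>M)\<^sup>2 \<le>
      (\<integral>\<^sup>+x. (ennreal (cmod (f x)))\<^sup>2 \<partial>M) * (\<integral>\<^sup>+x. (ennreal (cmod (g x)))\<^sup>2 \<partial>M)"
    by (rule Cauchy_Schwarz_nn_integral) measurable
  then show ?thesis
    by (simp add: ennreal_power nn_integral_sqnorm assms ennreal_mult)
qed

lemma ip_Cauchy_Schwarz:
  assumes "f \<in> L2 M" "g \<in> L2 M"
  shows "(cmod (ip M f g))\<^sup>2 \<le> sqnorm M f * sqnorm M g"
proof -
  have i: "integrable M (\<lambda>x. f x * cnj (g x))"
    by (rule L2_integrable_mult[OF assms])
  have "ennreal (cmod (ip M f g)) \<le> (\<integral>\<^sup>+x. ennreal (cmod (f x) * cmod (g x)) \<partial>M)"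
    unfolding ip_def using integral_norm_bound_ennreal[OF i] by (simp add: norm_mult)
  then have "(ennreal (cmod (ip M f g)))\<^sup>2 \<le> (\<integral>\<^sup>+x. ennreal (cmod (f x) * cmod (g x)) \<partial>M)\<^sup>2"
    by (intro power_mono) auto
  also note sqnorm_mult_le[OF assms]
  finally show ?thesis by (simp add: ennreal_power)
qed

text \<open>\<open>S\<close> is the orthogonal projection of \<open>f\<close>; the squared norm of
  \<open>f - S\<close>, which is nonnegative, equals that of \<open>f\<close> minus
  \<open>s\<close>.\<close>

lemma Bessel_inequality:
  fixes e :: "nat \<Rightarrow> 'a \<Rightarrow> complex"
  assumes e: "\<And>k. e k \<in> L2 M" and o: "\<And>j k. ip M (e j) (e k) = (if j = k then 1 else 0)"
    and f: "f \<in> L2 M" and A: "finite A"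
  shows "(\<Sum>k\<in>A. (cmod (ip M f (e k)))\<^sup>2) \<le> sqnorm M f"
proof -
  define S where "S = (\<lambda>x. \<Sum>k\<in>A. ip M f (e k) * e k x)"
  have S: "S \<in> L2 M" unfolding S_def by (intro L2_sum L2_cmult e)
  define s where "s = (\<Sum>k\<in>A. (cmod (ip M f (e k)))\<^sup>2)"
  have fS: "ip M f S = of_real s"
  proof -
    have "ip M f S = (\<Sum>k\<in>A. cnj (ip M f (e k)) * ip M f (e k))"
      unfolding S_def by (simp add: ip_sum_right L2_cmult e f ip_cmult_right)
    also have "\<dots> = of_real s"
      unfolding s_def of_real_sum complex_norm_square
      by (intro sum.cong) (auto simp: mult.commute)
    finally show ?thesis .
  qed
  have eS: "ip M (e k) S = cnj (ip M f (e k))" if "k \<in> A" for k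
  proof -
    have "ip M (e k) S = (\<Sum>j\<in>A. cnj (ip M f (e j)) * (if k = j then 1 else 0))"
      unfolding S_def by (simp add: ip_sum_right L2_cmult e ip_cmult_right o)
    also have "\<dots> = cnj (ip M f (e k))"
      using that A by (simp add: if_distrib cong: if_cong)
    finally show ?thesis .
  qed
  have SS: "ip M S S = of_real s"
  proof -
    have "ip M S S = (\<Sum>k\<in>A. ip M f (e k) * ip M (e k) S)"
      by (subst S_def) (simp add: ip_sum_left L2_cmult e S ip_cmult_left)
    also have "\<dots> = of_real s"
      unfolding s_def of_real_sum complex_norm_square
      by (intro sum.cong) (auto simp: eS)
    finally show ?thesis .
  qed
  have "of_real (sqnorm M (\<lambda>x. f x - S x)) = of_real (sqnorm M f) - (of_real s :: complex)"
  proof -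
    have "ip M (\<lambda>x. f x - S x) (\<lambda>x. f x - S x) = ip M f f - ip M f S - cnj (ip M f S) + ip M S S"
      using f S by (simp add: ip_diff_left ip_diff_right L2_diff ip_commute)
    then show ?thesis unfolding fS SS by (simp add: ip_self)
  qed
  then have "sqnorm M (\<lambda>x. f x - S x) = sqnorm M f - s"
    by (metis of_real_diff of_real_eq_iff)
  then show ?thesis
    unfolding s_def by (metis diff_ge_0_iff_ge sqnorm_nonneg)
qed

lemma sqnorm_diff_le:
  assumes "f \<in> L2 M" "g \<in> L2 M"
  shows "sqnorm M (\<lambda>x. f x - g x) \<le> 2 * sqnorm M f + 2 * sqnorm M g"
proof -
  have "sqnorm M (\<lambda>x. f x - g x) \<le> (LINT x|M. 2 * (cmod (f x))\<^sup>2 + 2 * (cmod (g x))\<^sup>2)"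
    unfolding sqnorm_def
    using assms L2_diff[OF assms] norm_add_power2_le[of "f _" "- g _"]
    by (intro integral_mono) (auto simp: L2_integrable)
  then show ?thesis using assms by (simp add: sqnorm_def L2_integrable)
qed

section \<open>Translations and Gaussians on the line\<close>

lemma nn_integral_lborel_translate:
  fixes f :: "'a :: euclidean_space \<Rightarrow> ennreal"
  assumes [measurable]: "f \<in> borel_measurable borel"
  shows "(\<integral>\<^sup>+x. f (c + x) \<partial>lborel) = (\<integral>\<^sup>+x. f x \<partial>lborel)"
proof -
  have "(\<integral>\<^sup>+x. f x \<partial>lborel) = (\<integral>\<^sup>+x. f x \<partial>distr lborel borel ((+) c))"
    by (simp add: lborel_distr_plus)
  also have "\<dots> = (\<integral>\<^sup>+x. f (c + x) \<partial>lborel)"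
    by (subst nn_integral_distr) auto
  finally show ?thesis by simp
qed

text \<open>Fubini for Bochner integrals with integrability replaced by Tonelli's test, a finite
  iterated integral of the norm, which can be bounded one variable at a time.\<close>

lemma (in pair_sigma_finite) Fubini_integral_nn:
  fixes f :: "'a \<Rightarrow> 'b \<Rightarrow> 'c :: {banach, second_countable_topology}"
  assumes [measurable]: "case_prod f \<in> borel_measurable (M1 \<Otimes>\<^sub>M M2)"
    and fin: "(\<integral>\<^sup>+x. \<integral>\<^sup>+y. ennreal (norm (f x y)) \<partial>M2 \<partial>M1) < \<infinity>"
  shows "(\<integral>y. (\<integral>x. f x y \<partial>M1) \<partial>M2) = (\<integral>x. (\<integral>y. f x y \<partial>M2) \<partial>M1)"
proof (rule Fubini_integral)
  have "(\<integral>\<^sup>+z. ennreal (norm (case_prod f z)) \<partial>(M1 \<Otimes>\<^sub>M M2)) =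
      (\<integral>\<^sup>+x. \<integral>\<^sup>+y. ennreal (norm (f x y)) \<partial>M2 \<partial>M1)"
    by (subst M2.nn_integral_fst[symmetric]) auto
  with fin show "integrable (M1 \<Otimes>\<^sub>M M2) (case_prod f)"
    by (simp add: integrable_iff_bounded)
qed

section \<open>Continuity of translations in L1\<close>

lemma compact_inner_approximation:
  fixes A :: "'a :: euclidean_space set"
  assumes A [measurable]: "A \<in> sets borel" and fin: "emeasure lborel A < \<infinity>" and e: "0 < (e :: real)"
  obtains K where "compact K" "K \<subseteq> A" "emeasure lborel (A - K) < e"
proof -
  define N where "N = density lborel (indicator A :: 'a \<Rightarrow> ennreal)"
  have N: "emeasure N B = emeasure lborel (A \<inter> B)" if "B \<in> sets borel" for B
    unfolding N_def using that by (simp add: emeasure_density flip: indicator_inter_arith)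
  \<comment> \<open>Inner regularity is used for finite measures, so Lebesgue measure is first
    restricted to \<open>A\<close>.\<close>
  have "emeasure N A = (SUP K \<in> {K. K \<subseteq> A \<and> compact K}. emeasure N K)"
    by (rule inner_regular) (use fin A in \<open>auto simp: N_def emeasure_density less_top\<close>)
  then have S: "emeasure lborel A = (SUP K \<in> {K. K \<subseteq> A \<and> compact K}. emeasure N K)"
    using N[OF A] by simp
  have "\<exists>K. K \<subseteq> A \<and> compact K \<and> emeasure lborel A < emeasure N K + e"
  \<comment> \<open>There must be room below the supremum: nothing lies strictly below the measure
    of a null set, for which the empty set is taken instead.\<close>
  proof (cases "emeasure lborel A = 0")
    case True
    then show ?thesis using e by (intro exI[of _ "{}"]) auto
  next
    case False
    then have "emeasure lborel A - e < emeasure lborel A"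
      using fin e by (intro ennreal_between) (auto simp: less_top zero_less_iff_neq_zero)
    then obtain K where "K \<subseteq> A" "compact K" "emeasure lborel A - e < emeasure N K"
      unfolding S less_SUP_iff by auto
    then show ?thesis
    proof (intro exI[of _ K] conjI)
      show "emeasure lborel A < emeasure N K + e"
      proof (rule ccontr)
        assume "\<not> ?thesis"
        then have "emeasure N K + e - e \<le> emeasure lborel A - e"
          by (intro ennreal_minus_mono) auto
        then show False
          using \<open>emeasure lborel A - e < emeasure N K\<close> by (simp add: ennreal_add_diff_cancel_right)
      qed
    qed
  qed
  then obtain K where K: "K \<subseteq> A" "compact K" "emeasure lborel A < emeasure N K + e" by blast
  have [measurable]: "K \<in> sets borel" using K by (simp add: borel_compact)
  have NK: "emeasure N K = emeasure lborel K"
    using K by (simp add: N Int_absorb1)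
  have "emeasure lborel K < \<infinity>" using K by (intro emeasure_compact_finite)
  then have "emeasure lborel (A - K) = emeasure lborel A - emeasure lborel K"
    using K by (intro emeasure_Diff) (auto simp: less_top)
  also have "\<dots> < e"
    using K(1,3) NK \<open>emeasure lborel K < \<infinity>\<close>
    by (subst minus_less_iff_ennreal) (auto simp: less_top add.commute intro: emeasure_mono)
  finally show ?thesis using that K by blast
qed

text \<open>Induction over integrable functions. For an indicator, compact \<open>K\<close> and open
  \<open>U\<close> enclose \<open>A\<close> up to small measure, and a shift shorter than the
  distance from \<open>K\<close> to the complement of \<open>U\<close> changes the indicator only on
  \<open>A - K\<close>, \<open>U - A\<close> and their translates. Sums and dominated limits
  preserve the property.\<close>

lemma L1_translation_continuous:
  fixes f :: "real \<Rightarrow> complex"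
  assumes "integrable lborel f" and "0 < (e :: real)"
  shows "\<forall>\<^sub>F u in nhds 0. (\<integral>\<^sup>+t. ennreal (cmod (f (u + t) - f t)) \<partial>lborel) \<le> ennreal e"
  using assms
proof (induction arbitrary: e rule: integrable_induct)
  case (base A c)
  then have A [measurable]: "A \<in> sets borel" by simp
  \<comment> \<open>Four exceptional sets of measure below \<open>e'\<close> enter; the
    \<open>+ 1\<close> covers \<open>c = 0\<close>.\<close>
  define e' where "e' = e / (4 * (cmod c + 1))"
  have e': "e' > 0" using base by (auto simp: e'_def intro!: divide_pos_pos add_nonneg_pos mult_pos_pos)
  obtain K where K: "compact K" "K \<subseteq> A" "emeasure lborel (A - K) < e'"
    using compact_inner_approximation[OF A base(2) e'] .
  obtain U where U: "open U" "A \<subseteq> U" "emeasure lborel (U - A) < e'"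
    using outer_regular_lborel[OF A e'] .
  have [measurable]: "K \<in> sets borel" "U \<in> sets borel" using K U by (auto simp: borel_compact)
  have "\<exists>d>0. \<forall>x\<in>K. \<forall>y\<in>-U. d \<le> dist x y"
    using separate_compact_closed[of K "-U"] K U by auto
  then obtain d where d: "d > 0" "\<And>x y. x \<in> K \<Longrightarrow> y \<notin> U \<Longrightarrow> d \<le> dist x y"
    by auto
  have *: "(\<integral>\<^sup>+t. ennreal (cmod (indicator A (u + t) *\<^sub>R c - indicator A t *\<^sub>R c)) \<partial>lborel) \<le> ennreal e"
    if u: "\<bar>u\<bar> < d" for u
  proof -
    let ?i = "indicator :: real set \<Rightarrow> real \<Rightarrow> ennreal"
    have "(\<integral>\<^sup>+t. ennreal (cmod (indicator A (u + t) *\<^sub>R c - indicator A t *\<^sub>R c)) \<partial>lborel)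
       \<le> (\<integral>\<^sup>+t. ennreal (cmod c) * (?i (A - K) (u + t) + ?i (U - A) t + ?i (A - K) t + ?i (U - A) (u + t)) \<partial>lborel)"
    proof (intro nn_integral_mono)
      fix t
      have 1: "t \<in> U" if "u + t \<in> K" using d(2)[OF that, of t] u by (force simp: dist_real_def)
      have 2: "u + t \<in> U" if "t \<in> K" using d(2)[OF that, of "u + t"] u by (force simp: dist_real_def)
      show "ennreal (cmod (indicator A (u + t) *\<^sub>R c - indicator A t *\<^sub>R c)) \<le>
        ennreal (cmod c) * (?i (A - K) (u + t) + ?i (U - A) t + ?i (A - K) t + ?i (U - A) (u + t))"
        using 1 2 by (auto simp: indicator_def norm_minus_commute distrib_left)
    qed
    also have "\<dots> = ennreal (cmod c) * (emeasure lborel (A - K) + emeasure lborel (U - A)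
        + emeasure lborel (A - K) + emeasure lborel (U - A))"
      by (simp add: nn_integral_cmult nn_integral_add nn_integral_lborel_translate)
    also have "\<dots> \<le> ennreal (cmod c) * (ennreal e' + ennreal e' + ennreal e' + ennreal e')"
      using K U by (intro mult_left_mono add_mono) auto
    also have "\<dots> = ennreal (cmod c * (4 * e'))"
    proof -
      have "ennreal (e' + e' + e' + e') = ennreal e' + ennreal e' + ennreal e' + ennreal e'"
        using e' by (simp only: ennreal_plus add_nonneg_nonneg less_imp_le)
      then show ?thesis by (simp add: ennreal_mult')
    qed
    also have "\<dots> \<le> ennreal e"
    proof (intro ennreal_leI)
      have "cmod c * (4 * e') \<le> (cmod c + 1) * (4 * e')" using e' by (intro mult_right_mono) auto
      also have "\<dots> = e" using norm_ge_zero[of c] by (simp add: e'_def field_simps add_nonneg_eq_0_iff)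
      finally show "cmod c * (4 * e') \<le> e" .
    qed
    finally show ?thesis .
  qed
  show ?case
    unfolding eventually_nhds_metric using d * by (auto simp: dist_real_def intro!: exI[of _ d])
next
  case (add f g)
  have e2: "e / 2 > 0" using add by simp
  have le: "(\<integral>\<^sup>+t. ennreal (cmod (f (u + t) + g (u + t) - (f t + g t))) \<partial>lborel) \<le>
    (\<integral>\<^sup>+t. ennreal (cmod (f (u + t) - f t)) \<partial>lborel) + (\<integral>\<^sup>+t. ennreal (cmod (g (u + t) - g t)) \<partial>lborel)" for u
  proof (subst nn_integral_add[symmetric])
    show "(\<integral>\<^sup>+t. ennreal (cmod (f (u + t) + g (u + t) - (f t + g t))) \<partial>lborel) \<le>
        (\<integral>\<^sup>+t. ennreal (cmod (f (u + t) - f t)) + ennreal (cmod (g (u + t) - g t)) \<partial>lborel)"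
      by (intro nn_integral_mono)
        (auto simp: norm_diff_triangle_ineq simp flip: ennreal_plus intro!: ennreal_leI)
  qed (use borel_measurable_integrable[OF add(1)] borel_measurable_integrable[OF add(2)] in simp_all)
  show ?case
    using add(3)[OF e2] add(4)[OF e2]
  proof eventually_elim
    case (elim u)
    have "(\<integral>\<^sup>+t. ennreal (cmod (f (u + t) + g (u + t) - (f t + g t))) \<partial>lborel) \<le> ennreal (e/2) + ennreal (e/2)"
      using le[of u] elim by (meson add_mono order_trans)
    then show ?case using add by (simp flip: ennreal_plus)
  qed
next
  case (lim f s)
  have f_meas: "f \<in> borel_measurable borel" using borel_measurable_integrable[OF lim(4)] by simp
  have s_meas: "s i \<in> borel_measurable borel" for i using borel_measurable_integrable[OF lim(1)] by simp
  note [measurable] = f_meas s_meas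
  have "(\<lambda>i. \<integral>\<^sup>+t. ennreal (cmod (s i t - f t)) \<partial>lborel) \<longlonglongrightarrow> (\<integral>\<^sup>+(t::real). 0 \<partial>lborel)"
  \<comment> \<open>The approximants of the induction rule satisfy
    \<open>cmod (s j t) \<le> 2 * cmod (f t)\<close>, whence the factor 3.\<close>
  proof (rule nn_integral_dominated_convergence[where w="\<lambda>t. ennreal (3 * cmod (f t))"])
    show "AE t in lborel. ennreal (cmod (s j t - f t)) \<le> ennreal (3 * cmod (f t))" for j
    proof (intro AE_I2 ennreal_leI)
      fix t
      show "cmod (s j t - f t) \<le> 3 * cmod (f t)"
        using lim(3)[of t j] norm_triangle_ineq4[of "s j t" "f t"] by simp
    qed
    show "(\<integral>\<^sup>+t. ennreal (3 * cmod (f t)) \<partial>lborel) < \<infinity>"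
      using lim(4) by (auto simp: integrable_iff_bounded ennreal_mult nn_integral_cmult ennreal_mult_less_top)
    show "AE t in lborel. (\<lambda>i. ennreal (cmod (s i t - f t))) \<longlonglongrightarrow> 0"
    proof (intro AE_I2)
      fix t
      have "(\<lambda>i. cmod (s i t - f t)) \<longlonglongrightarrow> 0"
        using lim(2)[of t] by (simp add: LIM_zero tendsto_norm_zero)
      then show "(\<lambda>i. ennreal (cmod (s i t - f t))) \<longlonglongrightarrow> 0"
        using tendsto_ennrealI by fastforce
    qed
  qed measurable
  then have "\<forall>\<^sub>F i in sequentially. (\<integral>\<^sup>+t. ennreal (cmod (s i t - f t)) \<partial>lborel) < ennreal (e / 3)"
    using lim(6) by (intro order_tendstoD) auto
  then obtain i where i: "(\<integral>\<^sup>+t. ennreal (cmod (s i t - f t)) \<partial>lborel) < ennreal (e / 3)"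
    by (auto simp: eventually_sequentially)
  have e3: "e / 3 > 0" using lim by simp
  show ?case
    using lim(5)[OF e3, of i]
  proof eventually_elim
    case (elim u)
    have "(\<integral>\<^sup>+t. ennreal (cmod (f (u + t) - f t)) \<partial>lborel) \<le>
       (\<integral>\<^sup>+t. ennreal (cmod (s i (u + t) - f (u + t))) + ennreal (cmod (s i (u + t) - s i t))
          + ennreal (cmod (s i t - f t)) \<partial>lborel)"
    proof (intro nn_integral_mono)
      fix t
      have "cmod (f (u + t) - f t) \<le> cmod (s i (u + t) - f (u + t)) + cmod (s i (u + t) - s i t) + cmod (s i t - f t)"
        using norm_triangle_ineq[of "s i (u + t) - s i t" "s i t - f t"]
          norm_triangle_ineq4[of "s i (u + t) - f t" "s i (u + t) - f (u + t)"] by (simp add: algebra_simps)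
      then show "ennreal (cmod (f (u + t) - f t)) \<le> ennreal (cmod (s i (u + t) - f (u + t)))
        + ennreal (cmod (s i (u + t) - s i t)) + ennreal (cmod (s i t - f t))"
        by (simp flip: ennreal_plus add: ennreal_leI)
    qed
    \<comment> \<open>Translation invariance makes the approximation error at the shifted argument
      equal to the unshifted one, so a single \<open>i\<close> serves all \<open>u\<close>.\<close>
    also have "\<dots> = (\<integral>\<^sup>+t. ennreal (cmod (s i t - f t)) \<partial>lborel)
        + (\<integral>\<^sup>+t. ennreal (cmod (s i (u + t) - s i t)) \<partial>lborel) + (\<integral>\<^sup>+t. ennreal (cmod (s i t - f t)) \<partial>lborel)"
      by (subst nn_integral_lborel_translate[symmetric, of "\<lambda>t. ennreal (cmod (s i t - f t))" u])
        (simp_all add: nn_integral_add)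
    also have "\<dots> \<le> ennreal (e / 3) + ennreal (e / 3) + ennreal (e / 3)"
      using elim i by (intro add_mono) auto
    also have "\<dots> = ennreal e" using lim by (simp flip: ennreal_plus)
    finally show ?case .
  qed
qed

text \<open>The characteristic function of the standard normal distribution, rescaled by
  \<open>c\<close>, for which \<open>std_normal_density (c * w)\<close> is a multiple of the wanted
  Gaussian.\<close>

lemma gaussian_fourier:
  fixes a u :: real
  assumes a: "a > 0"
  shows "integrable lborel (\<lambda>w. exp (- pi * a * w\<^sup>2))"
    and "(LINT w|lborel. of_real (exp (- pi * a * w\<^sup>2)) * cis (u * w)) =
      complex_of_real (exp (- u\<^sup>2 / (4 * pi * a)) / sqrt a)"
proof -
  define c where "c = sqrt (2 * pi * a)"
  have c: "c > 0" "c\<^sup>2 = 2 * pi * a" using a by (auto simp: c_def)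
  have "integrable lborel std_normal_density"
    by (rule integrable_normal_density) simp
  then have "integrable lborel (\<lambda>w. std_normal_density (0 + c * w))"
    using c by (intro lborel_integrable_real_affine) auto
  then have i: "integrable lborel (\<lambda>w. sqrt (2 * pi) * std_normal_density (c * w))"
    by simp
  have eq: "std_normal_density (c * w) = exp (- pi * a * w\<^sup>2) / sqrt (2 * pi)" for w
    by (simp add: std_normal_density_def power_mult_distrib c)
  show "integrable lborel (\<lambda>w. exp (- pi * a * w\<^sup>2))"
    using i by (simp add: eq)
  have "complex_of_real (exp (- (u / c)\<^sup>2 / 2)) = char std_normal_distribution (u / c)"
    by (simp add: char_std_normal_distribution)
  also have "\<dots> = (LINT x|lborel. std_normal_density x *\<^sub>R iexp (u / c * x))"
    unfolding char_def by (subst integral_density) (auto simp: normal_density_nonneg)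
  also have "\<dots> = \<bar>c\<bar> *\<^sub>R (LINT w|lborel. std_normal_density (0 + c * w) *\<^sub>R iexp (u / c * (0 + c * w)))"
    using c by (intro lborel_integral_real_affine) auto
  also have "\<dots> = \<bar>c\<bar> *\<^sub>R (LINT w|lborel. (1 / sqrt (2 * pi)) *\<^sub>R (of_real (exp (- pi * a * w\<^sup>2)) * cis (u * w)))"
  proof -
    have "std_normal_density (0 + c * w) *\<^sub>R iexp (u / c * (0 + c * w)) =
        (1 / sqrt (2 * pi)) *\<^sub>R (of_real (exp (- pi * a * w\<^sup>2)) * cis (u * w))" for w
      using c by (simp only: add_0 eq cis_conv_exp scaleR_conv_of_real) (simp add: mult.commute)
    then show ?thesis by simp
  qed
  also have "\<dots> = (c / sqrt (2 * pi)) *\<^sub>R (LINT w|lborel. of_real (exp (- pi * a * w\<^sup>2)) * cis (u * w))"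
    using c by simp
  also have "c / sqrt (2 * pi) = sqrt a" by (simp add: c_def real_sqrt_mult)
  finally have "complex_of_real (exp (- (u / c)\<^sup>2 / 2)) =
      sqrt a *\<^sub>R (LINT w|lborel. of_real (exp (- pi * a * w\<^sup>2)) * cis (u * w))" .
  moreover have "- (u / c)\<^sup>2 / 2 = - u\<^sup>2 / (4 * pi * a)"
    by (simp add: power_divide c)
  ultimately have eq2: "complex_of_real (exp (- u\<^sup>2 / (4 * pi * a))) =
      sqrt a *\<^sub>R (LINT w|lborel. of_real (exp (- pi * a * w\<^sup>2)) * cis (u * w))" by (simp add: mult.assoc)
  show "(LINT w|lborel. of_real (exp (- pi * a * w\<^sup>2)) * cis (u * w)) =
      complex_of_real (exp (- u\<^sup>2 / (4 * pi * a)) / sqrt a)"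
    unfolding of_real_divide eq2 using a by (simp add: scaleR_conv_of_real)
qed

section \<open>The Plancherel and Moyal identities\<close>

lemma ennreal_power2_le_imp_le:
  fixes x y :: ennreal
  assumes "x\<^sup>2 \<le> y\<^sup>2"
  shows "x \<le> y"
proof (cases x; cases y)
  fix r s :: real
  assume r: "0 \<le> r" "x = ennreal r" and s: "0 \<le> s" "y = ennreal s"
  then have "r\<^sup>2 \<le> s\<^sup>2" using assms by (simp add: ennreal_power)
  then show ?thesis using r s by (auto intro!: ennreal_leI power2_le_imp_le)
next
  fix s :: real
  assume "0 \<le> s" "x = top" "y = ennreal s"
  then show ?thesis using assms by (simp add: ennreal_power top_unique)
qed auto

lemma L2_borel_measurable: "f \<in> L2 lborel \<Longrightarrow> f \<in> borel_measurable borel"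
  using L2_measurable by fastforce

lemma L2_translate:
  fixes f :: "'a :: euclidean_space \<Rightarrow> complex"
  assumes "f \<in> L2 lborel"
  shows "(\<lambda>t. f (c + t)) \<in> L2 lborel" "sqnorm lborel (\<lambda>t. f (c + t)) = sqnorm lborel f"
proof -
  note [measurable] = L2_borel_measurable[OF assms]
  have "(\<integral>\<^sup>+t. ennreal ((cmod (f (c + t)))\<^sup>2) \<partial>lborel) = (\<integral>\<^sup>+t. ennreal ((cmod (f t))\<^sup>2) \<partial>lborel)"
    by (rule nn_integral_lborel_translate[of "\<lambda>t. ennreal ((cmod (f t))\<^sup>2)"]) measurable
  then have e: "(\<integral>\<^sup>+t. ennreal ((cmod (f (c + t)))\<^sup>2) \<partial>lborel) = ennreal (sqnorm lborel f)"
    by (simp add: nn_integral_sqnorm assms)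
  show L: "(\<lambda>t. f (c + t)) \<in> L2 lborel"
    by (rule L2I_nn_integral) (use e in auto)
  show "sqnorm lborel (\<lambda>t. f (c + t)) = sqnorm lborel f"
    using e nn_integral_sqnorm[OF L] by simp
qed

text \<open>The difference \<open>d\<close> of the shifted function and \<open>h\<close> is known to
  be small in L1 only. So \<open>h\<close> is split at height \<open>N\<close>: the bounded part
  \<open>b\<close> is paired with \<open>d\<close> through the L1 norm, while the remainder
  \<open>r N\<close> is small in L2 and paired by Cauchy-Schwarz.\<close>

lemma autocorrelation_tendsto:
  fixes h :: "real \<Rightarrow> complex"
  assumes h: "h \<in> L2 lborel" and int: "integrable lborel h" and u: "u \<longlonglongrightarrow> 0"
  shows "(\<lambda>n. ip lborel (\<lambda>t. h (u n + t)) h) \<longlonglongrightarrow> of_real (sqnorm lborel h)"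
proof (rule tendstoI)
  fix e :: real assume e: "e > 0"
  note [measurable] = L2_borel_measurable[OF h]
  define r where "r N t = (if cmod (h t) \<le> real N then 0 else h t)" for N t
  have r_le: "cmod (r N t) \<le> cmod (h t)" for N t by (simp add: r_def)
  have [measurable]: "r N \<in> borel_measurable borel" for N unfolding r_def by measurable
  have rL: "r N \<in> L2 lborel" for N
    unfolding L2_def using L2_integrable[OF h] r_le
    by (auto intro!: Bochner_Integration.integrable_bound[of lborel "\<lambda>t. (cmod (h t))\<^sup>2"] power_mono)
  have "(\<lambda>N. sqnorm lborel (r N)) \<longlonglongrightarrow> (LINT t|(lborel :: real measure). 0)"
    unfolding sqnorm_def
  proof (rule integral_dominated_convergence[where w="\<lambda>t. (cmod (h t))\<^sup>2"])
    show "AE t in lborel. (\<lambda>N. (cmod (r N t))\<^sup>2) \<longlonglongrightarrow> 0"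
    proof (intro AE_I2 tendsto_eventually)
      fix t
      obtain N0 where "cmod (h t) \<le> real N0" using real_arch_simple by blast
      then show "\<forall>\<^sub>F N in sequentially. (cmod (r N t))\<^sup>2 = 0"
        by (intro eventually_sequentiallyI[of N0]) (auto simp: r_def)
    qed
    show "AE t in lborel. norm ((cmod (r N t))\<^sup>2) \<le> (cmod (h t))\<^sup>2" for N
      using r_le by (intro AE_I2) (auto intro: power_mono)
  qed (use L2_integrable[OF h] in auto)
  then have lim: "(\<lambda>N. 4 * sqnorm lborel h * sqnorm lborel (r N)) \<longlonglongrightarrow> 0"
    using tendsto_mult_right_zero by auto
  have "\<forall>\<^sub>F N in sequentially. 4 * sqnorm lborel h * sqnorm lborel (r N) < (e / 4)\<^sup>2"
    using e by (intro order_tendstoD[OF lim]) auto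
  \<comment> \<open>The squared L2 norm of \<open>d\<close> is at most four times that of
    \<open>h\<close>, so this makes the pairing with \<open>r N\<close> at most
    \<open>e / 4\<close>.\<close>
  then obtain N where N: "4 * sqnorm lborel h * sqnorm lborel (r N) < (e / 4)\<^sup>2"
    by (auto simp: eventually_sequentially)
  \<comment> \<open>The pairing with the bounded part costs a factor \<open>N\<close>; the
    \<open>+ 1\<close> covers \<open>N = 0\<close>.\<close>
  define e' where "e' = e / (4 * (real N + 1))"
  have e': "e' > 0" using e by (auto simp: e'_def)
  have "\<forall>\<^sub>F n in sequentially. (\<integral>\<^sup>+t. ennreal (cmod (h (u n + t) - h t)) \<partial>lborel) \<le> ennreal e'"
    using L1_translation_continuous[OF int e'] u by (rule eventually_compose_filterlim)
  then show "\<forall>\<^sub>F n in sequentially. dist (ip lborel (\<lambda>t. h (u n + t)) h) (of_real (sqnorm lborel h)) < e"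
  proof eventually_elim
    case (elim n)
    define d where "d = (\<lambda>t. h (u n + t) - h t)"
    define b where "b = (\<lambda>t. h t - r N t)"
    have [measurable]: "d \<in> borel_measurable borel" "b \<in> borel_measurable borel"
      unfolding d_def b_def by measurable
    have dL: "d \<in> L2 lborel" unfolding d_def by (intro L2_diff L2_translate h)
    have bL: "b \<in> L2 lborel" unfolding b_def by (intro L2_diff rL h)
    have bN: "cmod (b t) \<le> real N" for t by (auto simp: b_def r_def)
    have d1: "(\<integral>\<^sup>+t. ennreal (cmod (d t)) \<partial>lborel) \<le> ennreal e'"
      using elim by (simp add: d_def)
    have "ip lborel (\<lambda>t. h (u n + t)) h - of_real (sqnorm lborel h) = ip lborel d h"
      unfolding d_def by (simp add: ip_diff_left L2_translate h flip: ip_self)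
    also have "\<dots> = ip lborel d b + ip lborel d (r N)"
      using bL rL dL by (simp add: b_def ip_diff_right h)
    finally have split: "ip lborel (\<lambda>t. h (u n + t)) h - of_real (sqnorm lborel h)
      = ip lborel d b + ip lborel d (r N)" .
    have "(cmod (ip lborel d (r N)))\<^sup>2 \<le> sqnorm lborel d * sqnorm lborel (r N)"
      by (intro ip_Cauchy_Schwarz dL rL)
    also have "\<dots> \<le> (2 * sqnorm lborel h + 2 * sqnorm lborel h) * sqnorm lborel (r N)"
      using sqnorm_diff_le[OF L2_translate(1)[OF h] h] L2_translate(2)[OF h]
      by (intro mult_right_mono) (auto simp: d_def)
    also have "\<dots> \<le> (e / 4)\<^sup>2" using N by simp
    finally have "cmod (ip lborel d (r N)) \<le> e / 4"
      by (rule power2_le_imp_le) (use e in simp)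
    moreover have "cmod (ip lborel d b) \<le> e / 4"
    proof -
      have "ennreal (cmod (ip lborel d b)) \<le> (\<integral>\<^sup>+t. ennreal (cmod (d t * cnj (b t))) \<partial>lborel)"
        unfolding ip_def by (rule integral_norm_bound_ennreal[OF L2_integrable_mult[OF dL bL]])
      also have "\<dots> \<le> (\<integral>\<^sup>+t. ennreal (real N) * ennreal (cmod (d t)) \<partial>lborel)"
      proof (intro nn_integral_mono)
        fix t
        have "cmod (d t * cnj (b t)) \<le> real N * cmod (d t)"
          using mult_left_mono[OF bN[of t], of "cmod (d t)"] by (simp add: norm_mult mult.commute)
        then show "ennreal (cmod (d t * cnj (b t))) \<le> ennreal (real N) * ennreal (cmod (d t))"
          by (subst ennreal_mult[symmetric]) (auto intro: ennreal_leI)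
      qed
      also have "\<dots> = ennreal (real N) * (\<integral>\<^sup>+t. ennreal (cmod (d t)) \<partial>lborel)"
        by (simp add: nn_integral_cmult)
      also have "\<dots> \<le> ennreal (real N) * ennreal e'"
        using d1 by (intro mult_left_mono) auto
      also have "\<dots> = ennreal (real N * e')"
        using e' by (simp add: ennreal_mult)
      finally have "cmod (ip lborel d b) \<le> real N * e'"
        using e' by (simp add: ennreal_le_iff)
      also have "\<dots> \<le> (real N + 1) * e'"
        using e' by (intro mult_right_mono) auto
      also have "\<dots> = e / 4" by (simp add: e'_def field_simps)
      finally show ?thesis .
    qed
    ultimately show ?case
      using norm_triangle_ineq[of "ip lborel d b" "ip lborel d (r N)"] e
      unfolding dist_norm split by linarith
  qed
qed

section \<open>The Fourier transform and Plancherel's identity\<close>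

definition fourier :: "(real \<Rightarrow> complex) \<Rightarrow> real \<Rightarrow> complex" where
  "fourier h w = (LINT t|lborel. h t * cis (- (2 * pi * w * t)))"

lemma borel_measurable_cis [measurable]: "cis \<in> borel_measurable borel"
  by (intro borel_measurable_continuous_onI continuous_intros)

lemma borel_measurable_fourier [measurable]:
  assumes [measurable]: "h \<in> borel_measurable borel"
  shows "fourier h \<in> borel_measurable borel"
  unfolding fourier_def[abs_def] by measurable

lemma norm_fourier_le:
  assumes "integrable lborel h"
  shows "cmod (fourier h w) \<le> (LINT t|lborel. cmod (h t))"
proof -
  have "cmod (fourier h w) \<le> (LINT t|lborel. cmod (h t * cis (- (2 * pi * w * t))))"
    unfolding fourier_def by (rule integral_norm_bound)
  then show ?thesis by (simp add: norm_mult)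
qed

text \<open>The Gaussian makes Fubini's theorem applicable and turns the energy of the transform
  into a Gaussian average of the autocorrelation of \<open>h\<close> at scale \<open>sqrt a\<close>.
  As \<open>a\<close> tends to 0, the limits of both sides can be found.\<close>

lemma gaussian_summation:
  fixes h :: "real \<Rightarrow> complex"
  assumes h: "h \<in> L2 lborel" and int: "integrable lborel h" and a: "a > 0"
  shows "(LINT w|lborel. of_real (exp (- pi * a * w\<^sup>2)) * (fourier h w * cnj (fourier h w))) =
    (LINT v|lborel. of_real (exp (- pi * v\<^sup>2)) * cnj (ip lborel (\<lambda>t. h (sqrt a * v + t)) h))"
proof -
  note [measurable] = L2_borel_measurable[OF h]
  let ?E = "\<lambda>w. exp (- pi * a * w\<^sup>2)"
  let ?F = "fourier h"
  define B where "B = (LINT t|lborel. cmod (h t))"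
  have B: "B \<ge> 0" "cmod (?F w) \<le> B" for w
    unfolding B_def using norm_fourier_le[OF int] by auto
  have Bnn: "(\<integral>\<^sup>+t. ennreal (cmod (h t)) \<partial>lborel) = ennreal B"
    unfolding B_def using int by (intro nn_integral_eq_integral) auto
  have Efin: "(\<integral>\<^sup>+w. ennreal (?E w) \<partial>lborel) < \<infinity>"
    using gaussian_fourier(1)[OF a] by (simp add: integrable_iff_bounded)
  have E1fin: "(\<integral>\<^sup>+w. ennreal (exp (- pi * w\<^sup>2)) \<partial>lborel) < \<infinity>"
    using gaussian_fourier(1)[of 1] by (simp add: integrable_iff_bounded)
  \<comment> \<open>For fixed \<open>t\<close>, integrating over the frequency first gives the
    Fourier transform of the Gaussian at \<open>s - t\<close>; the substitution
    \<open>s = t + sqrt a * v\<close> absorbs the factor \<open>1 / sqrt a\<close>.\<close>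
  have inner: "(LINT w|lborel. of_real (?E w) * cis (- (2 * pi * w * t)) * cnj (?F w)) =
      (LINT v|lborel. of_real (exp (- pi * v\<^sup>2)) * cnj (h (t + sqrt a * v)))" for t
  proof -
    have "(LINT w|lborel. of_real (?E w) * cis (- (2 * pi * w * t)) * cnj (?F w)) =
      (LINT w|lborel. (LINT s|lborel. cnj (h s) * (of_real (?E w) * cis ((2 * pi * (s - t)) * w))))"
    proof (intro Bochner_Integration.integral_cong refl)
      fix w
      have "cnj (?F w) = (LINT s|lborel. cnj (h s * cis (- (2 * pi * w * s))))"
        unfolding fourier_def by (rule Bochner_Integration.integral_cnj[symmetric])
      then have "of_real (?E w) * cis (- (2 * pi * w * t)) * cnj (?F w) =
        (LINT s|lborel. of_real (?E w) * cis (- (2 * pi * w * t)) * cnj (h s * cis (- (2 * pi * w * s))))"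
        by (simp only: Bochner_Integration.integral_mult_right_zero)
      also have "\<dots> = (LINT s|lborel. cnj (h s) * (of_real (?E w) * cis ((2 * pi * (s - t)) * w)))"
      proof (intro Bochner_Integration.integral_cong refl)
        fix s
        have "cis ((2 * pi * (s - t)) * w) = cis (- (2 * pi * w * t)) * cis (2 * pi * w * s)"
          unfolding cis_mult by (rule arg_cong[of _ _ cis]) (simp add: algebra_simps)
        then show "of_real (?E w) * cis (- (2 * pi * w * t)) * cnj (h s * cis (- (2 * pi * w * s))) =
            cnj (h s) * (of_real (?E w) * cis ((2 * pi * (s - t)) * w))"
          by (simp add: cis_cnj)
      qed
      finally show "of_real (?E w) * cis (- (2 * pi * w * t)) * cnj (?F w) =
        (LINT s|lborel. cnj (h s) * (of_real (?E w) * cis ((2 * pi * (s - t)) * w)))" .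
    qed
    also have "\<dots> = (LINT s|lborel. (LINT w|lborel. cnj (h s) * (of_real (?E w) * cis ((2 * pi * (s - t)) * w))))"
    proof (rule lborel_pair.Fubini_integral_nn)
      have "(\<integral>\<^sup>+s. \<integral>\<^sup>+w. ennreal (cmod (cnj (h s) * (of_real (?E w) * cis ((2 * pi * (s - t)) * w)))) \<partial>lborel \<partial>lborel)
        = (\<integral>\<^sup>+s. \<integral>\<^sup>+w. ennreal (cmod (h s)) * ennreal (?E w) \<partial>lborel \<partial>lborel)"
        by (simp add: norm_mult ennreal_mult)
      also have "\<dots> = (\<integral>\<^sup>+s. ennreal (cmod (h s)) \<partial>lborel) * (\<integral>\<^sup>+w. ennreal (?E w) \<partial>lborel)"
        by (simp add: nn_integral_cmult nn_integral_multc)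
      finally show "(\<integral>\<^sup>+s. \<integral>\<^sup>+w. ennreal (cmod (cnj (h s) * (of_real (?E w) * cis ((2 * pi * (s - t)) * w)))) \<partial>lborel \<partial>lborel) < \<infinity>"
        using Efin by (simp add: Bnn ennreal_mult_less_top)
    qed measurable
    also have "\<dots> = (LINT s|lborel. cnj (h s) * of_real (exp (- (2 * pi * (s - t))\<^sup>2 / (4 * pi * a)) / sqrt a))"
      by (simp only: Bochner_Integration.integral_mult_right_zero gaussian_fourier(2)[OF a])
    also have "\<dots> = \<bar>sqrt a\<bar> *\<^sub>R (LINT v|lborel. cnj (h (t + sqrt a * v)) *
        of_real (exp (- (2 * pi * (t + sqrt a * v - t))\<^sup>2 / (4 * pi * a)) / sqrt a))"
      using a by (intro lborel_integral_real_affine) auto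
    also have "\<dots> = (LINT v|lborel. \<bar>sqrt a\<bar> *\<^sub>R (cnj (h (t + sqrt a * v)) *
        of_real (exp (- (2 * pi * (t + sqrt a * v - t))\<^sup>2 / (4 * pi * a)) / sqrt a)))"
      by simp
    also have "\<dots> = (LINT v|lborel. of_real (exp (- pi * v\<^sup>2)) * cnj (h (t + sqrt a * v)))"
    proof (intro Bochner_Integration.integral_cong refl)
      fix v
      have "- (2 * pi * (t + sqrt a * v - t))\<^sup>2 / (4 * pi * a) = - pi * v\<^sup>2"
        using a by (simp add: power_mult_distrib field_simps power2_eq_square)
      then show "\<bar>sqrt a\<bar> *\<^sub>R (cnj (h (t + sqrt a * v)) *
        of_real (exp (- (2 * pi * (t + sqrt a * v - t))\<^sup>2 / (4 * pi * a)) / sqrt a)) =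
        of_real (exp (- pi * v\<^sup>2)) * cnj (h (t + sqrt a * v))"
        using a by (simp only:) (simp add: scaleR_conv_of_real)
    qed
    finally show ?thesis .
  qed
  have "(LINT w|lborel. of_real (?E w) * (?F w * cnj (?F w))) =
    (LINT w|lborel. (LINT t|lborel. h t * (of_real (?E w) * cis (- (2 * pi * w * t)) * cnj (?F w))))"
  proof (intro Bochner_Integration.integral_cong refl)
    fix w
    have "of_real (?E w) * (?F w * cnj (?F w)) =
        (LINT t|lborel. (h t * cis (- (2 * pi * w * t))) * (of_real (?E w) * cnj (?F w)))"
      by (subst Bochner_Integration.integral_mult_left_zero) (simp add: fourier_def)
    then show "of_real (?E w) * (?F w * cnj (?F w)) =
        (LINT t|lborel. h t * (of_real (?E w) * cis (- (2 * pi * w * t)) * cnj (?F w)))"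
      by (simp add: mult_ac)
  qed
  also have "\<dots> = (LINT t|lborel. (LINT w|lborel. h t * (of_real (?E w) * cis (- (2 * pi * w * t)) * cnj (?F w))))"
  proof (rule lborel_pair.Fubini_integral_nn)
    have "(\<integral>\<^sup>+t. \<integral>\<^sup>+w. ennreal (cmod (h t * (of_real (?E w) * cis (- (2 * pi * w * t)) * cnj (?F w)))) \<partial>lborel \<partial>lborel)
      \<le> (\<integral>\<^sup>+t. \<integral>\<^sup>+w. ennreal (cmod (h t)) * (ennreal (?E w) * ennreal B) \<partial>lborel \<partial>lborel)"
    proof (intro nn_integral_mono)
      fix t w
      have "cmod (h t * (of_real (?E w) * cis (- (2 * pi * w * t)) * cnj (?F w))) \<le> cmod (h t) * (?E w * B)"
        using B by (simp add: norm_mult mult_left_mono)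
      then show "ennreal (cmod (h t * (of_real (?E w) * cis (- (2 * pi * w * t)) * cnj (?F w))))
          \<le> ennreal (cmod (h t)) * (ennreal (?E w) * ennreal B)"
        using B by (subst ennreal_mult[symmetric], simp, simp)+ (auto intro: ennreal_leI)
    qed
    also have "\<dots> = (\<integral>\<^sup>+t. ennreal (cmod (h t)) \<partial>lborel) * ((\<integral>\<^sup>+w. ennreal (?E w) \<partial>lborel) * ennreal B)"
      by (simp add: nn_integral_cmult nn_integral_multc)
    also have "\<dots> < \<infinity>" using Efin by (simp add: Bnn ennreal_mult_less_top)
    finally show "(\<integral>\<^sup>+t. \<integral>\<^sup>+w. ennreal (cmod (h t * (of_real (?E w) * cis (- (2 * pi * w * t)) * cnj (?F w)))) \<partial>lborel \<partial>lborel) < \<infinity>" .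
  qed measurable
  also have "\<dots> = (LINT t|lborel. h t * (LINT v|lborel. of_real (exp (- pi * v\<^sup>2)) * cnj (h (t + sqrt a * v))))"
    by (simp only: Bochner_Integration.integral_mult_right_zero inner)
  also have "\<dots> = (LINT t|lborel. (LINT v|lborel. h t * (of_real (exp (- pi * v\<^sup>2)) * cnj (h (t + sqrt a * v)))))"
    by (simp only: Bochner_Integration.integral_mult_right_zero)
  also have "\<dots> = (LINT v|lborel. (LINT t|lborel. h t * (of_real (exp (- pi * v\<^sup>2)) * cnj (h (t + sqrt a * v)))))"
  \<comment> \<open>Cauchy-Schwarz bounds the inner integral uniformly in \<open>v\<close>, so the
    Gaussian alone makes the double integral finite.\<close>
  proof (rule lborel_pair.Fubini_integral_nn)
    have "(\<integral>\<^sup>+t. ennreal (cmod (h t) * cmod (h (t + sqrt a * v))) \<partial>lborel) \<le> ennreal (sqnorm lborel h)" for v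
    proof -
      have "(\<integral>\<^sup>+t. ennreal (cmod (h t) * cmod (h (sqrt a * v + t))) \<partial>lborel)\<^sup>2 \<le> ennreal (sqnorm lborel h * sqnorm lborel h)"
        using sqnorm_mult_le[OF h L2_translate(1)[OF h]] L2_translate(2)[OF h] by simp
      then have "(\<integral>\<^sup>+t. ennreal (cmod (h t) * cmod (h (sqrt a * v + t))) \<partial>lborel)\<^sup>2 \<le> (ennreal (sqnorm lborel h))\<^sup>2"
        by (simp add: power2_eq_square ennreal_mult)
      then show ?thesis by (simp add: add.commute ennreal_power2_le_imp_le)
    qed
    then have "(\<integral>\<^sup>+v. \<integral>\<^sup>+t. ennreal (exp (- pi * v\<^sup>2)) * ennreal (cmod (h t) * cmod (h (t + sqrt a * v))) \<partial>lborel \<partial>lborel)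
      \<le> (\<integral>\<^sup>+v. ennreal (exp (- pi * v\<^sup>2)) * ennreal (sqnorm lborel h) \<partial>lborel)"
      by (intro nn_integral_mono) (simp add: nn_integral_cmult mult_left_mono)
    also have "\<dots> < \<infinity>" using E1fin by (simp add: nn_integral_multc ennreal_mult_less_top)
    finally show "(\<integral>\<^sup>+v. \<integral>\<^sup>+t. ennreal (cmod (h t * (of_real (exp (- pi * v\<^sup>2)) * cnj (h (t + sqrt a * v))))) \<partial>lborel \<partial>lborel) < \<infinity>"
      by (simp add: norm_mult ennreal_mult mult_ac)
  qed measurable
  also have "\<dots> = (LINT v|lborel. of_real (exp (- pi * v\<^sup>2)) * cnj (ip lborel (\<lambda>t. h (sqrt a * v + t)) h))"
  proof (intro Bochner_Integration.integral_cong refl)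
    fix v
    have "(LINT t|lborel. h t * (of_real (exp (- pi * v\<^sup>2)) * cnj (h (t + sqrt a * v)))) =
        (LINT t|lborel. of_real (exp (- pi * v\<^sup>2)) * (h t * cnj (h (sqrt a * v + t))))"
      by (simp only: mult.left_commute add.commute)
    also have "\<dots> = of_real (exp (- pi * v\<^sup>2)) * cnj (ip lborel (\<lambda>t. h (sqrt a * v + t)) h)"
      by (simp only: ip_commute) (simp only: ip_def Bochner_Integration.integral_mult_right_zero)
    finally show "(LINT t|lborel. h t * (of_real (exp (- pi * v\<^sup>2)) * cnj (h (t + sqrt a * v)))) =
        of_real (exp (- pi * v\<^sup>2)) * cnj (ip lborel (\<lambda>t. h (sqrt a * v + t)) h)" .
  qed
  finally show ?thesis .
qed

text \<open>Let \<open>a\<close> tend to 0 in \<open>gaussian_summation\<close>. The left side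
  increases to the full energy by monotone convergence, which presupposes no integrability of the
  squared transform; the right side converges by dominated convergence and
  \<open>autocorrelation_tendsto\<close>.\<close>

lemma Plancherel_L1_L2:
  fixes h :: "real \<Rightarrow> complex"
  assumes h: "h \<in> L2 lborel" and int: "integrable lborel h"
  shows "(\<integral>\<^sup>+w. ennreal ((cmod (fourier h w))\<^sup>2) \<partial>lborel) = ennreal (sqnorm lborel h)"
proof -
  note [measurable] = L2_borel_measurable[OF h]
  define a where "a n = 1 / real (Suc n)" for n
  have a: "a n > 0" for n by (simp add: a_def)
  have a0: "a \<longlonglongrightarrow> 0" unfolding a_def by (rule LIMSEQ_Suc[OF lim_1_over_n])
  define B where "B = (LINT t|lborel. cmod (h t))"
  have B: "B \<ge> 0" "cmod (fourier h w) \<le> B" for w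
    unfolding B_def using norm_fourier_le[OF int] by auto
  define J where "J n = (LINT w|lborel. exp (- pi * a n * w\<^sup>2) * (cmod (fourier h w))\<^sup>2)" for n
  have iJ: "integrable lborel (\<lambda>w. exp (- pi * a n * w\<^sup>2) * (cmod (fourier h w))\<^sup>2)" for n
  proof (rule Bochner_Integration.integrable_bound)
    show "integrable lborel (\<lambda>w. exp (- pi * a n * w\<^sup>2) * B\<^sup>2)"
      using gaussian_fourier(1)[OF a] by simp
    show "AE w in lborel. norm (exp (- pi * a n * w\<^sup>2) * (cmod (fourier h w))\<^sup>2)
        \<le> norm (exp (- pi * a n * w\<^sup>2) * B\<^sup>2)"
      using B by (intro AE_I2) (auto intro!: mult_left_mono power_mono)
  qed measurable
  have J_eq: "complex_of_real (J n) =
      (LINT v|lborel. of_real (exp (- pi * v\<^sup>2)) * cnj (ip lborel (\<lambda>t. h (sqrt (a n) * v + t)) h))" for n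
  proof -
    have "complex_of_real (J n) =
        (LINT w|lborel. of_real (exp (- pi * a n * w\<^sup>2) * (cmod (fourier h w))\<^sup>2))"
      unfolding J_def by (rule integral_complex_of_real[symmetric])
    also have "\<dots> = (LINT w|lborel. of_real (exp (- pi * a n * w\<^sup>2)) * (fourier h w * cnj (fourier h w)))"
      by (simp only: of_real_mult complex_norm_square)
    finally show ?thesis using gaussian_summation[OF h int a] by simp
  qed
  have "(\<lambda>n. (LINT v|lborel. of_real (exp (- pi * v\<^sup>2)) * cnj (ip lborel (\<lambda>t. h (sqrt (a n) * v + t)) h)))
    \<longlonglongrightarrow> (LINT v|lborel. of_real (exp (- pi * v\<^sup>2)) * of_real (sqnorm lborel h))"
  proof (rule integral_dominated_convergence[where w="\<lambda>v. exp (- pi * v\<^sup>2) * sqnorm lborel h"])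
    show "AE v in lborel. (\<lambda>n. of_real (exp (- pi * v\<^sup>2)) * cnj (ip lborel (\<lambda>t. h (sqrt (a n) * v + t)) h))
      \<longlonglongrightarrow> of_real (exp (- pi * v\<^sup>2)) * of_real (sqnorm lborel h)"
    proof (intro AE_I2)
      fix v
      have "(\<lambda>n. sqrt (a n) * v) \<longlonglongrightarrow> sqrt 0 * v" by (intro tendsto_intros a0)
      then have "(\<lambda>n. ip lborel (\<lambda>t. h (sqrt (a n) * v + t)) h) \<longlonglongrightarrow> of_real (sqnorm lborel h)"
        by (intro autocorrelation_tendsto h int) simp
      then have "(\<lambda>n. of_real (exp (- pi * v\<^sup>2)) * cnj (ip lborel (\<lambda>t. h (sqrt (a n) * v + t)) h))
        \<longlonglongrightarrow> of_real (exp (- pi * v\<^sup>2)) * cnj (of_real (sqnorm lborel h))"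
        by (intro tendsto_intros)
      then show "(\<lambda>n. of_real (exp (- pi * v\<^sup>2)) * cnj (ip lborel (\<lambda>t. h (sqrt (a n) * v + t)) h))
        \<longlonglongrightarrow> of_real (exp (- pi * v\<^sup>2)) * of_real (sqnorm lborel h)" by simp
    qed
    show "AE v in lborel. norm (of_real (exp (- pi * v\<^sup>2)) * cnj (ip lborel (\<lambda>t. h (sqrt (a n) * v + t)) h))
       \<le> exp (- pi * v\<^sup>2) * sqnorm lborel h" for n
    proof (intro AE_I2)
      fix v
      have "(cmod (ip lborel (\<lambda>t. h (sqrt (a n) * v + t)) h))\<^sup>2 \<le> (sqnorm lborel h)\<^sup>2"
        using ip_Cauchy_Schwarz[OF L2_translate(1)[OF h] h] L2_translate(2)[OF h] by (simp add: power2_eq_square)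
      then have "cmod (ip lborel (\<lambda>t. h (sqrt (a n) * v + t)) h) \<le> sqnorm lborel h"
        by (rule power2_le_imp_le) simp
      then show "norm (of_real (exp (- pi * v\<^sup>2)) * cnj (ip lborel (\<lambda>t. h (sqrt (a n) * v + t)) h))
       \<le> exp (- pi * v\<^sup>2) * sqnorm lborel h"
        by (simp add: norm_mult mult_left_mono)
    qed
    show "integrable lborel (\<lambda>v. exp (- pi * v\<^sup>2) * sqnorm lborel h)"
      using gaussian_fourier(1)[of 1] by simp
  qed (unfold ip_def, measurable)
  moreover have "(LINT v|lborel. of_real (exp (- pi * v\<^sup>2)) * complex_of_real (sqnorm lborel h)) = of_real (sqnorm lborel h)"
    using gaussian_fourier(2)[of 1 0] by (subst Bochner_Integration.integral_mult_left_zero) simp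
  ultimately have "(\<lambda>n. complex_of_real (J n)) \<longlonglongrightarrow> of_real (sqnorm lborel h)"
    by (simp only: J_eq)
  then have "J \<longlonglongrightarrow> sqnorm lborel h" by (rule tendsto_of_real_iff[THEN iffD1])
  then have 1: "(\<lambda>n. ennreal (J n)) \<longlonglongrightarrow> ennreal (sqnorm lborel h)"
    by (rule tendsto_ennrealI)
  have "(\<lambda>n. (\<integral>\<^sup>+w. ennreal (exp (- pi * a n * w\<^sup>2) * (cmod (fourier h w))\<^sup>2) \<partial>lborel))
    \<longlonglongrightarrow> (\<integral>\<^sup>+w. ennreal ((cmod (fourier h w))\<^sup>2) \<partial>lborel)"
  proof (rule nn_integral_LIMSEQ)
    show "incseq (\<lambda>n w. ennreal (exp (- pi * a n * w\<^sup>2) * (cmod (fourier h w))\<^sup>2))"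
      by (intro incseq_SucI le_funI ennreal_leI mult_right_mono)
        (auto simp: a_def intro!: mult_right_mono mult_left_mono divide_left_mono)
    show "(\<lambda>n. ennreal (exp (- pi * a n * w\<^sup>2) * (cmod (fourier h w))\<^sup>2)) \<longlonglongrightarrow> ennreal ((cmod (fourier h w))\<^sup>2)" for w
    proof (rule tendsto_ennrealI)
      have "(\<lambda>n. exp (- pi * a n * w\<^sup>2) * (cmod (fourier h w))\<^sup>2) \<longlonglongrightarrow> exp (- pi * 0 * w\<^sup>2) * (cmod (fourier h w))\<^sup>2"
        by (intro tendsto_intros a0)
      then show "(\<lambda>n. exp (- pi * a n * w\<^sup>2) * (cmod (fourier h w))\<^sup>2) \<longlonglongrightarrow> (cmod (fourier h w))\<^sup>2" by simp
    qed
  qed measurable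
  moreover have "(\<integral>\<^sup>+w. ennreal (exp (- pi * a n * w\<^sup>2) * (cmod (fourier h w))\<^sup>2) \<partial>lborel) = ennreal (J n)" for n
    unfolding J_def by (intro nn_integral_eq_integral iJ) auto
  ultimately have "(\<lambda>n. ennreal (J n)) \<longlonglongrightarrow> (\<integral>\<^sup>+w. ennreal ((cmod (fourier h w))\<^sup>2) \<partial>lborel)" by simp
  with 1 show ?thesis using LIMSEQ_unique by blast
qed


section \<open>The short-time Fourier transform and Moyal's identity\<close>

lemma stft_eq_fourier: "stft \<phi> f (x, w) = fourier (\<lambda>t. f t * cnj (\<phi> (t - x))) w"
proof -
  have "cnj (exp (2 * of_real pi * \<i> * of_real w * of_real t)) = cis (- (2 * pi * w * t))" for t
    by (simp add: cis_conv_exp exp_cnj mult_ac)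
  then show ?thesis
    by (simp add: stft_def l2_inner_def fourier_def tf_shift_def mult_ac)
qed

lemma borel_measurable_stft [measurable]:
  assumes [measurable]: "\<phi> \<in> borel_measurable borel" "f \<in> borel_measurable borel"
  shows "stft \<phi> f \<in> borel_measurable borel"
proof -
  have "stft \<phi> f = (\<lambda>z. LINT t|lborel. f t * cnj (\<phi> (t - fst z)) * cis (- (2 * pi * snd z * t)))"
    by (auto simp: stft_eq_fourier fourier_def fun_eq_iff)
  also have "\<dots> \<in> borel_measurable (borel \<Otimes>\<^sub>M borel)" by measurable
  finally show ?thesis by (simp add: borel_prod)
qed

lemma nn_integral_plane:
  fixes F :: "real \<times> real \<Rightarrow> ennreal"
  assumes [measurable]: "F \<in> borel_measurable borel"
  shows "(\<integral>\<^sup>+z. F z \<partial>lborel) = (\<integral>\<^sup>+x. \<integral>\<^sup>+y. F (x, y) \<partial>lborel \<partial>lborel)"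
proof -
  have "F \<in> borel_measurable (lborel \<Otimes>\<^sub>M lborel)"
    by (simp add: lborel_prod)
  from lborel.nn_integral_fst[OF this] show ?thesis by (simp add: lborel_prod)
qed

lemma L2_reflect:
  fixes f :: "real \<Rightarrow> complex"
  assumes "f \<in> L2 lborel"
  shows "(\<integral>\<^sup>+x. ennreal ((cmod (f (t - x)))\<^sup>2) \<partial>lborel) = ennreal (sqnorm lborel f)"
proof -
  note [measurable] = L2_borel_measurable[OF assms]
  have "ennreal (sqnorm lborel f) = (\<integral>\<^sup>+x. ennreal ((cmod (f x))\<^sup>2) \<partial>lborel)"
    by (simp add: nn_integral_sqnorm assms)
  also have "\<dots> = ennreal \<bar>- 1\<bar> * (\<integral>\<^sup>+x. ennreal ((cmod (f (t + (- 1) * x)))\<^sup>2) \<partial>lborel)"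
    by (rule nn_integral_real_affine) auto
  finally show ?thesis by simp
qed

text \<open>For fixed \<open>x\<close> the transform is the Fourier transform of the slice
  \<open>h x\<close>, so Plancherel's identity in the frequency and Tonelli's theorem in
  \<open>x\<close> and \<open>t\<close> give the result.\<close>

theorem Moyal:
  assumes f: "f \<in> L2 lborel" and \<phi>: "\<phi> \<in> L2 lborel"
  shows "(\<integral>\<^sup>+z. ennreal ((cmod (stft \<phi> f z))\<^sup>2) \<partial>lborel) = ennreal (sqnorm lborel f * sqnorm lborel \<phi>)"
proof -
  note [measurable] = L2_borel_measurable[OF f] L2_borel_measurable[OF \<phi>]
  define h where "h x = (\<lambda>t. f t * cnj (\<phi> (t - x)))" for x
  have \<phi>x: "(\<lambda>t. \<phi> (t - x)) \<in> L2 lborel" for x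
    using L2_translate(1)[OF \<phi>, of "- x"] by (simp add: add.commute)
  have hm [measurable]: "h x \<in> borel_measurable borel" for x
    unfolding h_def by measurable
  have hi: "integrable lborel (h x)" for x
    unfolding h_def by (rule L2_integrable_mult[OF f \<phi>x])
  have sq: "(\<integral>\<^sup>+x. \<integral>\<^sup>+t. ennreal ((cmod (h x t))\<^sup>2) \<partial>lborel \<partial>lborel) = ennreal (sqnorm lborel f * sqnorm lborel \<phi>)"
  proof -
    have "(\<integral>\<^sup>+x. \<integral>\<^sup>+t. ennreal ((cmod (h x t))\<^sup>2) \<partial>lborel \<partial>lborel) =
      (\<integral>\<^sup>+x. \<integral>\<^sup>+t. ennreal ((cmod (f t))\<^sup>2) * ennreal ((cmod (\<phi> (t - x)))\<^sup>2) \<partial>lborel \<partial>lborel)"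
      by (simp add: h_def norm_mult power_mult_distrib ennreal_mult)
    also have "\<dots> = (\<integral>\<^sup>+t. \<integral>\<^sup>+x. ennreal ((cmod (f t))\<^sup>2) * ennreal ((cmod (\<phi> (t - x)))\<^sup>2) \<partial>lborel \<partial>lborel)"
      by (rule lborel_pair.Fubini') measurable
    also have "\<dots> = ennreal (sqnorm lborel f * sqnorm lborel \<phi>)"
      by (simp add: nn_integral_cmult nn_integral_multc L2_reflect \<phi> nn_integral_sqnorm f ennreal_mult)
    finally show ?thesis .
  qed
  \<comment> \<open>Every slice is integrable but need not be square-integrable; by
    \<open>sq\<close> it is so for almost all \<open>x\<close>, which is enough under the
    integral.\<close>
  have fin: "AE x in lborel. (\<integral>\<^sup>+t. ennreal ((cmod (h x t))\<^sup>2) \<partial>lborel) \<noteq> \<infinity>"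
    by (rule nn_integral_PInf_AE) (use sq in \<open>auto simp: h_def\<close>)
  have "(\<integral>\<^sup>+z. ennreal ((cmod (stft \<phi> f z))\<^sup>2) \<partial>lborel) =
    (\<integral>\<^sup>+x. \<integral>\<^sup>+w. ennreal ((cmod (fourier (h x) w))\<^sup>2) \<partial>lborel \<partial>lborel)"
    by (subst nn_integral_plane) (auto simp: stft_eq_fourier h_def)
  also have "\<dots> = (\<integral>\<^sup>+x. \<integral>\<^sup>+t. ennreal ((cmod (h x t))\<^sup>2) \<partial>lborel \<partial>lborel)"
  proof (rule nn_integral_cong_AE, use fin in eventually_elim)
    fix x
    assume "(\<integral>\<^sup>+t. ennreal ((cmod (h x t))\<^sup>2) \<partial>lborel) \<noteq> \<infinity>"
    then have "h x \<in> L2 lborel" by (intro L2I_nn_integral) (auto simp: less_top)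
    then show "(\<integral>\<^sup>+w. ennreal ((cmod (fourier (h x) w))\<^sup>2) \<partial>lborel) = (\<integral>\<^sup>+t. ennreal ((cmod (h x t))\<^sup>2) \<partial>lborel)"
      by (simp add: Plancherel_L1_L2 hi nn_integral_sqnorm)
  qed
  also note sq
  finally show ?thesis .
qed

lemma stft_L2:
  assumes "f \<in> L2 lborel" "\<phi> \<in> L2 lborel"
  shows "stft \<phi> f \<in> L2 lborel" "sqnorm lborel (stft \<phi> f) = sqnorm lborel f * sqnorm lborel \<phi>"
proof -
  note [measurable] = assms[THEN L2_borel_measurable]
  show L: "stft \<phi> f \<in> L2 lborel"
    by (rule L2I_nn_integral) (auto simp: Moyal assms)
  show "sqnorm lborel (stft \<phi> f) = sqnorm lborel f * sqnorm lborel \<phi>"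
    using Moyal[OF assms] nn_integral_sqnorm[OF L] by simp
qed

lemma tf_shift_L2:
  assumes "\<phi> \<in> L2 lborel"
  shows "tf_shift z \<phi> \<in> L2 lborel" "sqnorm lborel (tf_shift z \<phi>) = sqnorm lborel \<phi>"
proof -
  obtain x w where z: "z = (x, w)" by fastforce
  have tr: "(\<lambda>t. \<phi> (t - x)) \<in> L2 lborel" "sqnorm lborel (\<lambda>t. \<phi> (t - x)) = sqnorm lborel \<phi>"
    using L2_translate[OF assms, of "- x"] by (simp_all add: add.commute)
  note [measurable] = tr(1)[THEN L2_borel_measurable]
  have e: "exp (2 * of_real pi * \<i> * of_real w * of_real t) = cis (2 * pi * w * t)" for t
    by (simp add: cis_conv_exp mult_ac)
  have n: "cmod (tf_shift z \<phi> t) = cmod (\<phi> (t - x))" for t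
    by (simp add: tf_shift_def z norm_mult e)
  have "tf_shift z \<phi> = (\<lambda>t. cis (2 * pi * w * t) * \<phi> (t - x))"
    by (auto simp: tf_shift_def z e)
  also have "\<dots> \<in> borel_measurable borel" by measurable
  finally have "tf_shift z \<phi> \<in> borel_measurable borel" .
  then show "tf_shift z \<phi> \<in> L2 lborel"
    using tr(1) by (auto simp: L2_def n)
  show "sqnorm lborel (tf_shift z \<phi>) = sqnorm lborel \<phi>"
    using tr(2) by (simp add: sqnorm_def n)
qed

lemma stft_add:
  assumes "f \<in> L2 lborel" "g \<in> L2 lborel" "\<phi> \<in> L2 lborel"
  shows "stft \<phi> (\<lambda>t. f t + g t) z = stft \<phi> f z + stft \<phi> g z"
  unfolding stft_def l2_inner_eq_ip by (intro ip_add_left tf_shift_L2 assms)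

lemma stft_diff:
  assumes "f \<in> L2 lborel" "g \<in> L2 lborel" "\<phi> \<in> L2 lborel"
  shows "stft \<phi> (\<lambda>t. f t - g t) z = stft \<phi> f z - stft \<phi> g z"
  unfolding stft_def l2_inner_eq_ip by (intro ip_diff_left tf_shift_L2 assms)

lemma stft_cmult: "stft \<phi> (\<lambda>t. c * f t) z = c * stft \<phi> f z"
  unfolding stft_def l2_inner_eq_ip by (rule ip_cmult_left)

lemma stft_diff_window:
  assumes "f \<in> L2 lborel" "\<phi> \<in> L2 lborel" "\<psi> \<in> L2 lborel"
  shows "stft (\<lambda>t. \<phi> t - \<psi> t) f z = stft \<phi> f z - stft \<psi> f z"
proof -
  have "tf_shift z (\<lambda>t. \<phi> t - \<psi> t) = (\<lambda>t. tf_shift z \<phi> t - tf_shift z \<psi> t)"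
    by (auto simp: tf_shift_def algebra_simps split: prod.split)
  then show ?thesis
    unfolding stft_def l2_inner_eq_ip by (simp add: ip_diff_right tf_shift_L2 assms)
qed

text \<open>Polarization: the difference \<open>S\<close> of the two sesquilinear forms vanishes on
  the diagonal by \<open>Moyal\<close>; expanding it at \<open>f + h\<close> and at
  \<open>f + i h\<close> gives two linear equations that force \<open>S f h = 0\<close>.\<close>

theorem Moyal_ip:
  assumes f: "f \<in> L2 lborel" and h: "h \<in> L2 lborel" and g: "g \<in> L2 lborel" "sqnorm lborel g = 1"
  shows "ip lborel (stft g f) (stft g h) = ip lborel f h"
proof -
  define S where "S u v = ip lborel (stft g u) (stft g v) - ip lborel u v" for u v
  have S0: "S u u = 0" if "u \<in> L2 lborel" for u
    by (simp add: S_def ip_self stft_L2 that g)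
  have Sadd: "S (\<lambda>t. u t + v t) (\<lambda>t. u t + v t) = S u u + S u v + S v u + S v v"
    if "u \<in> L2 lborel" "v \<in> L2 lborel" for u v
  proof -
    have "stft g (\<lambda>t. u t + v t) = (\<lambda>z. stft g u z + stft g v z)"
      by (simp add: fun_eq_iff stft_add that g)
    then show ?thesis
      using that g by (simp add: S_def ip_add_left ip_add_right L2_add stft_L2)
  qed
  have "S f h + S h f = 0"
    using Sadd[OF f h] f h by (simp add: S0 L2_add)
  moreover have "- \<i> * S f h + \<i> * S h f = 0"
  proof -
    have ih: "(\<lambda>t. \<i> * h t) \<in> L2 lborel" by (intro L2_cmult h)
    have eq: "stft g (\<lambda>t. \<i> * h t) = (\<lambda>z. \<i> * stft g h z)"
      by (simp add: fun_eq_iff stft_cmult)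
    have "S f (\<lambda>t. \<i> * h t) = - \<i> * S f h" "S (\<lambda>t. \<i> * h t) f = \<i> * S h f"
      unfolding S_def eq by (simp_all add: ip_cmult_right ip_cmult_left algebra_simps)
    then show ?thesis
      using Sadd[OF f ih] f ih by (simp add: S0 L2_add)
  qed
  ultimately have "S f h = 0"
    by (simp add: complex_eq_iff)
  then show ?thesis by (simp add: S_def)
qed

section \<open>Localization operators and convolution estimates\<close>

lemma ip_cmod_le:
  assumes "f \<in> L2 M" "g \<in> L2 M"
  shows "cmod (ip M f g) \<le> sqrt (sqnorm M f * sqnorm M g)"
  using ip_Cauchy_Schwarz[OF assms] by (rule real_le_rsqrt)

lemma nn_integral_mult_le:
  assumes "f \<in> L2 M" "g \<in> L2 M"
  shows "(\<integral>\<^sup>+x. ennreal (cmod (f x) * cmod (g x)) \<partial>M) \<le> ennreal (sqrt (sqnorm M f * sqnorm M g))"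
  using sqnorm_mult_le[OF assms] by (rule ennreal_power2_le_imp_le[OF ord_le_eq_trans])
    (simp only: ennreal_power real_sqrt_pow2 mult_nonneg_nonneg sqnorm_nonneg real_sqrt_ge_zero)

lemma stft_bound:
  assumes "f \<in> L2 lborel" "\<phi> \<in> L2 lborel"
  shows "cmod (stft \<phi> f z) \<le> sqrt (sqnorm lborel f * sqnorm lborel \<phi>)"
  using ip_cmod_le[OF assms(1) tf_shift_L2(1)[OF assms(2)]]
  by (simp add: stft_def l2_inner_eq_ip tf_shift_L2(2)[OF assms(2)])

lemma borel_measurable_tf_shift:
  assumes [measurable]: "\<phi> \<in> borel_measurable borel"
  shows "(\<lambda>(z, t). tf_shift z \<phi> t) \<in> borel_measurable (lborel \<Otimes>\<^sub>M lborel)"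
proof -
  have e: "exp (2 * of_real pi * \<i> * of_real w * of_real t) = cis (2 * pi * w * t)" for w t
    by (simp add: cis_conv_exp mult_ac)
  have "(\<lambda>(z, t). tf_shift z \<phi> t) = (\<lambda>p. cis (2 * pi * snd (fst p) * snd p) * \<phi> (snd p - fst (fst p)))"
    by (auto simp: tf_shift_def e fun_eq_iff)
  also have "\<dots> \<in> borel_measurable ((lborel \<Otimes>\<^sub>M lborel) \<Otimes>\<^sub>M lborel)" by measurable
  finally show ?thesis by (simp add: lborel_prod)
qed

text \<open>The weak form of the operator, expressed by transforms alone: Fubini's theorem moves the
  pairing with \<open>h\<close> inside, where it becomes the transform of \<open>h\<close>.
  Cauchy-Schwarz bounds both pairings uniformly in \<open>z\<close>, and \<open>m\<close> in L1 does
  the rest.\<close>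

lemma loc_op_ip:
  assumes f: "f \<in> L2 lborel" and \<phi>: "\<phi> \<in> L2 lborel" and h: "h \<in> L2 lborel" and m: "integrable lborel m"
  shows "ip lborel (loc_op m \<phi> f) h = (LINT z|lborel. stft \<phi> f z * of_real (m z) * cnj (stft \<phi> h z))"
proof -
  note [measurable] = L2_borel_measurable[OF f] L2_borel_measurable[OF \<phi>] L2_borel_measurable[OF h]
    borel_measurable_tf_shift[OF L2_borel_measurable[OF \<phi>]]
  have [measurable]: "m \<in> borel_measurable borel" using m by auto
  define C where "C = sqrt (sqnorm lborel f * sqnorm lborel \<phi>) * sqrt (sqnorm lborel \<phi> * sqnorm lborel h)"
  have C: "C \<ge> 0" by (simp add: C_def)
  have "ip lborel (loc_op m \<phi> f) h =
    (LINT t|lborel. (LINT z|lborel. stft \<phi> f z * of_real (m z) * tf_shift z \<phi> t * cnj (h t)))"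
    unfolding ip_def loc_op_def by (simp only: Bochner_Integration.integral_mult_left_zero)
  also have "\<dots> = (LINT z|lborel. (LINT t|lborel. stft \<phi> f z * of_real (m z) * tf_shift z \<phi> t * cnj (h t)))"
  proof (rule lborel_pair.Fubini_integral_nn)
    have "(\<integral>\<^sup>+z. \<integral>\<^sup>+t. ennreal (cmod (stft \<phi> f z * of_real (m z) * tf_shift z \<phi> t * cnj (h t))) \<partial>lborel \<partial>lborel)
      \<le> (\<integral>\<^sup>+z. ennreal C * ennreal \<bar>m z\<bar> \<partial>lborel)"
    proof (intro nn_integral_mono)
      fix z
      note [measurable] = L2_borel_measurable[OF tf_shift_L2(1)[OF \<phi>, of z]]
      have "(\<integral>\<^sup>+t. ennreal (cmod (stft \<phi> f z * of_real (m z) * tf_shift z \<phi> t * cnj (h t))) \<partial>lborel) =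
        (\<integral>\<^sup>+t. ennreal (cmod (stft \<phi> f z) * \<bar>m z\<bar>) * ennreal (cmod (tf_shift z \<phi> t) * cmod (h t)) \<partial>lborel)"
        by (simp add: norm_mult mult.assoc flip: ennreal_mult)
      also have "\<dots> = ennreal (cmod (stft \<phi> f z) * \<bar>m z\<bar>) * (\<integral>\<^sup>+t. ennreal (cmod (tf_shift z \<phi> t) * cmod (h t)) \<partial>lborel)"
        by (intro nn_integral_cmult) measurable
      also have "\<dots> \<le> ennreal (sqrt (sqnorm lborel f * sqnorm lborel \<phi>) * \<bar>m z\<bar>) * ennreal (sqrt (sqnorm lborel \<phi> * sqnorm lborel h))"
        using nn_integral_mult_le[OF tf_shift_L2(1)[OF \<phi>, of z] h] stft_bound[OF f \<phi>, of z]
        by (intro mult_mono ennreal_leI mult_right_mono) (auto simp: tf_shift_L2(2)[OF \<phi>])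
      also have "\<dots> = ennreal C * ennreal \<bar>m z\<bar>"
        by (simp add: C_def mult_ac flip: ennreal_mult)
      finally show "(\<integral>\<^sup>+t. ennreal (cmod (stft \<phi> f z * of_real (m z) * tf_shift z \<phi> t * cnj (h t))) \<partial>lborel)
        \<le> ennreal C * ennreal \<bar>m z\<bar>" .
    qed
    also have "\<dots> < \<infinity>"
      using m C by (simp add: nn_integral_cmult ennreal_mult_less_top integrable_iff_bounded)
    finally show "(\<integral>\<^sup>+z. \<integral>\<^sup>+t. ennreal (cmod (stft \<phi> f z * of_real (m z) * tf_shift z \<phi> t * cnj (h t))) \<partial>lborel \<partial>lborel) < \<infinity>" .
  qed measurable
  also have "\<dots> = (LINT z|lborel. stft \<phi> f z * of_real (m z) * cnj (stft \<phi> h z))"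
  proof (intro Bochner_Integration.integral_cong refl)
    fix z
    have "(LINT t|lborel. stft \<phi> f z * of_real (m z) * tf_shift z \<phi> t * cnj (h t)) =
      stft \<phi> f z * of_real (m z) * ip lborel (tf_shift z \<phi>) h"
      unfolding ip_def by (subst Bochner_Integration.integral_mult_right_zero[symmetric]) (simp add: mult.assoc)
    then show "(LINT t|lborel. stft \<phi> f z * of_real (m z) * tf_shift z \<phi> t * cnj (h t)) =
      stft \<phi> f z * of_real (m z) * cnj (stft \<phi> h z)"
      by (simp add: stft_def l2_inner_eq_ip ip_commute)
  qed
  finally show ?thesis .
qed

lemma borel_measurable_loc_op:
  assumes [measurable]: "f \<in> borel_measurable borel" "\<phi> \<in> borel_measurable borel" "m \<in> borel_measurable borel"
  shows "loc_op m \<phi> f \<in> borel_measurable borel"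
proof -
  have [measurable]: "(\<lambda>p. tf_shift (snd p) \<phi> (fst p)) \<in> borel_measurable (lborel \<Otimes>\<^sub>M lborel)"
    using measurable_compose[OF measurable_pair_swap' borel_measurable_tf_shift[OF assms(2)]]
    by (simp add: case_prod_unfold)
  show ?thesis
    unfolding loc_op_def[abs_def] by measurable
qed

text \<open>Cauchy-Schwarz over \<open>E\<close>, which has finite measure, bounds the squared value
  at \<open>t\<close> by the integral over \<open>E\<close> of the squared shifted windows at
  \<open>t\<close>; integrating over \<open>t\<close> returns the norm of the window for every
  \<open>z\<close> in \<open>E\<close>.\<close>

lemma loc_op_indicator_L2:
  assumes f: "f \<in> L2 lborel" and \<phi>: "\<phi> \<in> L2 lborel" and E [measurable]: "E \<in> sets borel" and fin: "emeasure lborel E < \<infinity>"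
  shows "loc_op (indicator E) \<phi> f \<in> L2 lborel"
proof (rule L2I_nn_integral)
  note [measurable] = L2_borel_measurable[OF f] L2_borel_measurable[OF \<phi>]
    borel_measurable_tf_shift[OF L2_borel_measurable[OF \<phi>]]
  have "loc_op (indicator E) \<phi> f \<in> borel_measurable borel"
    by (intro borel_measurable_loc_op) measurable
  then show "loc_op (indicator E) \<phi> f \<in> borel_measurable lborel" by simp
  define C where "C = sqrt (sqnorm lborel f * sqnorm lborel \<phi>)"
  have C: "C \<ge> 0" "cmod (stft \<phi> f z) \<le> C" for z
    using stft_bound[OF f \<phi>] by (auto simp: C_def)
  have [measurable]: "(\<lambda>z. tf_shift z \<phi> t) \<in> borel_measurable borel" for t
    using measurable_compose[OF measurable_Pair2' borel_measurable_tf_shift[OF L2_borel_measurable[OF \<phi>]], of t]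
    by simp
  have pt: "ennreal ((cmod (loc_op (indicator E) \<phi> f t))\<^sup>2) \<le>
      (ennreal (C\<^sup>2) * emeasure lborel E) * (\<integral>\<^sup>+z. indicator E z * ennreal ((cmod (tf_shift z \<phi> t))\<^sup>2) \<partial>lborel)" for t
  proof -
    have "ennreal (cmod (loc_op (indicator E) \<phi> f t)) \<le>
      (\<integral>\<^sup>+z. ennreal (cmod (stft \<phi> f z * of_real (indicator E z) * tf_shift z \<phi> t)) \<partial>lborel)"
    proof (cases "integrable lborel (\<lambda>z. stft \<phi> f z * of_real (indicator E z) * tf_shift z \<phi> t)")
      case True
      then show ?thesis unfolding loc_op_def by (rule integral_norm_bound_ennreal)
    next
      \<comment> \<open>Without integrability the Bochner integral is 0 by default, so the bound
        holds trivially.\<close>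
      case False
      then show ?thesis by (simp add: loc_op_def not_integrable_integral_eq)
    qed
    also have "\<dots> \<le> (\<integral>\<^sup>+z. (ennreal C * indicator E z) * (indicator E z * ennreal (cmod (tf_shift z \<phi> t))) \<partial>lborel)"
      using C by (intro nn_integral_mono)
        (auto simp: norm_mult indicator_def intro!: mult_right_mono ennreal_leI simp flip: ennreal_mult)
    finally have "(ennreal (cmod (loc_op (indicator E) \<phi> f t)))\<^sup>2 \<le>
      (\<integral>\<^sup>+z. (ennreal C * indicator E z) * (indicator E z * ennreal (cmod (tf_shift z \<phi> t))) \<partial>lborel)\<^sup>2"
      by (intro power_mono) auto
    also have "\<dots> \<le> (\<integral>\<^sup>+z. (ennreal C * indicator E z)\<^sup>2 \<partial>lborel) *
        (\<integral>\<^sup>+z. (indicator E z * ennreal (cmod (tf_shift z \<phi> t)))\<^sup>2 \<partial>lborel)"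
      by (rule Cauchy_Schwarz_nn_integral) measurable
    also have "(\<lambda>z. (ennreal C * indicator E z)\<^sup>2) = (\<lambda>z. ennreal (C\<^sup>2) * indicator E z)"
      using C by (auto simp: fun_eq_iff indicator_def ennreal_power)
    also have "(\<integral>\<^sup>+z. ennreal (C\<^sup>2) * indicator E z \<partial>lborel) = ennreal (C\<^sup>2) * emeasure lborel E"
      by (subst nn_integral_cmult_indicator) auto
    also have "(\<lambda>z. (indicator E z * ennreal (cmod (tf_shift z \<phi> t)))\<^sup>2) = (\<lambda>z. indicator E z * ennreal ((cmod (tf_shift z \<phi> t))\<^sup>2))"
      by (auto simp: fun_eq_iff indicator_def ennreal_power)
    finally show ?thesis by (simp add: ennreal_power)
  qed
  have "(\<integral>\<^sup>+t. ennreal ((cmod (loc_op (indicator E) \<phi> f t))\<^sup>2) \<partial>lborel) \<le>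
    (\<integral>\<^sup>+t. (ennreal (C\<^sup>2) * emeasure lborel E) * (\<integral>\<^sup>+z. indicator E z * ennreal ((cmod (tf_shift z \<phi> t))\<^sup>2) \<partial>lborel) \<partial>lborel)"
    by (intro nn_integral_mono pt)
  also have "\<dots> = (ennreal (C\<^sup>2) * emeasure lborel E) * (\<integral>\<^sup>+t. (\<integral>\<^sup>+z. indicator E z * ennreal ((cmod (tf_shift z \<phi> t))\<^sup>2) \<partial>lborel) \<partial>lborel)"
    by (intro nn_integral_cmult) measurable
  also have "(\<integral>\<^sup>+t. (\<integral>\<^sup>+z. indicator E z * ennreal ((cmod (tf_shift z \<phi> t))\<^sup>2) \<partial>lborel) \<partial>lborel) =
    (\<integral>\<^sup>+z. (\<integral>\<^sup>+t. indicator E z * ennreal ((cmod (tf_shift z \<phi> t))\<^sup>2) \<partial>lborel) \<partial>lborel)"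
    by (rule lborel_pair.Fubini') measurable
  also have "\<dots> = (\<integral>\<^sup>+z. ennreal (sqnorm lborel \<phi>) * indicator E z \<partial>lborel)"
  proof (intro nn_integral_cong)
    fix z
    note T = tf_shift_L2[OF \<phi>, of z]
    note [measurable] = L2_borel_measurable[OF T(1)]
    show "(\<integral>\<^sup>+t. indicator E z * ennreal ((cmod (tf_shift z \<phi> t))\<^sup>2) \<partial>lborel) = ennreal (sqnorm lborel \<phi>) * indicator E z"
      using nn_integral_sqnorm[OF T(1)] T(2) by (simp add: nn_integral_cmult mult.commute)
  qed
  also have "\<dots> = ennreal (sqnorm lborel \<phi>) * emeasure lborel E"
    by (subst nn_integral_cmult_indicator) auto
  finally show "(\<integral>\<^sup>+t. ennreal ((cmod (loc_op (indicator E) \<phi> f t))\<^sup>2) \<partial>lborel) < \<infinity>"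
    by (rule le_less_trans) (use fin in \<open>simp add: ennreal_mult_less_top\<close>)
qed

text \<open>Covariance: substituting \<open>x + t\<close> for \<open>t\<close> moves the shift from
  the analysed function to the argument, up to a phase that the modulus removes.\<close>

lemma stft_tf_shift:
  "cmod (stft g (tf_shift z \<psi>) w) = cmod (stft g \<psi> (w - z))"
proof -
  obtain x \<omega> where z: "z = (x, \<omega>)" by fastforce
  obtain y \<nu> where w: "w = (y, \<nu>)" by fastforce
  have e: "exp (2 * of_real pi * \<i> * of_real w * of_real t) = cis (2 * pi * w * t)" for w t
    by (simp add: cis_conv_exp mult_ac)
  have "stft g (tf_shift z \<psi>) w =
    (LINT t|lborel. cis (2 * pi * \<omega> * t) * \<psi> (t - x) * cnj (cis (2 * pi * \<nu> * t) * g (t - y)))"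
    by (simp add: stft_def l2_inner_def tf_shift_def z w e)
  also have "\<dots> = \<bar>1\<bar> *\<^sub>R (LINT t|lborel. cis (2 * pi * \<omega> * (x + 1 * t)) * \<psi> ((x + 1 * t) - x) *
      cnj (cis (2 * pi * \<nu> * (x + 1 * t)) * g ((x + 1 * t) - y)))"
    by (rule lborel_integral_real_affine) simp
  also have "\<dots> = (LINT t|lborel. cis (2 * pi * (\<omega> - \<nu>) * x) * (\<psi> t * cnj (cis (2 * pi * (\<nu> - \<omega>) * t) * g (t - (y - x)))))"
  proof -
    have "cis (2 * pi * \<omega> * (x + t)) * cis (- (2 * pi * \<nu> * (x + t))) =
        cis (2 * pi * (\<omega> - \<nu>) * x) * cis (- (2 * pi * (\<nu> - \<omega>) * t))" for t
      unfolding cis_mult by (rule arg_cong[of _ _ cis]) (simp add: algebra_simps)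
    moreover have "A * B = C * D \<Longrightarrow> A * p * (B * q) = C * (p * (D * q))" for A B C D p q :: complex
      by algebra
    ultimately have "cis (2 * pi * \<omega> * (x + t)) * \<psi> t * cnj (cis (2 * pi * \<nu> * (x + t)) * g (x + t - y)) =
       cis (2 * pi * (\<omega> - \<nu>) * x) * (\<psi> t * cnj (cis (2 * pi * (\<nu> - \<omega>) * t) * g (x + t - y)))" for t
      unfolding complex_cnj_mult cis_cnj by blast
    moreover have "x + t - y = t - (y - x)" for t by simp
    ultimately have "cis (2 * pi * \<omega> * (x + t)) * \<psi> t * cnj (cis (2 * pi * \<nu> * (x + t)) * g (x + t - y)) =
       cis (2 * pi * (\<omega> - \<nu>) * x) * (\<psi> t * cnj (cis (2 * pi * (\<nu> - \<omega>) * t) * g (t - (y - x))))" for t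
      by metis
    moreover have "x + 1 * t - x = t" "x + 1 * t = x + t" for t by simp_all
    ultimately show ?thesis by (simp only: abs_one scaleR_one)
  qed
  also have "\<dots> = cis (2 * pi * (\<omega> - \<nu>) * x) * stft g \<psi> (w - z)"
    by (simp add: stft_def l2_inner_def tf_shift_def z w e)
  finally show ?thesis by (simp add: norm_mult)
qed

text \<open>
  \<open>u\<close> is the weak version of \<open>V\<^sub>g\<^sup>* (1\<^sub>E V\<^sub>g f)\<close>.
\<close>

definition stft_part :: "(real \<Rightarrow> complex) \<Rightarrow> (real \<times> real) set \<Rightarrow> (real \<Rightarrow> complex) \<Rightarrow> (real \<Rightarrow> complex) \<Rightarrow> bool" where
  "stft_part g E f u \<longleftrightarrow> u \<in> L2 lborel \<and>
     (\<forall>h\<in>L2 lborel. ip lborel u h = ip lborel (\<lambda>z. indicator E z * stft g f z) (stft g h))"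

lemma L2_indicator_mult:
  assumes f: "f \<in> L2 M" and [measurable]: "E \<in> sets M"
  shows "(\<lambda>z. indicator E z * f z) \<in> L2 M"
proof -
  note [measurable] = L2_measurable[OF f]
  show ?thesis
    unfolding L2_def using L2_integrable[OF f]
    by (auto intro!: Bochner_Integration.integrable_bound[of M "\<lambda>t. (cmod (f t))\<^sup>2"] simp: indicator_def)
qed

text \<open>By Moyal's identity the full plane gives back \<open>f\<close>, which makes
  \<open>stft_part_pointwise\<close> available for \<open>f\<close> itself.\<close>

lemma stft_part_UNIV:
  assumes "f \<in> L2 lborel" "g \<in> L2 lborel" "sqnorm lborel g = 1"
  shows "stft_part g UNIV f f"
  using assms by (auto simp: stft_part_def Moyal_ip)

lemma stft_part_loc_op:
  assumes f: "f \<in> L2 lborel" and g: "g \<in> L2 lborel" and E [measurable]: "E \<in> sets borel" and fin: "emeasure lborel E < \<infinity>"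
  shows "stft_part g E f (loc_op (indicator E) g f)"
proof -
  have "integrable lborel (indicator E :: real \<times> real \<Rightarrow> real)"
    using fin by simp
  note loc_op_ip[OF f g _ this]
  moreover have "(LINT z|lborel. stft g f z * of_real (indicator E z) * cnj (stft g h z)) =
      ip lborel (\<lambda>z. indicator E z * stft g f z) (stft g h)" for h
    unfolding ip_def by (intro Bochner_Integration.integral_cong) (auto simp: indicator_def)
  ultimately show ?thesis
    by (simp add: stft_part_def loc_op_indicator_L2[OF f g E fin])
qed

text \<open>The complement of a set of finite measure is out of reach of
  \<open>stft_part_loc_op\<close>; linearity and Moyal's identity identify its part as
  \<open>f - u\<close>.\<close>

lemma stft_part_Compl:
  assumes f: "f \<in> L2 lborel" and g: "g \<in> L2 lborel" "sqnorm lborel g = 1"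
    and E [measurable]: "E \<in> sets borel" and u: "stft_part g E f u"
  shows "stft_part g (- E) f (\<lambda>t. f t - u t)"
  unfolding stft_part_def
proof (intro conjI ballI)
  have uL: "u \<in> L2 lborel" using u by (simp add: stft_part_def)
  show "(\<lambda>t. f t - u t) \<in> L2 lborel" by (intro L2_diff f uL)
  fix h :: "real \<Rightarrow> complex" assume h: "h \<in> L2 lborel"
  have V: "stft g f \<in> L2 lborel" "stft g h \<in> L2 lborel" by (auto intro: stft_L2 f g h)
  have "ip lborel (\<lambda>t. f t - u t) h = ip lborel (stft g f) (stft g h) - ip lborel (\<lambda>z. indicator E z * stft g f z) (stft g h)"
    using u h by (simp add: ip_diff_left f uL stft_part_def Moyal_ip g)
  also have "\<dots> = ip lborel (\<lambda>z. stft g f z - indicator E z * stft g f z) (stft g h)"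
    by (subst ip_diff_left) (auto intro!: L2_indicator_mult V)
  also have "(\<lambda>z. stft g f z - indicator E z * stft g f z) = (\<lambda>z. indicator (- E) z * stft g f z)"
    by (auto simp: fun_eq_iff indicator_def)
  finally show "ip lborel (\<lambda>t. f t - u t) h = ip lborel (\<lambda>z. indicator (- E) z * stft g f z) (stft g h)" .
qed

text \<open>The weak identity is tested with \<open>u\<close> itself. The transform is an isometry,
  so Cauchy-Schwarz bounds the square of \<open>sqnorm lborel u\<close> by its product with
  \<open>sqnorm lborel F\<close>.\<close>

lemma stft_part_sqnorm:
  assumes f: "f \<in> L2 lborel" and g: "g \<in> L2 lborel" "sqnorm lborel g = 1"
    and E [measurable]: "E \<in> sets borel" and u: "stft_part g E f u"
  shows "ennreal (sqnorm lborel u) \<le> (\<integral>\<^sup>+z. indicator E z * ennreal ((cmod (stft g f z))\<^sup>2) \<partial>lborel)"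
proof -
  have uL: "u \<in> L2 lborel" using u by (simp add: stft_part_def)
  define F where "F = (\<lambda>z. indicator E z * stft g f z)"
  have F: "F \<in> L2 lborel" unfolding F_def by (intro L2_indicator_mult stft_L2 f g) auto
  have V: "stft g u \<in> L2 lborel" "sqnorm lborel (stft g u) = sqnorm lborel u"
    by (auto simp: stft_L2 uL g)
  have "(sqnorm lborel u)\<^sup>2 = (cmod (ip lborel u u))\<^sup>2" by (simp add: ip_self)
  also have "ip lborel u u = ip lborel F (stft g u)"
    using u uL by (simp add: stft_part_def F_def)
  also have "(cmod \<dots>)\<^sup>2 \<le> sqnorm lborel F * sqnorm lborel u"
    using ip_Cauchy_Schwarz[OF F V(1)] V(2) by simp
  finally have "sqnorm lborel u * sqnorm lborel u \<le> sqnorm lborel F * sqnorm lborel u"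
    by (simp add: power2_eq_square)
  \<comment> \<open>If \<open>sqnorm lborel u\<close> is 0 the claim is trivial, otherwise the
    factor cancels.\<close>
  then have "sqnorm lborel u \<le> sqnorm lborel F"
    using sqnorm_nonneg[of lborel u] sqnorm_nonneg[of lborel F] by (metis mult_right_le_imp_le order_le_less)
  then have "ennreal (sqnorm lborel u) \<le> (\<integral>\<^sup>+z. ennreal ((cmod (F z))\<^sup>2) \<partial>lborel)"
    by (simp add: nn_integral_sqnorm F ennreal_leI)
  also have "\<dots> = (\<integral>\<^sup>+z. indicator E z * ennreal ((cmod (stft g f z))\<^sup>2) \<partial>lborel)"
    by (intro nn_integral_cong) (auto simp: F_def indicator_def)
  finally show ?thesis .
qed

text \<open>The value at \<open>z\<close> is the pairing of \<open>u\<close> with the shifted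
  window, to which the weak identity applies; covariance turns the second factor into a translate. A
  change of window is thus controlled by a convolution with the modulus of
  \<open>stft g \<psi>\<close>.\<close>

lemma stft_part_pointwise:
  assumes f: "f \<in> L2 lborel" and g: "g \<in> L2 lborel" and \<psi>: "\<psi> \<in> L2 lborel"
    and E [measurable]: "E \<in> sets borel" and u: "stft_part g E f u"
  shows "ennreal (cmod (stft \<psi> u z)) \<le>
    (\<integral>\<^sup>+w. indicator E w * ennreal (cmod (stft g f w)) * ennreal (cmod (stft g \<psi> (w - z))) \<partial>lborel)"
proof -
  define F where "F = (\<lambda>z. indicator E z * stft g f z)"
  have F: "F \<in> L2 lborel" unfolding F_def by (intro L2_indicator_mult stft_L2 f g) auto
  have T: "stft g (tf_shift z \<psi>) \<in> L2 lborel" by (intro stft_L2 tf_shift_L2 \<psi> g)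
  have "stft \<psi> u z = ip lborel F (stft g (tf_shift z \<psi>))"
    using u tf_shift_L2(1)[OF \<psi>] by (simp add: stft_part_def F_def stft_def[of \<psi>] l2_inner_eq_ip)
  then have "ennreal (cmod (stft \<psi> u z)) \<le> (\<integral>\<^sup>+w. ennreal (cmod (F w * cnj (stft g (tf_shift z \<psi>) w))) \<partial>lborel)"
    unfolding ip_def using integral_norm_bound_ennreal[OF L2_integrable_mult[OF F T]] by simp
  also have "\<dots> = (\<integral>\<^sup>+w. indicator E w * ennreal (cmod (stft g f w)) * ennreal (cmod (stft g \<psi> (w - z))) \<partial>lborel)"
    by (intro nn_integral_cong) (auto simp: F_def indicator_def norm_mult stft_tf_shift ennreal_mult)
  finally show ?thesis .
qed

section \<open>Young's inequality\<close>

lemma nn_integral_lborel_reflect: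
  fixes f :: "'a :: euclidean_space \<Rightarrow> ennreal"
  assumes [measurable]: "f \<in> borel_measurable borel"
  shows "(\<integral>\<^sup>+x. f (c - x) \<partial>lborel) = (\<integral>\<^sup>+x. f x \<partial>lborel)"
proof -
  have "(\<integral>\<^sup>+x. f x \<partial>lborel) =
    (\<integral>\<^sup>+x. f x \<partial>density (distr lborel borel (\<lambda>x. c + (- 1) *\<^sub>R x)) (\<lambda>_. \<bar>- 1 :: real\<bar> ^ DIM('a)))"
    using lborel_affine[of "- 1" c] by simp
  also have "\<dots> = (\<integral>\<^sup>+x. f (c - x) \<partial>lborel)"
    by (simp add: density_1 nn_integral_distr)
  finally show ?thesis by simp
qed

text \<open>Cauchy-Schwarz for the measure with density \<open>K (w - z)\<close>, whose total mass
  does not depend on \<open>z\<close>, followed by Tonelli's theorem. The kernel is taken at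
  \<open>w - z\<close> because it arises so in \<open>stft_part_pointwise\<close>.\<close>

lemma Young_convolution_L2:
  fixes F K :: "'a :: euclidean_space \<Rightarrow> ennreal"
  assumes [measurable]: "F \<in> borel_measurable borel" "K \<in> borel_measurable borel"
  shows "(\<integral>\<^sup>+z. (\<integral>\<^sup>+w. F w * K (w - z) \<partial>lborel)\<^sup>2 \<partial>lborel) \<le> (\<integral>\<^sup>+w. K w \<partial>lborel)\<^sup>2 * (\<integral>\<^sup>+w. (F w)\<^sup>2 \<partial>lborel)"
proof -
  let ?k = "\<integral>\<^sup>+w. K w \<partial>lborel"
  have tr: "(\<integral>\<^sup>+w. K (w - z) \<partial>lborel) = ?k" for z
    using nn_integral_lborel_translate[of K "- z"] by simp
  have "(\<integral>\<^sup>+w. F w * K (w - z) \<partial>lborel)\<^sup>2 \<le> (\<integral>\<^sup>+w. (F w)\<^sup>2 * K (w - z) \<partial>lborel) * ?k" for z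
  proof -
    let ?N = "density lborel (\<lambda>w. K (w - z))"
    have "(\<integral>\<^sup>+w. F w * K (w - z) \<partial>lborel)\<^sup>2 = (\<integral>\<^sup>+w. F w * 1 \<partial>?N)\<^sup>2"
      by (simp add: nn_integral_density mult.commute)
    also have "\<dots> \<le> (\<integral>\<^sup>+w. (F w)\<^sup>2 \<partial>?N) * (\<integral>\<^sup>+w. 1\<^sup>2 \<partial>?N)"
      by (rule Cauchy_Schwarz_nn_integral) measurable
    also have "\<dots> = (\<integral>\<^sup>+w. (F w)\<^sup>2 * K (w - z) \<partial>lborel) * ?k"
      by (subst (1 2) nn_integral_density) (auto simp: tr mult.commute)
    finally show ?thesis .
  qed
  then have "(\<integral>\<^sup>+z. (\<integral>\<^sup>+w. F w * K (w - z) \<partial>lborel)\<^sup>2 \<partial>lborel) \<le>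
    (\<integral>\<^sup>+z. (\<integral>\<^sup>+w. (F w)\<^sup>2 * K (w - z) \<partial>lborel) * ?k \<partial>lborel)"
    by (intro nn_integral_mono) auto
  also have "\<dots> = (\<integral>\<^sup>+z. (\<integral>\<^sup>+w. (F w)\<^sup>2 * K (w - z) \<partial>lborel) \<partial>lborel) * ?k"
    by (intro nn_integral_multc) measurable
  also have "(\<integral>\<^sup>+z. (\<integral>\<^sup>+w. (F w)\<^sup>2 * K (w - z) \<partial>lborel) \<partial>lborel) = (\<integral>\<^sup>+w. (\<integral>\<^sup>+z. (F w)\<^sup>2 * K (w - z) \<partial>lborel) \<partial>lborel)"
    by (rule lborel_pair.Fubini') measurable
  also have "\<dots> = (\<integral>\<^sup>+w. (F w)\<^sup>2 * ?k \<partial>lborel)"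
    by (simp add: nn_integral_cmult nn_integral_lborel_reflect)
  also have "\<dots> = (\<integral>\<^sup>+w. (F w)\<^sup>2 \<partial>lborel) * ?k"
    by (intro nn_integral_multc) measurable
  finally show ?thesis by (simp add: power2_eq_square mult_ac)
qed

section \<open>The Gaussian window\<close>

lemma nn_integral_gaussian:
  assumes "a > 0"
  shows "(\<integral>\<^sup>+t. ennreal (exp (- pi * a * t\<^sup>2)) \<partial>lborel) = ennreal (1 / sqrt a)"
proof -
  have "complex_of_real (LINT t|lborel. exp (- pi * a * t\<^sup>2)) = of_real (1 / sqrt a)"
    using gaussian_fourier(2)[OF assms, of 0] by simp
  then have "(LINT t|lborel. exp (- pi * a * t\<^sup>2)) = 1 / sqrt a"
    by (simp only: of_real_eq_iff)
  then show ?thesis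
    using gaussian_fourier(1)[OF assms] by (simp add: nn_integral_eq_integral)
qed

lemma std_gaussian_measurable [measurable]: "std_gaussian \<in> borel_measurable borel"
  unfolding std_gaussian_def[abs_def] by measurable

lemma std_gaussian_L2: "std_gaussian \<in> L2 lborel" and sqnorm_std_gaussian: "sqnorm lborel std_gaussian = 1"
proof -
  have "(2 powr (1 / 4))\<^sup>2 = sqrt (2 :: real)"
    by (simp add: power2_eq_square powr_half_sqrt flip: powr_add)
  then have sq: "(cmod (std_gaussian t))\<^sup>2 = sqrt 2 * exp (- pi * 2 * t\<^sup>2)" for t
  proof -
    have "(exp (- pi * t\<^sup>2))\<^sup>2 = exp (- pi * 2 * t\<^sup>2)"
      unfolding exp_double[symmetric] by simp
    then show ?thesis
      using \<open>(2 powr (1 / 4))\<^sup>2 = sqrt (2 :: real)\<close>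
      by (simp only: std_gaussian_def norm_of_real power2_abs power_mult_distrib)
  qed
  have e: "(\<integral>\<^sup>+t. ennreal ((cmod (std_gaussian t))\<^sup>2) \<partial>lborel) = 1"
  proof -
    have "(\<integral>\<^sup>+t. ennreal ((cmod (std_gaussian t))\<^sup>2) \<partial>lborel) =
        (\<integral>\<^sup>+t. ennreal (sqrt 2) * ennreal (exp (- pi * 2 * t\<^sup>2)) \<partial>lborel)"
      using sq by (simp add: ennreal_mult)
    also have "\<dots> = ennreal (sqrt 2) * ennreal (1 / sqrt 2)"
      using nn_integral_gaussian[of 2] by (subst nn_integral_cmult) simp_all
    finally show ?thesis by (simp flip: ennreal_mult)
  qed
  then show L: "std_gaussian \<in> L2 lborel" by (intro L2I_nn_integral) auto
  show "sqnorm lborel std_gaussian = 1"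
    using nn_integral_sqnorm[OF L] e by (simp add: ennreal_eq_1)
qed

text \<open>Centring the integral at \<open>x / 2\<close> makes the product of the two Gaussians a
  multiple of a single Gaussian in \<open>s\<close> with parameter 2, to which
  \<open>gaussian_fourier\<close> applies.\<close>

lemma stft_std_gaussian:
  "cmod (stft std_gaussian std_gaussian (x, w)) = exp (- pi * (1/2) * x\<^sup>2) * exp (- pi * (1/2) * w\<^sup>2)"
proof -
  have s2: "(2 powr (1 / 4)) * (2 powr (1 / 4)) = sqrt (2 :: real)"
    by (simp add: powr_half_sqrt flip: powr_add)
  define c where "c = sqrt 2 * exp (- pi * (1/2) * x\<^sup>2)"
  have prod: "std_gaussian (x/2 + 1 * s) * cnj (std_gaussian (x/2 + 1 * s - x)) = of_real (c * exp (- pi * 2 * s\<^sup>2))" for s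
  proof -
    have "- pi * (x/2 + s)\<^sup>2 + - pi * (x/2 + s - x)\<^sup>2 = - pi * (1/2) * x\<^sup>2 + - pi * 2 * s\<^sup>2"
      by (simp add: power2_eq_square field_simps)
    then have "exp (- pi * (x/2 + s)\<^sup>2) * exp (- pi * (x/2 + s - x)\<^sup>2) = exp (- pi * (1/2) * x\<^sup>2) * exp (- pi * 2 * s\<^sup>2)"
      by (simp only: exp_add[symmetric])
    moreover have "std_gaussian (x/2 + s) * cnj (std_gaussian (x/2 + s - x)) =
      of_real ((2 powr (1 / 4)) * (2 powr (1 / 4)) * (exp (- pi * (x/2 + s)\<^sup>2) * exp (- pi * (x/2 + s - x)\<^sup>2)))"
      unfolding std_gaussian_def by (simp only: complex_cnj_complex_of_real of_real_mult[symmetric] mult_ac)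
    ultimately show ?thesis by (simp only: s2 c_def mult.assoc mult_1)
  qed
  have "stft std_gaussian std_gaussian (x, w) =
    (LINT t|lborel. std_gaussian t * cnj (std_gaussian (t - x)) * cis (- (2 * pi * w * t)))"
    by (simp add: stft_eq_fourier fourier_def)
  also have "\<dots> = \<bar>1\<bar> *\<^sub>R (LINT s|lborel. std_gaussian (x/2 + 1 * s) * cnj (std_gaussian (x/2 + 1 * s - x)) * cis (- (2 * pi * w * (x/2 + 1 * s))))"
    by (rule lborel_integral_real_affine) simp
  also have "\<dots> = (LINT s|lborel. (of_real c * cis (- (pi * w * x))) * (of_real (exp (- pi * 2 * s\<^sup>2)) * cis ((- 2 * pi * w) * s)))"
  proof -
    have cs: "cis (- (2 * pi * w * (x/2 + 1 * s))) = cis (- (pi * w * x)) * cis ((- 2 * pi * w) * s)" for s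
      unfolding cis_mult by (rule arg_cong[of _ _ cis]) (simp add: algebra_simps)
    have alg: "A * B * (C * D) = (A * C) * (B * D)" for A B C D :: complex by algebra
    show ?thesis unfolding prod cs of_real_mult alg abs_one scaleR_one ..
  qed
  also have "\<dots> = (of_real c * cis (- (pi * w * x))) * of_real (exp (- (- 2 * pi * w)\<^sup>2 / (4 * pi * 2)) / sqrt 2)"
    by (simp only: Bochner_Integration.integral_mult_right_zero gaussian_fourier(2)[OF zero_less_numeral])
  also have "- (- 2 * pi * w)\<^sup>2 / (4 * pi * 2) = - pi * (1/2) * w\<^sup>2"
    by (simp add: power2_eq_square)
  finally show ?thesis by (simp add: norm_mult c_def)
qed

lemma nn_integral_stft_std_gaussian:
  "(\<integral>\<^sup>+z. ennreal (cmod (stft std_gaussian std_gaussian z)) \<partial>lborel) < \<infinity>"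
proof -
  have "(\<integral>\<^sup>+z. ennreal (cmod (stft std_gaussian std_gaussian z)) \<partial>lborel) =
    (\<integral>\<^sup>+x. \<integral>\<^sup>+w. ennreal (exp (- pi * (1/2) * x\<^sup>2)) * ennreal (exp (- pi * (1/2) * w\<^sup>2)) \<partial>lborel \<partial>lborel)"
    by (subst nn_integral_plane) (simp_all add: stft_std_gaussian ennreal_mult)
  also have "\<dots> = (\<integral>\<^sup>+x. ennreal (exp (- pi * (1/2) * x\<^sup>2)) \<partial>lborel) * (\<integral>\<^sup>+w. ennreal (exp (- pi * (1/2) * w\<^sup>2)) \<partial>lborel)"
    by (simp add: nn_integral_cmult nn_integral_multc)
  finally show ?thesis
    using nn_integral_gaussian[of "1/2"] by (simp add: ennreal_mult_less_top)
qed

section \<open>Relatively separated sets\<close>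

lemma nn_integral_tail_small:
  fixes K :: "'a :: euclidean_space \<Rightarrow> ennreal" and e :: real
  assumes [measurable]: "K \<in> borel_measurable borel" and fin: "(\<integral>\<^sup>+u. K u \<partial>lborel) < \<infinity>" and e: "0 < e"
  shows "\<exists>R>0. \<forall>r\<ge>R. (\<integral>\<^sup>+u. K u * indicator {u. r \<le> norm u} u \<partial>lborel) \<le> ennreal e"
proof -
  have "(\<lambda>n. \<integral>\<^sup>+u. K u * indicator {u. real n \<le> norm u} u \<partial>lborel) \<longlonglongrightarrow> (\<integral>\<^sup>+(u::'a). 0 \<partial>lborel)"
  proof (rule nn_integral_dominated_convergence[where w=K])
    show "AE u in lborel. (\<lambda>n. K u * indicator {u. real n \<le> norm u} u) \<longlonglongrightarrow> 0"
    proof (intro AE_I2 tendsto_eventually)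
      fix u :: 'a
      obtain N :: nat where "norm u < real N" using reals_Archimedean2 by blast
      then show "\<forall>\<^sub>F n in sequentially. K u * indicator {u. real n \<le> norm u} u = 0"
        by (intro eventually_sequentiallyI[of N]) (auto simp: indicator_def)
    qed
  qed (use fin in \<open>auto simp: indicator_def\<close>)
  then have "\<forall>\<^sub>F n in sequentially. (\<integral>\<^sup>+u. K u * indicator {u. real n \<le> norm u} u \<partial>lborel) < ennreal e"
    using e by (intro order_tendstoD) auto
  then obtain n where n: "(\<integral>\<^sup>+u. K u * indicator {u. real n \<le> norm u} u \<partial>lborel) < ennreal e"
    by (auto simp: eventually_sequentially)
  show ?thesis
  \<comment> \<open>The index \<open>n\<close> may be 0; the \<open>+ 1\<close> keeps the radius
    positive.\<close>
  proof (intro exI[of _ "real n + 1"] conjI allI impI)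
    fix r assume "real n + 1 \<le> r"
    then have "(\<integral>\<^sup>+u. K u * indicator {u. r \<le> norm u} u \<partial>lborel) \<le> (\<integral>\<^sup>+u. K u * indicator {u. real n \<le> norm u} u \<partial>lborel)"
      by (intro nn_integral_mono mult_left_mono) (auto simp: indicator_def)
    with n show "(\<integral>\<^sup>+u. K u * indicator {u. r \<le> norm u} u \<partial>lborel) \<le> ennreal e" by simp
  qed simp
qed

lemma nn_integral_powr_line:
  fixes p :: real
  assumes p: "p > 1"
  shows "(\<integral>\<^sup>+x. ennreal ((1 + \<bar>x\<bar>) powr (- p)) \<partial>lborel) < \<infinity>"
proof -
  let ?f = "\<lambda>x :: real. (1 + \<bar>x\<bar>) powr (- p)"
  let ?F = "\<lambda>x :: real. (1 + x) powr (1 - p) / (1 - p)"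
  have half: "(\<integral>\<^sup>+x. ennreal (?f x) * indicator {0..} x \<partial>lborel) < \<infinity>"
  proof -
    have "(\<integral>\<^sup>+x. ennreal (?f x) * indicator {0..} x \<partial>lborel) = ennreal (0 - ?F 0)"
    proof (rule nn_integral_FTC_atLeast)
      show "DERIV ?F x :> ?f x" if "0 \<le> x" for x
      proof -
        have "((\<lambda>x. (1 + x) powr (1 - p)) has_real_derivative (1 - p) * (1 + x) powr (- p)) (at x)"
          using that by (auto intro!: derivative_eq_intros)
        from DERIV_cdivide[OF this, of "1 - p"] show ?thesis using p that by simp
      qed
      have "filterlim (\<lambda>x :: real. 1 + x) at_top at_top"
        by (intro filterlim_tendsto_add_at_top[OF tendsto_const] filterlim_ident)
      then have "((\<lambda>x. (1 + x) powr (1 - p)) \<longlongrightarrow> 0) at_top"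
        using p by (intro tendsto_neg_powr) auto
      then show "(?F \<longlongrightarrow> 0) at_top"
        by (intro tendsto_divide_zero)
    qed auto
    then show ?thesis by simp
  qed
  have "(\<integral>\<^sup>+x. ennreal (?f x) \<partial>lborel) \<le>
    (\<integral>\<^sup>+x. ennreal (?f x) * indicator {0..} x + ennreal (?f (0 - x)) * indicator {0..} (0 - x) \<partial>lborel)"
    by (intro nn_integral_mono) (auto simp: indicator_def)
  also have "\<dots> = (\<integral>\<^sup>+x. ennreal (?f x) * indicator {0..} x \<partial>lborel)
      + (\<integral>\<^sup>+x. ennreal (?f (0 - x)) * indicator {0..} (0 - x) \<partial>lborel)"
    by (intro nn_integral_add) auto
  also have "(\<integral>\<^sup>+x. ennreal (?f (0 - x)) * indicator {0..} (0 - x) \<partial>lborel) =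
      (\<integral>\<^sup>+x. ennreal (?f x) * indicator {0..} x \<partial>lborel)"
    by (rule nn_integral_lborel_reflect[of "\<lambda>x. ennreal (?f x) * indicator {0..} x"]) measurable
  finally show ?thesis using half by (auto simp: less_top intro: le_less_trans)
qed

text \<open>Half of the exponent is spent on each coordinate, and \<open>s / 2 > 1\<close> is what
  the two integrals over the line require.\<close>

lemma nn_integral_powr_plane:
  fixes s :: real
  assumes s: "s > 2"
  shows "(\<integral>\<^sup>+u. ennreal ((1 + norm (u :: real \<times> real)) powr (- s)) \<partial>lborel) < \<infinity>"
proof -
  have "(\<integral>\<^sup>+u. ennreal ((1 + norm (u :: real \<times> real)) powr (- s)) \<partial>lborel) \<le>
     (\<integral>\<^sup>+x. \<integral>\<^sup>+y. ennreal ((1 + \<bar>x\<bar>) powr (- (s/2))) * ennreal ((1 + \<bar>y\<bar>) powr (- (s/2))) \<partial>lborel \<partial>lborel)"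
  proof (subst nn_integral_plane, measurable, intro nn_integral_mono)
    fix x y :: real
    let ?n = "norm (x, y)"
    have xy: "\<bar>x\<bar> \<le> ?n" "\<bar>y\<bar> \<le> ?n"
      using norm_fst_le[of x y] norm_snd_le[of y x] by auto
    have "(1 + ?n) powr (- s) = (1 + ?n) powr (- (s/2)) * (1 + ?n) powr (- (s/2))"
      by (simp flip: powr_add)
    also have "\<dots> \<le> (1 + \<bar>x\<bar>) powr (- (s/2)) * (1 + \<bar>y\<bar>) powr (- (s/2))"
      using xy s by (intro mult_mono powr_mono2') auto
    finally show "ennreal ((1 + ?n) powr (- s)) \<le>
        ennreal ((1 + \<bar>x\<bar>) powr (- (s/2))) * ennreal ((1 + \<bar>y\<bar>) powr (- (s/2)))"
      by (subst ennreal_mult[symmetric]) (auto intro: ennreal_leI)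
  qed
  also have "\<dots> = (\<integral>\<^sup>+x. ennreal ((1 + \<bar>x\<bar>) powr (- (s/2))) \<partial>lborel) * (\<integral>\<^sup>+y. ennreal ((1 + \<bar>y\<bar>) powr (- (s/2))) \<partial>lborel)"
    by (simp add: nn_integral_cmult nn_integral_multc)
  also have "\<dots> < \<infinity>"
    using nn_integral_powr_line[of "s/2"] s by (simp add: ennreal_mult_less_top)
  finally show ?thesis .
qed

section \<open>Sums over relatively separated sets\<close>

lemma sets_borel_ball [measurable]: "ball (c :: 'a :: metric_space) r \<in> sets borel"
  by (rule borel_open[OF open_ball])

text \<open>A point \<open>w\<close> lies in the unit balls of boundedly many points of
  \<open>\<Gamma>\<close> only. Sums over \<open>\<Gamma>\<close> thus become integrals once each
  term has been spread over the unit ball around its index.\<close>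

lemma relatively_separated_sum:
  assumes "relatively_separated \<Gamma>"
  obtains N :: nat where "\<And>F (h :: real \<times> real \<Rightarrow> ennreal). finite F \<Longrightarrow> F \<subseteq> \<Gamma> \<Longrightarrow> h \<in> borel_measurable borel \<Longrightarrow>
    (\<Sum>\<gamma>\<in>F. \<integral>\<^sup>+w. h w * indicator (ball \<gamma> 1) w \<partial>lborel) \<le> of_nat N * (\<integral>\<^sup>+w. h w \<partial>lborel)"
proof -
  obtain N where N: "\<And>z. finite (\<Gamma> \<inter> ball z 1)" "\<And>z. card (\<Gamma> \<inter> ball z 1) \<le> N"
    using assms by (auto simp: relatively_separated_def)
  show ?thesis
  proof (rule that)
    fix F and h :: "real \<times> real \<Rightarrow> ennreal"
    assume F: "finite F" "F \<subseteq> \<Gamma>" and [measurable]: "h \<in> borel_measurable borel"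
    have cnt: "(\<Sum>\<gamma>\<in>F. indicator (ball \<gamma> 1) w :: ennreal) \<le> of_nat N" for w
    proof -
      have "(\<Sum>\<gamma>\<in>F. indicator (ball \<gamma> 1) w :: ennreal) = of_nat (card (F \<inter> ball w 1))"
      proof -
        have "(\<Sum>\<gamma>\<in>F. indicator (ball \<gamma> 1) w :: ennreal) = (\<Sum>\<gamma>\<in>F \<inter> ball w 1. 1)"
          using F by (intro sum.mono_neutral_cong_right) (auto simp: indicator_def dist_commute)
        then show ?thesis by simp
      qed
      moreover have "card (F \<inter> ball w 1) \<le> card (\<Gamma> \<inter> ball w 1)"
        using F N by (intro card_mono) auto
      ultimately show ?thesis using N(2)[of w] by (simp add: order_trans)
    qed
    have "(\<Sum>\<gamma>\<in>F. \<integral>\<^sup>+w. h w * indicator (ball \<gamma> 1) w \<partial>lborel) = (\<integral>\<^sup>+w. h w * (\<Sum>\<gamma>\<in>F. indicator (ball \<gamma> 1) w) \<partial>lborel)"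
      by (simp add: nn_integral_sum sum_distrib_left)
    also have "\<dots> \<le> (\<integral>\<^sup>+w. h w * of_nat N \<partial>lborel)"
      by (intro nn_integral_mono mult_left_mono cnt) auto
    also have "\<dots> = of_nat N * (\<integral>\<^sup>+w. h w \<partial>lborel)"
      by (subst nn_integral_multc) (auto simp: mult.commute)
    finally show "(\<Sum>\<gamma>\<in>F. \<integral>\<^sup>+w. h w * indicator (ball \<gamma> 1) w \<partial>lborel) \<le> of_nat N * (\<integral>\<^sup>+w. h w \<partial>lborel)" .
  qed
qed

lemma emeasure_ball_translate:
  fixes \<gamma> :: "'a :: euclidean_space"
  shows "emeasure lborel (ball \<gamma> r) = emeasure lborel (ball (0 :: 'a) r)"
proof -
  have "emeasure lborel (ball (0 :: 'a) r) = (\<integral>\<^sup>+x. indicator (ball 0 r) (x :: 'a) \<partial>lborel)" by simp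
  also have "\<dots> = (\<integral>\<^sup>+x. indicator (ball 0 r) (- \<gamma> + x) \<partial>lborel)"
    by (rule nn_integral_lborel_translate[symmetric]) measurable
  also have "\<dots> = (\<integral>\<^sup>+x. indicator (ball \<gamma> r) x \<partial>lborel)"
    by (intro nn_integral_cong) (auto simp: indicator_def dist_norm norm_minus_commute)
  finally show ?thesis by simp
qed

text \<open>Volume comparison: the unit balls around the points counted lie in the ball of radius
  \<open>R + 1\<close> around \<open>w\<close> and overlap boundedly often.\<close>

lemma relatively_separated_card:
  assumes "relatively_separated \<Gamma>"
  shows "\<exists>N :: real. 0 < N \<and> (\<forall>F w. finite F \<longrightarrow> F \<subseteq> \<Gamma> \<longrightarrow> real (card {\<gamma>\<in>F. norm (w - \<gamma>) \<le> R}) \<le> N)"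
proof -
  obtain N :: nat where N: "\<And>F (h :: real \<times> real \<Rightarrow> ennreal). finite F \<Longrightarrow> F \<subseteq> \<Gamma> \<Longrightarrow> h \<in> borel_measurable borel \<Longrightarrow>
    (\<Sum>\<gamma>\<in>F. \<integral>\<^sup>+w. h w * indicator (ball \<gamma> 1) w \<partial>lborel) \<le> of_nat N * (\<integral>\<^sup>+w. h w \<partial>lborel)"
    using relatively_separated_sum[OF assms] by blast
  define b where "b = measure lborel (ball (0 :: real \<times> real) 1)"
  define c where "c = measure lborel (ball (0 :: real \<times> real) (R + 1))"
  have b: "emeasure lborel (ball \<gamma> 1) = ennreal b" for \<gamma> :: "real \<times> real"
    unfolding b_def emeasure_ball_translate[of \<gamma>] by (rule emeasure_eq_ennreal_measure) (metis emeasure_lborel_ball_finite infinity_ennreal_def less_irrefl)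
  have c: "emeasure lborel (ball \<gamma> (R + 1)) = ennreal c" for \<gamma> :: "real \<times> real"
    unfolding c_def emeasure_ball_translate[of \<gamma>] by (rule emeasure_eq_ennreal_measure) (metis emeasure_lborel_ball_finite infinity_ennreal_def less_irrefl)
  have b0: "b > 0" unfolding b_def by (rule content_ball_pos) simp
  have c0: "c \<ge> 0" by (simp add: c_def)
  have *: "real (card {\<gamma>\<in>F. norm (w - \<gamma>) \<le> R}) \<le> real N * c / b" if F: "finite F" "F \<subseteq> \<Gamma>" for F w
  proof -
    let ?G = "{\<gamma>\<in>F. norm (w - \<gamma>) \<le> R}"
    have "ennreal (real (card ?G) * b) = (\<Sum>\<gamma>\<in>?G. emeasure lborel (ball \<gamma> 1))"
      using b0 by (simp add: b ennreal_mult ennreal_of_nat_eq_real_of_nat)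
    also have "\<dots> = (\<Sum>\<gamma>\<in>?G. \<integral>\<^sup>+v. indicator (ball w (R + 1)) v * indicator (ball \<gamma> 1) v \<partial>lborel)"
    proof (intro sum.cong refl)
      fix \<gamma> assume "\<gamma> \<in> ?G"
      then have "ball \<gamma> 1 \<subseteq> ball w (R + 1)"
        by (subst ball_subset_ball_iff) (auto simp: dist_norm norm_minus_commute)
      then have "(\<integral>\<^sup>+v. indicator (ball w (R + 1)) v * indicator (ball \<gamma> 1) v \<partial>lborel) = (\<integral>\<^sup>+v. indicator (ball \<gamma> 1) v \<partial>lborel)"
        by (intro nn_integral_cong) (auto simp: indicator_def)
      then show "emeasure lborel (ball \<gamma> 1) = (\<integral>\<^sup>+v. indicator (ball w (R + 1)) v * indicator (ball \<gamma> 1) v \<partial>lborel)" by simp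
    qed
    also have "\<dots> \<le> of_nat N * (\<integral>\<^sup>+v. indicator (ball w (R + 1)) v \<partial>lborel)"
      using F by (intro N) auto
    also have "\<dots> = ennreal (real N * c)"
      using c0 by (simp add: c ennreal_mult ennreal_of_nat_eq_real_of_nat)
    finally have "real (card ?G) * b \<le> real N * c"
      using c0 by (subst (asm) ennreal_le_iff) auto
    then show ?thesis using b0 by (simp add: field_simps)
  qed
  show ?thesis
  \<comment> \<open>The summand 1 makes the bound strictly positive; it later becomes a
    denominator.\<close>
  proof (intro exI[of _ "real N * c / b + 1"] conjI allI impI)
    show "0 < real N * c / b + 1" using b0 c0 by (intro add_nonneg_pos) auto
    show "real (card {\<gamma>\<in>F. norm (w - \<gamma>) \<le> R}) \<le> real N * c / b + 1" if "finite F" "F \<subseteq> \<Gamma>" for F w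
      using *[OF that, of w] by linarith
  qed
qed

text \<open>Each point of \<open>\<Gamma>\<close> lies within distance 1 of a countable dense set,
  and each element of that set has only finitely many points of \<open>\<Gamma>\<close> so
  close.\<close>

lemma relatively_separated_countable:
  assumes "relatively_separated \<Gamma>"
  shows "countable \<Gamma>"
proof -
  obtain D :: "(real \<times> real) set" where D: "countable D" "\<And>X. open X \<Longrightarrow> X \<noteq> {} \<Longrightarrow> \<exists>d\<in>D. d \<in> X"
    using countable_dense_setE by blast
  have "\<Gamma> \<subseteq> (\<Union>d\<in>D. \<Gamma> \<inter> ball d 1)"
  proof
    fix \<gamma> assume "\<gamma> \<in> \<Gamma>"
    moreover obtain d where "d \<in> D" "d \<in> ball \<gamma> 1" using D(2)[of "ball \<gamma> 1"] by auto
    ultimately show "\<gamma> \<in> (\<Union>d\<in>D. \<Gamma> \<inter> ball d 1)" by (auto simp: dist_commute)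
  qed
  moreover have "countable (\<Union>d\<in>D. \<Gamma> \<inter> ball d 1)"
    using assms D by (intro countable_UN) (auto simp: relatively_separated_def intro: countable_finite)
  ultimately show ?thesis by (rule countable_subset)
qed

text \<open>Each term is spread over the unit ball around its index, where the decaying function is
  comparable with its value at the centre. The sum is then at most a multiple of an integral over
  the complement of a ball, which is small because \<open>s > 2\<close>.\<close>

lemma relatively_separated_tail:
  fixes C s e :: real
  assumes "relatively_separated \<Gamma>" and s: "s > 2" and e: "e > 0" and C: "C \<ge> 0"
  shows "\<exists>R>0. \<forall>r\<ge>R. \<forall>F z. finite F \<longrightarrow> F \<subseteq> \<Gamma> \<longrightarrow>
    (\<Sum>\<gamma>\<in>F. if r \<le> norm (z - \<gamma>) then C * (1 + norm (z - \<gamma>)) powr (- s) else 0) \<le> e"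
proof -
  obtain N :: nat where N: "\<And>F (h :: real \<times> real \<Rightarrow> ennreal). finite F \<Longrightarrow> F \<subseteq> \<Gamma> \<Longrightarrow> h \<in> borel_measurable borel \<Longrightarrow>
    (\<Sum>\<gamma>\<in>F. \<integral>\<^sup>+w. h w * indicator (ball \<gamma> 1) w \<partial>lborel) \<le> of_nat N * (\<integral>\<^sup>+w. h w \<partial>lborel)"
    using relatively_separated_sum[OF assms(1)] by blast
  define b where "b = measure lborel (ball (0 :: real \<times> real) 1)"
  have b: "emeasure lborel (ball \<gamma> 1) = ennreal b" for \<gamma> :: "real \<times> real"
    unfolding b_def emeasure_ball_translate[of \<gamma>] by (rule emeasure_eq_ennreal_measure) (metis emeasure_lborel_ball_finite infinity_ennreal_def less_irrefl)
  have b0: "b > 0" unfolding b_def by (rule content_ball_pos) simp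
  define K where "K u = ennreal ((1 + norm (u :: real \<times> real)) powr (- s))" for u
  have [measurable]: "K \<in> borel_measurable borel" unfolding K_def by measurable
  define c where "c = 2 powr s * C * (real N + 1)"
  have c0: "c \<ge> 0" using C by (simp add: c_def)
  \<comment> \<open>The \<open>+ 1\<close> in the denominator covers \<open>C = 0\<close>; the
    factor \<open>b\<close>, the volume of a unit ball, is divided out at the end.\<close>
  define e' where "e' = e * b / (c + 1)"
  have e': "e' > 0" using e b0 c0 by (simp add: e'_def)
  obtain R where R: "R > 0" "\<And>r. r \<ge> R \<Longrightarrow> (\<integral>\<^sup>+u. K u * indicator {u. r \<le> norm u} u \<partial>lborel) \<le> ennreal e'"
    using nn_integral_tail_small[of K e'] nn_integral_powr_plane[OF s] e' unfolding K_def by auto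
  show ?thesis
  \<comment> \<open>The unit ball around a point at distance \<open>r\<close> reaches in to distance
    \<open>r - 1\<close>, so the radius grows by 1.\<close>
  proof (intro exI[of _ "R + 1"] conjI allI impI)
    show "R + 1 > 0" using R by simp
    fix r F and z :: "real \<times> real" assume r: "R + 1 \<le> r" and F: "finite F" "F \<subseteq> \<Gamma>"
    let ?t = "\<lambda>\<gamma>. if r \<le> norm (z - \<gamma>) then C * (1 + norm (z - \<gamma>)) powr (- s) else 0"
    let ?h = "\<lambda>w. ennreal (2 powr s * C) * (K (w - z) * indicator {u. r - 1 \<le> norm u} (w - z))"
    have pt: "ennreal (?t \<gamma>) * indicator (ball \<gamma> 1) w \<le> ?h w * indicator (ball \<gamma> 1) w" for \<gamma> w
    proof (cases "r \<le> norm (z - \<gamma>) \<and> w \<in> ball \<gamma> 1")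
      case True
      then have d: "norm (\<gamma> - w) < 1" by (simp add: dist_norm)
      have n1: "norm (w - z) \<le> norm (z - \<gamma>) + norm (\<gamma> - w)"
        using norm_triangle_ineq[of "z - \<gamma>" "\<gamma> - w"] by (simp add: norm_minus_commute)
      have n2: "norm (z - \<gamma>) \<le> norm (w - z) + norm (\<gamma> - w)"
        using norm_triangle_ineq[of "z - w" "w - \<gamma>"] by (simp add: norm_minus_commute)
      \<comment> \<open>On the unit ball \<open>1 + norm (w - z)\<close> is at most twice
        \<open>1 + norm (z - \<gamma>)\<close>; this costs the factor
        \<open>2 powr s\<close>.\<close>
      have "(1 + norm (z - \<gamma>)) powr (- s) = 2 powr s * (2 * (1 + norm (z - \<gamma>))) powr (- s)"
        by (subst powr_mult) (simp_all add: powr_minus)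
      also have "\<dots> \<le> 2 powr s * (1 + norm (w - z)) powr (- s)"
      proof (intro mult_left_mono powr_mono2')
        show "0 < 1 + norm (w - z)" using norm_ge_zero[of "w - z"] by linarith
        show "1 + norm (w - z) \<le> 2 * (1 + norm (z - \<gamma>))" 
        proof -
          have "norm (w - z) \<le> norm (z - \<gamma>) + 1" using n1 d by linarith
          moreover have "0 \<le> norm (z - \<gamma>)" by simp
          ultimately show ?thesis by (simp only: distrib_left mult_1_right)
        qed
      qed (use s in auto)
      finally have "C * (1 + norm (z - \<gamma>)) powr (- s) \<le> C * (2 powr s * (1 + norm (w - z)) powr (- s))"
        using C by (rule mult_left_mono)
      then have "C * (1 + norm (z - \<gamma>)) powr (- s) \<le> 2 powr s * C * (1 + norm (w - z)) powr (- s)"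
        by (simp only: mult_ac)
      then have "ennreal (?t \<gamma>) \<le> ennreal (2 powr s * C) * K (w - z)"
        using True C unfolding K_def by (subst ennreal_mult[symmetric]) (auto intro: ennreal_leI)
      moreover have "r - 1 \<le> norm (w - z)" using True n2 d by simp
      ultimately show ?thesis using True by simp
    qed (auto simp: indicator_def)
    have "ennreal ((\<Sum>\<gamma>\<in>F. ?t \<gamma>) * b) = (\<Sum>\<gamma>\<in>F. ennreal (?t \<gamma>) * emeasure lborel (ball \<gamma> 1))"
      using C b0 by (simp add: b ennreal_mult sum_nonneg flip: sum_ennreal sum_distrib_right)
    also have "\<dots> = (\<Sum>\<gamma>\<in>F. \<integral>\<^sup>+w. ennreal (?t \<gamma>) * indicator (ball \<gamma> 1) w \<partial>lborel)"
      by (intro sum.cong refl nn_integral_cmult_indicator[symmetric]) auto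
    also have "\<dots> \<le> (\<Sum>\<gamma>\<in>F. \<integral>\<^sup>+w. ?h w * indicator (ball \<gamma> 1) w \<partial>lborel)"
      by (intro sum_mono nn_integral_mono pt)
    also have "\<dots> \<le> of_nat N * (\<integral>\<^sup>+w. ?h w \<partial>lborel)"
      by (intro N F) measurable
    also have "(\<integral>\<^sup>+w. ?h w \<partial>lborel) = ennreal (2 powr s * C) * (\<integral>\<^sup>+w. K (w - z) * indicator {u. r - 1 \<le> norm u} (w - z) \<partial>lborel)"
      by (intro nn_integral_cmult) measurable
    also have "(\<integral>\<^sup>+w. K (w - z) * indicator {u. r - 1 \<le> norm u} (w - z) \<partial>lborel) = (\<integral>\<^sup>+u. K u * indicator {u. r - 1 \<le> norm u} u \<partial>lborel)"
      using nn_integral_lborel_translate[of "\<lambda>u. K u * indicator {u. r - 1 \<le> norm u} u" "- z"] by simp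
    also have "of_nat N * (ennreal (2 powr s * C) * \<dots>) \<le> of_nat N * (ennreal (2 powr s * C) * ennreal e')"
      using r by (intro mult_left_mono R) auto
    also have "\<dots> = ennreal (real N * (2 powr s * C * e'))"
      using C e' by (simp add: ennreal_mult ennreal_of_nat_eq_real_of_nat)
    finally have "(\<Sum>\<gamma>\<in>F. ?t \<gamma>) * b \<le> real N * (2 powr s * C * e')"
      using C e' by (subst (asm) ennreal_le_iff) auto
    also have "\<dots> \<le> c * e'"
      unfolding c_def using C e' by (simp add: algebra_simps)
    also have "\<dots> \<le> e * b"
      using c0 e b0 by (simp add: e'_def field_simps)
    finally show "(\<Sum>\<gamma>\<in>F. ?t \<gamma>) \<le> e" using b0 by simp
  qed
qed

section \<open>The grid of squares\<close>

definition grid_cell :: "real \<Rightarrow> real \<times> real \<Rightarrow> int \<times> int" where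
  "grid_cell R z = (\<lfloor>fst z / R\<rfloor>, \<lfloor>snd z / R\<rfloor>)"

text \<open>A square with a margin of one square on each side, so that points outside the block keep
  distance \<open>R\<close> from the central square. The block is attached to a cell and not to a
  point, since all indices in a cell are to share it.\<close>

definition grid_block :: "real \<Rightarrow> int \<times> int \<Rightarrow> (real \<times> real) set" where
  "grid_block R j = {w. \<bar>\<lfloor>fst w / R\<rfloor> - fst j\<bar> \<le> 1 \<and> \<bar>\<lfloor>snd w / R\<rfloor> - snd j\<bar> \<le> 1}"

lemma grid_block_borel [measurable]: "grid_block R j \<in> sets borel"
proof -
  have fl: "\<bar>\<lfloor>x\<rfloor> - i\<bar> \<le> 1 \<longleftrightarrow> of_int i - 1 \<le> x \<and> x < of_int i + 2" for x :: real and i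
    by linarith
  have "{w \<in> space (borel \<Otimes>\<^sub>M borel). (of_int (fst j) - 1 \<le> fst w / R \<and> fst w / R < of_int (fst j) + 2) \<and>
      (of_int (snd j) - 1 \<le> snd w / R \<and> snd w / R < of_int (snd j) + 2)} \<in> sets (borel \<Otimes>\<^sub>M borel)"
    by measurable
  then show ?thesis unfolding borel_prod by (simp add: grid_block_def fl)
qed

lemma floor_diff_le_1:
  fixes a b R :: real
  assumes R: "R > 0" and "\<bar>\<lfloor>a / R\<rfloor> - \<lfloor>b / R\<rfloor>\<bar> \<le> 1"
  shows "\<bar>a - b\<bar> \<le> 2 * R"
proof -
  have "\<bar>a / R - b / R\<bar> \<le> 2" using assms(2) by linarith
  then show ?thesis using R by (simp add: field_simps abs_le_iff)
qed

lemma floor_diff_gt_1: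
  fixes a b R :: real
  assumes R: "R > 0" and "\<not> \<bar>\<lfloor>a / R\<rfloor> - \<lfloor>b / R\<rfloor>\<bar> \<le> 1"
  shows "R \<le> \<bar>a - b\<bar>"
proof -
  have "1 \<le> \<bar>a / R - b / R\<bar>" using assms(2) by linarith
  then have "1 \<le> \<bar>a - b\<bar> / R" using R by (simp flip: diff_divide_distrib)
  then show ?thesis using R by (simp add: field_simps)
qed

lemma grid_block_near:
  assumes R: "R > 0" and "w \<in> grid_block R (grid_cell R \<gamma>)"
  shows "norm (w - \<gamma>) \<le> 4 * R"
proof -
  have "norm (w - \<gamma>) \<le> \<bar>fst w - fst \<gamma>\<bar> + \<bar>snd w - snd \<gamma>\<bar>"
    using norm_Pair_le[of "fst w - fst \<gamma>" "snd w - snd \<gamma>"] by (simp add: minus_prod_def)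
  also have "\<dots> \<le> 2 * R + 2 * R"
    using assms by (intro add_mono floor_diff_le_1) (auto simp: grid_block_def grid_cell_def)
  finally show ?thesis by simp
qed

lemma grid_block_far:
  assumes R: "R > 0" and "w \<notin> grid_block R (grid_cell R \<gamma>)"
  shows "R \<le> norm (w - \<gamma>)"
proof -
  have "R \<le> \<bar>fst w - fst \<gamma>\<bar> \<or> R \<le> \<bar>snd w - snd \<gamma>\<bar>"
    using assms floor_diff_gt_1[OF R] by (auto simp: grid_block_def grid_cell_def)
  moreover have "\<bar>fst w - fst \<gamma>\<bar> \<le> norm (w - \<gamma>)" "\<bar>snd w - snd \<gamma>\<bar> \<le> norm (w - \<gamma>)"
    using norm_fst_le[of "fst w - fst \<gamma>" "snd w - snd \<gamma>"] norm_snd_le[of "snd w - snd \<gamma>" "fst w - fst \<gamma>"]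
    by (simp_all add: minus_prod_def)
  ultimately show ?thesis by linarith
qed

lemma grid_block_finite_measure:
  assumes R: "R > 0"
  shows "emeasure lborel (grid_block R j) < \<infinity>"
proof (rule emeasure_bounded_finite)
  have "grid_cell R (R * real_of_int (fst j), R * real_of_int (snd j)) = j"
    using R by (simp add: grid_cell_def)
  then have "norm (w - (R * real_of_int (fst j), R * real_of_int (snd j))) \<le> 4 * R" if "w \<in> grid_block R j" for w
    using grid_block_near[OF R, of w "(R * real_of_int (fst j), R * real_of_int (snd j))"] that by simp
  then have "grid_block R j \<subseteq> cball (R * real_of_int (fst j), R * real_of_int (snd j)) (4 * R)"
    by (intro subsetI) (simp only: mem_cball dist_norm norm_minus_commute)
  then show "bounded (grid_block R j)" using bounded_cball bounded_subset by blast
qed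

text \<open>Only the nine cells around that of \<open>w\<close> have blocks containing
  \<open>w\<close>. The bound does not depend on \<open>R\<close>, which lets the perturbation of
  the windows be fixed before \<open>R\<close>.\<close>

lemma grid_block_overlap:
  assumes "finite J"
  shows "(\<Sum>j\<in>J. indicator (grid_block R j) w :: ennreal) \<le> 9"
proof -
  let ?a = "\<lfloor>fst w / R\<rfloor>" and ?b = "\<lfloor>snd w / R\<rfloor>"
  let ?S = "{?a - 1..?a + 1} \<times> {?b - 1..?b + 1}"
  have "(\<Sum>j\<in>J. indicator (grid_block R j) w :: ennreal) \<le> (\<Sum>j\<in>J \<inter> ?S. 1)"
    using assms by (subst sum.mono_neutral_cong_right[of J "J \<inter> ?S" _ "\<lambda>_. 1"])
      (auto simp: grid_block_def indicator_def split: if_splits)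
  also have "\<dots> = of_nat (card (J \<inter> ?S))" by simp
  also have "\<dots> \<le> of_nat (card ?S)"
    by (intro of_nat_mono card_mono) auto
  also have "\<dots> = 9" by (simp add: card_cartesian_product)
  finally show ?thesis .
qed

section \<open>Phase-space localization of the quadratic forms\<close>

lemma ennreal_power2_add_le:
  fixes x y :: ennreal
  shows "(x + y)\<^sup>2 \<le> 2 * x\<^sup>2 + 2 * y\<^sup>2"
proof (cases x; cases y)
  fix r s :: real
  assume r: "0 \<le> r" "x = ennreal r" and s: "0 \<le> s" "y = ennreal s"
  have "(r + s)\<^sup>2 \<le> 2 * r\<^sup>2 + 2 * s\<^sup>2" using norm_add_power2_le[of r s] by simp
  then have "ennreal ((r + s)\<^sup>2) \<le> ennreal (2 * r\<^sup>2 + 2 * s\<^sup>2)" by (rule ennreal_leI)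
  also have "\<dots> = 2 * (ennreal r)\<^sup>2 + 2 * (ennreal s)\<^sup>2"
    using r s by (simp add: ennreal_mult ennreal_power)
  finally show ?thesis using r s by (simp add: ennreal_power flip: ennreal_plus)
qed (auto simp: ennreal_mult_top)

text \<open>An extended real, so that sums, Tonelli's theorem and monotone limits need no
  integrability; \<open>ennreal\<close> would turn a negative value of \<open>m\<close> into
  0.\<close>

definition loc_form :: "(real \<times> real \<Rightarrow> real) \<Rightarrow> (real \<Rightarrow> complex) \<Rightarrow> (real \<Rightarrow> complex) \<Rightarrow> ennreal" where
  "loc_form m \<phi> f = (\<integral>\<^sup>+z. ennreal (m z) * ennreal ((cmod (stft \<phi> f z))\<^sup>2) \<partial>lborel)"

text \<open>One majorant \<open>E\<close> serves all indices at once: in the sums over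
  \<open>\<Gamma>\<close> the window may change from term to term, while the weights can be summed
  only against a common function. For one window in L2, Moyal's identity reduces this to a bound on
  its squared norm.\<close>

definition uniformly_small :: "'i set \<Rightarrow> ('i \<Rightarrow> real \<Rightarrow> complex) \<Rightarrow> real \<Rightarrow> bool" where
  "uniformly_small I \<kappa> \<delta> \<longleftrightarrow> (\<forall>h\<in>L2 lborel. \<exists>E\<in>borel_measurable borel.
     (\<forall>i\<in>I. \<forall>z. ennreal (cmod (stft (\<kappa> i) h z)) \<le> E z) \<and>
     (\<integral>\<^sup>+z. (E z)\<^sup>2 \<partial>lborel) \<le> ennreal (\<delta> * sqnorm lborel h))"

text \<open>
  Up to small perturbations, all windows have short-time Fourier transforms below a common
  integrable kernel.  The perturbation is what makes arbitrary windows in \<open>L\<^sup>2\<close> admissible, whose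
  kernels \<open>V\<^sub>g \<phi>\<close> need not be integrable.
\<close>

definition uniformly_localized :: "(real \<Rightarrow> complex) \<Rightarrow> 'i set \<Rightarrow> ('i \<Rightarrow> real \<Rightarrow> complex) \<Rightarrow> bool" where
  "uniformly_localized g I \<phi> \<longleftrightarrow> (\<forall>\<delta>>0. \<exists>K \<phi>'. K \<in> borel_measurable borel \<and> (\<integral>\<^sup>+z. K z \<partial>lborel) < \<infinity> \<and>
     (\<forall>i\<in>I. \<phi>' i \<in> L2 lborel \<and> (\<forall>z. ennreal (cmod (stft g (\<phi>' i) z)) \<le> K z)) \<and>
     uniformly_small I (\<lambda>i t. \<phi> i t - \<phi>' i t) \<delta>)"

lemma sum_ennreal_weights_le:
  assumes "\<And>\<gamma>. \<gamma> \<in> F \<Longrightarrow> 0 \<le> \<eta> \<gamma>" and "(\<Sum>\<gamma>\<in>F. \<eta> \<gamma>) \<le> (B :: real)"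
  shows "(\<Sum>\<gamma>\<in>F. ennreal (\<eta> \<gamma>) * x) \<le> ennreal B * x"
proof -
  have "(\<Sum>\<gamma>\<in>F. ennreal (\<eta> \<gamma>) * x) = ennreal (\<Sum>\<gamma>\<in>F. \<eta> \<gamma>) * x"
    using assms(1) by (simp add: sum_distrib_right[symmetric] sum_ennreal)
  also have "\<dots> \<le> ennreal B * x"
    using assms(2) by (intro mult_right_mono ennreal_leI) auto
  finally show ?thesis .
qed

text \<open>If \<open>z\<close> is far from \<open>\<gamma>\<close>, the weight at \<open>z\<close>
  belongs to the small tail \<open>\<tau>\<close>. If \<open>z\<close> is near, every
  \<open>w\<close> in \<open>E \<gamma>\<close> has distance at least \<open>r\<close> from
  \<open>z\<close>, so that only the tail of the kernel acts. Young's inequality bounds the total in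
  either case.\<close>

lemma near_far_estimate:
  fixes \<eta> :: "real \<times> real \<Rightarrow> real \<times> real \<Rightarrow> real"
  assumes meas: "\<And>\<gamma>. \<gamma> \<in> F \<Longrightarrow> \<eta> \<gamma> \<in> borel_measurable borel"
    and nonneg: "\<And>\<gamma> z. \<gamma> \<in> F \<Longrightarrow> 0 \<le> \<eta> \<gamma> z"
    and sumB: "\<And>z. (\<Sum>\<gamma>\<in>F. \<eta> \<gamma> z) \<le> B"
    and tail: "\<And>z. (\<Sum>\<gamma>\<in>F. if r \<le> norm (z - \<gamma>) then \<eta> \<gamma> z else 0) \<le> \<tau>"
    and f: "f \<in> L2 lborel" and g: "g \<in> L2 lborel" "sqnorm lborel g = 1"
    and K [measurable]: "K \<in> borel_measurable borel"
    and \<psi>: "\<And>\<gamma>. \<gamma> \<in> F \<Longrightarrow> \<psi> \<gamma> \<in> L2 lborel" "\<And>\<gamma> z. \<gamma> \<in> F \<Longrightarrow> ennreal (cmod (stft g (\<psi> \<gamma>) z)) \<le> K z"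
    and E: "\<And>\<gamma>. \<gamma> \<in> F \<Longrightarrow> E \<gamma> \<in> sets borel" "\<And>\<gamma> w. \<gamma> \<in> F \<Longrightarrow> w \<in> E \<gamma> \<Longrightarrow> 2 * r \<le> norm (w - \<gamma>)"
    and v: "\<And>\<gamma>. \<gamma> \<in> F \<Longrightarrow> stft_part g (E \<gamma>) f (v \<gamma>)"
  shows "(\<Sum>\<gamma>\<in>F. loc_form (\<eta> \<gamma>) (\<psi> \<gamma>) (v \<gamma>)) \<le>
    (ennreal B * (\<integral>\<^sup>+u. K u * indicator {u. r \<le> norm u} u \<partial>lborel)\<^sup>2
      + ennreal \<tau> * (\<integral>\<^sup>+u. K u \<partial>lborel)\<^sup>2) * ennreal (sqnorm lborel f)"
proof -
  let ?X = "\<lambda>\<gamma> z. (cmod (stft (\<psi> \<gamma>) (v \<gamma>) z))"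
  note [measurable] = L2_borel_measurable[OF f] L2_borel_measurable[OF g(1)]
  define V where "V w = ennreal (cmod (stft g f w))" for w
  define Kr where "Kr u = K u * indicator {u. r \<le> norm u} u" for u
  define M where "M z = (\<integral>\<^sup>+w. V w * K (w - z) \<partial>lborel)" for z
  define N where "N z = (\<integral>\<^sup>+w. V w * Kr (w - z) \<partial>lborel)" for z
  have [measurable]: "V \<in> borel_measurable borel" "Kr \<in> borel_measurable borel"
    unfolding V_def Kr_def by measurable
  have [measurable]: "M \<in> borel_measurable borel" "N \<in> borel_measurable borel"
    unfolding M_def N_def by measurable
  have VV: "(\<integral>\<^sup>+w. (V w)\<^sup>2 \<partial>lborel) = ennreal (sqnorm lborel f)"
    using Moyal[OF f g(1)] g(2) by (simp add: V_def ennreal_power)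
  define \<theta> where "\<theta> \<gamma> z = (if r \<le> norm (z - \<gamma>) then \<eta> \<gamma> z else 0)" for \<gamma> z
  have pt: "ennreal (\<eta> \<gamma> z) * ennreal ((?X \<gamma> z)\<^sup>2) \<le>
      ennreal (\<eta> \<gamma> z) * (N z)\<^sup>2 + ennreal (\<theta> \<gamma> z) * (M z)\<^sup>2" if \<gamma>: "\<gamma> \<in> F" for \<gamma> z
  proof -
    have X: "ennreal (?X \<gamma> z) \<le>
        (\<integral>\<^sup>+w. indicator (E \<gamma>) w * V w * ennreal (cmod (stft g (\<psi> \<gamma>) (w - z))) \<partial>lborel)"
      unfolding V_def using \<gamma> by (intro stft_part_pointwise f g \<psi> E v)
    show ?thesis
    proof (cases "r \<le> norm (z - \<gamma>)")
      case True
      note X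
      also have "(\<integral>\<^sup>+w. indicator (E \<gamma>) w * V w * ennreal (cmod (stft g (\<psi> \<gamma>) (w - z))) \<partial>lborel) \<le> M z"
        unfolding M_def using \<psi>(2)[OF \<gamma>]
        by (intro nn_integral_mono mult_mono) (auto simp: indicator_def)
      finally have "(ennreal (?X \<gamma> z))\<^sup>2 \<le> (M z)\<^sup>2"
        by (intro power_mono) auto
      then have "ennreal (\<eta> \<gamma> z) * ennreal ((?X \<gamma> z)\<^sup>2) \<le> ennreal (\<theta> \<gamma> z) * (M z)\<^sup>2"
        using True by (auto simp: \<theta>_def ennreal_power intro!: mult_left_mono)
      then show ?thesis by (simp add: add_increasing)
    next
      case False
      note X
      also have "(\<integral>\<^sup>+w. indicator (E \<gamma>) w * V w * ennreal (cmod (stft g (\<psi> \<gamma>) (w - z))) \<partial>lborel) \<le> N z"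
        unfolding N_def
      proof (intro nn_integral_mono)
        fix w
        show "indicator (E \<gamma>) w * V w * ennreal (cmod (stft g (\<psi> \<gamma>) (w - z))) \<le> V w * Kr (w - z)"
        proof (cases "w \<in> E \<gamma>")
          case True
          have "norm (w - \<gamma>) \<le> norm (w - z) + norm (z - \<gamma>)"
            using norm_triangle_ineq[of "w - z" "z - \<gamma>"] by simp
          then have "r \<le> norm (w - z)" using E(2)[OF \<gamma> True] False by linarith
          then show ?thesis using True \<psi>(2)[OF \<gamma>] by (simp add: Kr_def mult_left_mono)
        qed simp
      qed
      finally have "(ennreal (?X \<gamma> z))\<^sup>2 \<le> (N z)\<^sup>2"
        by (intro power_mono) auto
      then have "ennreal (\<eta> \<gamma> z) * ennreal ((?X \<gamma> z)\<^sup>2) \<le> ennreal (\<eta> \<gamma> z) * (N z)\<^sup>2"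
        by (auto simp: ennreal_power intro!: mult_left_mono)
      then show ?thesis by (simp add: add_increasing2)
    qed
  qed
  have "(\<Sum>\<gamma>\<in>F. loc_form (\<eta> \<gamma>) (\<psi> \<gamma>) (v \<gamma>)) =
      (\<integral>\<^sup>+z. (\<Sum>\<gamma>\<in>F. ennreal (\<eta> \<gamma> z) * ennreal ((?X \<gamma> z)\<^sup>2)) \<partial>lborel)"
    unfolding loc_form_def
  proof (rule nn_integral_sum[symmetric])
    fix \<gamma> assume \<gamma>: "\<gamma> \<in> F"
    have "v \<gamma> \<in> L2 lborel" using v[OF \<gamma>] by (simp add: stft_part_def)
    note [measurable] = L2_borel_measurable[OF this] L2_borel_measurable[OF \<psi>(1)[OF \<gamma>]] meas[OF \<gamma>]
    show "(\<lambda>z. ennreal (\<eta> \<gamma> z) * ennreal ((?X \<gamma> z)\<^sup>2)) \<in> borel_measurable lborel"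
      by measurable
  qed
  also have "\<dots> \<le> (\<integral>\<^sup>+z. ennreal B * (N z)\<^sup>2 + ennreal \<tau> * (M z)\<^sup>2 \<partial>lborel)"
  proof (intro nn_integral_mono)
    fix z
    have "(\<Sum>\<gamma>\<in>F. ennreal (\<eta> \<gamma> z) * ennreal ((?X \<gamma> z)\<^sup>2)) \<le>
        (\<Sum>\<gamma>\<in>F. ennreal (\<eta> \<gamma> z) * (N z)\<^sup>2) + (\<Sum>\<gamma>\<in>F. ennreal (\<theta> \<gamma> z) * (M z)\<^sup>2)"
      unfolding sum.distrib[symmetric] by (intro sum_mono pt)
    also have "\<dots> \<le> ennreal B * (N z)\<^sup>2 + ennreal \<tau> * (M z)\<^sup>2"
      using nonneg sumB[of z] tail[of z]
      by (intro add_mono sum_ennreal_weights_le) (auto simp: \<theta>_def)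
    finally show "(\<Sum>\<gamma>\<in>F. ennreal (\<eta> \<gamma> z) * ennreal ((?X \<gamma> z)\<^sup>2)) \<le>
      ennreal B * (N z)\<^sup>2 + ennreal \<tau> * (M z)\<^sup>2" .
  qed
  also have "\<dots> = ennreal B * (\<integral>\<^sup>+z. (N z)\<^sup>2 \<partial>lborel) + ennreal \<tau> * (\<integral>\<^sup>+z. (M z)\<^sup>2 \<partial>lborel)"
    by (simp add: nn_integral_add nn_integral_cmult)
  also have "\<dots> \<le> ennreal B * ((\<integral>\<^sup>+u. Kr u \<partial>lborel)\<^sup>2 * (\<integral>\<^sup>+w. (V w)\<^sup>2 \<partial>lborel))
      + ennreal \<tau> * ((\<integral>\<^sup>+u. K u \<partial>lborel)\<^sup>2 * (\<integral>\<^sup>+w. (V w)\<^sup>2 \<partial>lborel))"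
    unfolding N_def M_def by (intro add_mono mult_left_mono Young_convolution_L2) auto
  finally show ?thesis
    by (simp add: VV Kr_def distrib_right mult.assoc)
qed

text \<open>The functions tested vary with \<open>\<gamma>\<close>, but only through
  \<open>c \<gamma>\<close>. After \<open>f\<close> has been split off, the remaining terms are
  grouped by the value of \<open>c\<close>: within a group, one majorant meets weights of sum at
  most \<open>B\<close>. Hence the squared norms of the \<open>u j\<close> are counted once per cell
  and not once per index.\<close>

lemma perturbation_estimate:
  fixes \<eta> :: "'a \<Rightarrow> real \<times> real \<Rightarrow> real" and c :: "'a \<Rightarrow> 'b"
  assumes F: "finite F" and meas: "\<And>\<gamma>. \<gamma> \<in> F \<Longrightarrow> \<eta> \<gamma> \<in> borel_measurable borel"
    and nonneg: "\<And>\<gamma> z. \<gamma> \<in> F \<Longrightarrow> 0 \<le> \<eta> \<gamma> z"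
    and sumB: "\<And>z. (\<Sum>\<gamma>\<in>F. \<eta> \<gamma> z) \<le> B" and B: "0 \<le> B"
    and f: "f \<in> L2 lborel" and u: "\<And>j. u j \<in> L2 lborel"
    and \<kappa>: "\<And>\<gamma>. \<gamma> \<in> F \<Longrightarrow> \<kappa> \<gamma> \<in> L2 lborel"
    and E: "\<And>h. h \<in> L2 lborel \<Longrightarrow> E h \<in> borel_measurable borel"
      "\<And>h \<gamma> z. h \<in> L2 lborel \<Longrightarrow> \<gamma> \<in> F \<Longrightarrow> ennreal (cmod (stft (\<kappa> \<gamma>) h z)) \<le> E h z"
      "\<And>h. h \<in> L2 lborel \<Longrightarrow> (\<integral>\<^sup>+z. (E h z)\<^sup>2 \<partial>lborel) \<le> ennreal (\<delta> * sqnorm lborel h)"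
    and \<delta>: "0 \<le> \<delta>"
    and sum_u: "(\<Sum>j\<in>c ` F. sqnorm lborel (u j)) \<le> L * sqnorm lborel f"
  shows "(\<Sum>\<gamma>\<in>F. loc_form (\<eta> \<gamma>) (\<kappa> \<gamma>) (\<lambda>t. f t - u (c \<gamma>) t)) \<le> ennreal (2 * B * \<delta> * (1 + L) * sqnorm lborel f)"
proof -
  let ?v = "\<lambda>\<gamma>. (\<lambda>t. f t - u (c \<gamma>) t)"
  let ?J = "\<lambda>\<gamma>. (\<integral>\<^sup>+z. ennreal (\<eta> \<gamma> z) * (E (u (c \<gamma>)) z)\<^sup>2 \<partial>lborel)"
  have pt: "ennreal ((cmod (stft (\<kappa> \<gamma>) (?v \<gamma>) z))\<^sup>2) \<le> 2 * (E f z)\<^sup>2 + 2 * (E (u (c \<gamma>)) z)\<^sup>2"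
    if \<gamma>: "\<gamma> \<in> F" for \<gamma> z
  proof -
    have "ennreal (cmod (stft (\<kappa> \<gamma>) (?v \<gamma>) z)) \<le>
        ennreal (cmod (stft (\<kappa> \<gamma>) f z)) + ennreal (cmod (stft (\<kappa> \<gamma>) (u (c \<gamma>)) z))"
      using \<kappa>[OF \<gamma>] by (subst stft_diff) (auto simp: f u norm_triangle_ineq4 ennreal_leI simp flip: ennreal_plus)
    also have "\<dots> \<le> E f z + E (u (c \<gamma>)) z"
      using \<gamma> by (intro add_mono E f u)
    finally have "(ennreal (cmod (stft (\<kappa> \<gamma>) (?v \<gamma>) z)))\<^sup>2 \<le> (E f z + E (u (c \<gamma>)) z)\<^sup>2"
      by (intro power_mono) auto
    also note ennreal_power2_add_le
    finally show ?thesis by (simp add: ennreal_power)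
  qed
  have "(\<Sum>\<gamma>\<in>F. loc_form (\<eta> \<gamma>) (\<kappa> \<gamma>) (?v \<gamma>)) \<le>
      (\<Sum>\<gamma>\<in>F. (\<integral>\<^sup>+z. ennreal (\<eta> \<gamma> z) * (2 * (E f z)\<^sup>2 + 2 * (E (u (c \<gamma>)) z)\<^sup>2) \<partial>lborel))"
    unfolding loc_form_def by (intro sum_mono nn_integral_mono mult_left_mono pt) auto
  also have "\<dots> = 2 * (\<integral>\<^sup>+z. (\<Sum>\<gamma>\<in>F. ennreal (\<eta> \<gamma> z) * (E f z)\<^sup>2) \<partial>lborel)
     + 2 * (\<Sum>\<gamma>\<in>F. (?J \<gamma>))"
  proof -
    have "(\<integral>\<^sup>+z. ennreal (\<eta> \<gamma> z) * (2 * (E f z)\<^sup>2 + 2 * (E (u (c \<gamma>)) z)\<^sup>2) \<partial>lborel) =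
        2 * (\<integral>\<^sup>+z. ennreal (\<eta> \<gamma> z) * (E f z)\<^sup>2 \<partial>lborel) + 2 * (?J \<gamma>)"
      if \<gamma>: "\<gamma> \<in> F" for \<gamma>
    proof -
      note [measurable] = meas[OF \<gamma>] E(1)[OF f] E(1)[OF u]
      have "(\<integral>\<^sup>+z. ennreal (\<eta> \<gamma> z) * (2 * (E f z)\<^sup>2 + 2 * (E (u (c \<gamma>)) z)\<^sup>2) \<partial>lborel) =
        (\<integral>\<^sup>+z. 2 * (ennreal (\<eta> \<gamma> z) * (E f z)\<^sup>2) + 2 * (ennreal (\<eta> \<gamma> z) * (E (u (c \<gamma>)) z)\<^sup>2) \<partial>lborel)"
        by (simp add: distrib_left mult.left_commute)
      then show ?thesis by (simp add: nn_integral_add nn_integral_cmult)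
    qed
    moreover have "(\<integral>\<^sup>+z. (\<Sum>\<gamma>\<in>F. ennreal (\<eta> \<gamma> z) * (E f z)\<^sup>2) \<partial>lborel) = (\<Sum>\<gamma>\<in>F. (\<integral>\<^sup>+z. ennreal (\<eta> \<gamma> z) * (E f z)\<^sup>2 \<partial>lborel))"
    proof (intro nn_integral_sum)
      fix \<gamma> assume "\<gamma> \<in> F"
      note [measurable] = meas[OF this] E(1)[OF f]
      show "(\<lambda>z. ennreal (\<eta> \<gamma> z) * (E f z)\<^sup>2) \<in> borel_measurable lborel" by measurable
    qed
    ultimately show ?thesis by (simp add: sum.distrib sum_distrib_left)
  qed
  also have "(\<integral>\<^sup>+z. (\<Sum>\<gamma>\<in>F. ennreal (\<eta> \<gamma> z) * (E f z)\<^sup>2) \<partial>lborel) \<le> ennreal (B * (\<delta> * sqnorm lborel f))"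
  proof -
    have "(\<integral>\<^sup>+z. (\<Sum>\<gamma>\<in>F. ennreal (\<eta> \<gamma> z) * (E f z)\<^sup>2) \<partial>lborel) \<le> (\<integral>\<^sup>+z. ennreal B * (E f z)\<^sup>2 \<partial>lborel)"
      by (intro nn_integral_mono sum_ennreal_weights_le nonneg sumB)
    also have "\<dots> = ennreal B * (\<integral>\<^sup>+z. (E f z)\<^sup>2 \<partial>lborel)"
      using E(1)[OF f] by (intro nn_integral_cmult) measurable
    also have "\<dots> \<le> ennreal B * ennreal (\<delta> * sqnorm lborel f)"
      by (intro mult_left_mono E f) auto
    finally show ?thesis using B by (simp add: ennreal_mult')
  qed
  also have "(\<Sum>\<gamma>\<in>F. (?J \<gamma>)) \<le> ennreal (B * (\<delta> * (L * sqnorm lborel f)))"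
  proof -
    have "(\<Sum>\<gamma>\<in>F. (?J \<gamma>)) =
      (\<Sum>j\<in>c ` F. \<Sum>\<gamma>\<in>{\<gamma>\<in>F. c \<gamma> = j}. (?J \<gamma>))"
      by (rule sum.image_gen[OF F])
    also have "\<dots> \<le> (\<Sum>j\<in>c ` F. ennreal (B * (\<delta> * sqnorm lborel (u j))))"
    proof (intro sum_mono)
      fix j
      have [measurable]: "E (u j) \<in> borel_measurable borel" by (intro E u)
      have "(\<Sum>\<gamma>\<in>{\<gamma>\<in>F. c \<gamma> = j}. (?J \<gamma>)) =
        (\<Sum>\<gamma>\<in>{\<gamma>\<in>F. c \<gamma> = j}. (\<integral>\<^sup>+z. ennreal (\<eta> \<gamma> z) * (E (u j) z)\<^sup>2 \<partial>lborel))"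
        by (intro sum.cong) auto
      also have "\<dots> = (\<integral>\<^sup>+z. (\<Sum>\<gamma>\<in>{\<gamma>\<in>F. c \<gamma> = j}. ennreal (\<eta> \<gamma> z) * (E (u j) z)\<^sup>2) \<partial>lborel)"
        using meas by (intro nn_integral_sum[symmetric]) auto
      also have "\<dots> \<le> (\<integral>\<^sup>+z. ennreal B * (E (u j) z)\<^sup>2 \<partial>lborel)"
      proof (intro nn_integral_mono sum_ennreal_weights_le)
        fix z
        have "(\<Sum>\<gamma>\<in>{\<gamma>\<in>F. c \<gamma> = j}. \<eta> \<gamma> z) \<le> (\<Sum>\<gamma>\<in>F. \<eta> \<gamma> z)"
          using F nonneg by (intro sum_mono2) auto
        then show "(\<Sum>\<gamma>\<in>{\<gamma>\<in>F. c \<gamma> = j}. \<eta> \<gamma> z) \<le> B" using sumB[of z] by linarith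
      qed (use nonneg in auto)
      also have "\<dots> = ennreal B * (\<integral>\<^sup>+z. (E (u j) z)\<^sup>2 \<partial>lborel)"
        by (intro nn_integral_cmult) measurable
      also have "\<dots> \<le> ennreal B * ennreal (\<delta> * sqnorm lborel (u j))"
        by (intro mult_left_mono E u) auto
      finally show "(\<Sum>\<gamma>\<in>{\<gamma>\<in>F. c \<gamma> = j}. (?J \<gamma>)) \<le>
          ennreal (B * (\<delta> * sqnorm lborel (u j)))"
        using B by (simp add: ennreal_mult')
    qed
    also have "\<dots> = ennreal (B * (\<delta> * (\<Sum>j\<in>c ` F. sqnorm lborel (u j))))"
      using B \<delta> by (simp add: sum_ennreal sum_distrib_left)
    also have "\<dots> \<le> ennreal (B * (\<delta> * (L * sqnorm lborel f)))"
      using B \<delta> sum_u by (intro ennreal_leI mult_left_mono) auto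
    finally show ?thesis .
  qed
  finally have le: "(\<Sum>\<gamma>\<in>F. loc_form (\<eta> \<gamma>) (\<kappa> \<gamma>) (?v \<gamma>)) \<le>
     2 * ennreal (B * (\<delta> * sqnorm lborel f)) + 2 * ennreal (B * (\<delta> * (L * sqnorm lborel f)))"
    by (simp add: add_mono mult_left_mono)
  have "0 \<le> L * sqnorm lborel f"
    using sum_u by (rule order_trans[rotated]) (simp add: sum_nonneg)
  then have "2 * ennreal (B * (\<delta> * sqnorm lborel f)) + 2 * ennreal (B * (\<delta> * (L * sqnorm lborel f))) =
      ennreal (2 * (B * (\<delta> * sqnorm lborel f)) + 2 * (B * (\<delta> * (L * sqnorm lborel f))))"
    using B \<delta> by (simp add: ennreal_mult)
  also have "2 * (B * (\<delta> * sqnorm lborel f)) + 2 * (B * (\<delta> * (L * sqnorm lborel f))) = 2 * B * \<delta> * (1 + L) * sqnorm lborel f"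
    by (simp add: algebra_simps)
  finally show ?thesis using le by simp
qed

section \<open>Localized approximants\<close>

lemma loc_form_add_windows_le:
  assumes \<phi>: "\<phi> \<in> L2 lborel" "\<psi> \<in> L2 lborel" and h: "h \<in> L2 lborel" and [measurable]: "m \<in> borel_measurable borel"
  shows "loc_form m \<phi> h \<le> 2 * loc_form m \<psi> h + 2 * loc_form m (\<lambda>t. \<phi> t - \<psi> t) h"
proof -
  note [measurable] = L2_borel_measurable[OF \<phi>(1)] L2_borel_measurable[OF \<phi>(2)] L2_borel_measurable[OF h]
  have "loc_form m \<phi> h \<le> (\<integral>\<^sup>+z. 2 * (ennreal (m z) * ennreal ((cmod (stft \<psi> h z))\<^sup>2))
      + 2 * (ennreal (m z) * ennreal ((cmod (stft (\<lambda>t. \<phi> t - \<psi> t) h z))\<^sup>2)) \<partial>lborel)"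
    unfolding loc_form_def
  proof (intro nn_integral_mono)
    fix z
    have "(cmod (stft \<phi> h z))\<^sup>2 \<le> 2 * (cmod (stft \<psi> h z))\<^sup>2 + 2 * (cmod (stft (\<lambda>t. \<phi> t - \<psi> t) h z))\<^sup>2"
      using norm_add_power2_le[of "stft \<psi> h z" "stft (\<lambda>t. \<phi> t - \<psi> t) h z"] by (simp add: stft_diff_window h \<phi>)
    then have "ennreal ((cmod (stft \<phi> h z))\<^sup>2) \<le> ennreal (2 * (cmod (stft \<psi> h z))\<^sup>2 + 2 * (cmod (stft (\<lambda>t. \<phi> t - \<psi> t) h z))\<^sup>2)"
      by (rule ennreal_leI)
    then have "ennreal (m z) * ennreal ((cmod (stft \<phi> h z))\<^sup>2) \<le>
        ennreal (m z) * (2 * ennreal ((cmod (stft \<psi> h z))\<^sup>2) + 2 * ennreal ((cmod (stft (\<lambda>t. \<phi> t - \<psi> t) h z))\<^sup>2))"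
      by (intro mult_left_mono) (auto simp: ennreal_mult)
    then show "ennreal (m z) * ennreal ((cmod (stft \<phi> h z))\<^sup>2) \<le> 2 * (ennreal (m z) * ennreal ((cmod (stft \<psi> h z))\<^sup>2))
      + 2 * (ennreal (m z) * ennreal ((cmod (stft (\<lambda>t. \<phi> t - \<psi> t) h z))\<^sup>2))"
      by (simp add: distrib_left mult.left_commute)
  qed
  also have "\<dots> = 2 * loc_form m \<psi> h + 2 * loc_form m (\<lambda>t. \<phi> t - \<psi> t) h"
    by (simp add: nn_integral_add nn_integral_cmult loc_form_def)
  finally show ?thesis .
qed

text \<open>The approximants \<open>u\<close> come before the map \<open>\<iota>\<close>: they serve
  every assignment of windows, so that a threshold derived from \<open>N\<close> is the same for all
  partitions.\<close>

definition localized_approximation ::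
  "'i set \<Rightarrow> ('i \<Rightarrow> real \<Rightarrow> complex) \<Rightarrow> (real \<times> real) set \<Rightarrow> (real \<times> real \<Rightarrow> real \<times> real \<Rightarrow> real) \<Rightarrow>
    real \<Rightarrow> real \<Rightarrow> (real \<Rightarrow> complex) \<Rightarrow> bool" where
  "localized_approximation I \<phi> \<Gamma> \<eta> \<delta> N f \<longleftrightarrow> (\<exists>u. (\<forall>\<gamma>. u \<gamma> \<in> L2 lborel) \<and>
    (\<forall>F. finite F \<longrightarrow> F \<subseteq> \<Gamma> \<longrightarrow> (\<Sum>\<gamma>\<in>F. sqnorm lborel (u \<gamma>)) \<le> N * sqnorm lborel f) \<and>
    (\<forall>F \<iota>. finite F \<longrightarrow> F \<subseteq> \<Gamma> \<longrightarrow> (\<forall>\<gamma>\<in>F. \<iota> \<gamma> \<in> I) \<longrightarrow>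
      (\<Sum>\<gamma>\<in>F. loc_form (\<eta> \<gamma>) (\<phi> (\<iota> \<gamma>)) (\<lambda>t. f t - u \<gamma> t)) \<le> ennreal (\<delta> * sqnorm lborel f)))"

text \<open>The order of the choices matters: \<open>\<delta>1\<close> fixes the kernel
  \<open>K\<close>, the kernel fixes \<open>r\<close> and the side \<open>R\<close>, and only then
  \<open>N\<close> is known. The perturbation is therefore estimated with the overlap 9 of the
  blocks, and \<open>N\<close> bounds only the norms of the approximants.\<close>

lemma ex_localized_approximation:
  fixes \<eta> :: "real \<times> real \<Rightarrow> real \<times> real \<Rightarrow> real" and \<phi> :: "'i \<Rightarrow> real \<Rightarrow> complex"
  assumes sep: "relatively_separated \<Gamma>"
    and meas: "\<And>\<gamma>. \<gamma> \<in> \<Gamma> \<Longrightarrow> \<eta> \<gamma> \<in> borel_measurable borel"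
    and nonneg: "\<And>\<gamma> z. \<gamma> \<in> \<Gamma> \<Longrightarrow> 0 \<le> \<eta> \<gamma> z"
    and sumB: "\<And>F z. finite F \<Longrightarrow> F \<subseteq> \<Gamma> \<Longrightarrow> (\<Sum>\<gamma>\<in>F. \<eta> \<gamma> z) \<le> B" and B: "0 < B"
    and decay: "\<And>\<gamma> z. \<gamma> \<in> \<Gamma> \<Longrightarrow> \<eta> \<gamma> z \<le> C * (1 + norm (z - \<gamma>)) powr (- s)" and C: "0 \<le> C" and s: "2 < s"
    and g: "g \<in> L2 lborel" "sqnorm lborel g = 1"
    and \<phi>: "\<And>i. i \<in> I \<Longrightarrow> \<phi> i \<in> L2 lborel" and loc: "uniformly_localized g I \<phi>"
    and \<delta>: "0 < \<delta>"
  shows "\<exists>N>0. \<forall>f\<in>L2 lborel. localized_approximation I \<phi> \<Gamma> \<eta> \<delta> N f"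
proof -
  \<comment> \<open>With ninefold overlap the perturbation costs \<open>20 * B * \<delta>1\<close>;
    splitting the window doubles this, and half of \<open>\<delta>\<close> is reserved for
    it.\<close>
  define \<delta>1 where "\<delta>1 = \<delta> / (80 * B)"
  have \<delta>1: "\<delta>1 > 0" using \<delta> B by (simp add: \<delta>1_def)
  obtain K \<phi>' where K [measurable]: "K \<in> borel_measurable borel" and Kfin: "(\<integral>\<^sup>+z. K z \<partial>lborel) < \<infinity>"
    and \<phi>': "\<And>i. i \<in> I \<Longrightarrow> \<phi>' i \<in> L2 lborel" "\<And>i z. i \<in> I \<Longrightarrow> ennreal (cmod (stft g (\<phi>' i) z)) \<le> K z"
    and small: "uniformly_small I (\<lambda>i t. \<phi> i t - \<phi>' i t) \<delta>1"
    using loc[unfolded uniformly_localized_def, THEN spec, THEN mp, OF \<delta>1]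
    by (elim exE conjE) (rule that, assumption, assumption, blast, blast, assumption)
  from bchoice[OF small[unfolded uniformly_small_def Bex_def]] obtain E where
    E: "\<And>h. h \<in> L2 lborel \<Longrightarrow> E h \<in> borel_measurable borel"
      "\<And>h i z. h \<in> L2 lborel \<Longrightarrow> i \<in> I \<Longrightarrow> ennreal (cmod (stft (\<lambda>t. \<phi> i t - \<phi>' i t) h z)) \<le> E h z"
      "\<And>h. h \<in> L2 lborel \<Longrightarrow> (\<integral>\<^sup>+z. (E h z)\<^sup>2 \<partial>lborel) \<le> ennreal (\<delta>1 * sqnorm lborel h)"
    by blast
  define k where "k = enn2real (\<integral>\<^sup>+z. K z \<partial>lborel)"
  have k: "(\<integral>\<^sup>+z. K z \<partial>lborel) = ennreal k" "k \<ge> 0"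
    using Kfin by (auto simp: k_def)
  \<comment> \<open>\<open>\<tau>\<close> and \<open>c\<close> below contribute at most
    \<open>\<delta> / 8\<close> each to \<open>near_far_estimate\<close>; their sum, doubled, is the
    other half of \<open>\<delta>\<close>.\<close>
  define \<tau> where "\<tau> = \<delta> / (8 * (k\<^sup>2 + 1))"
  have k1: "k\<^sup>2 + 1 > 0" by (intro add_nonneg_pos) auto
  then have \<tau>0: "\<tau> > 0" using \<delta> unfolding \<tau>_def by (intro divide_pos_pos mult_pos_pos) auto
  have "\<tau> * k\<^sup>2 \<le> \<tau> * (k\<^sup>2 + 1)" using \<tau>0 by (intro mult_left_mono) auto
  also have "\<dots> = \<delta> / 8"
  proof -
    have "0 < x \<Longrightarrow> \<delta> / (8 * x) * x = \<delta> / 8" for x :: real by simp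
    from this[OF k1] show ?thesis unfolding \<tau>_def .
  qed
  finally have \<tau>: "\<tau> > 0" "\<tau> * k\<^sup>2 \<le> \<delta> / 8" using \<tau>0 by auto
  define c where "c = sqrt (\<delta> / (8 * B))"
  have c: "c > 0" "B * c\<^sup>2 = \<delta> / 8" using \<delta> B by (auto simp: c_def)
  obtain R1 where R1: "R1 > 0" "\<And>r. r \<ge> R1 \<Longrightarrow> (\<integral>\<^sup>+u. K u * indicator {u. r \<le> norm u} u \<partial>lborel) \<le> ennreal c"
    using nn_integral_tail_small[OF K Kfin c(1)] by blast
  obtain R2 where R2: "R2 > 0" "\<forall>r\<ge>R2. \<forall>F z. finite F \<longrightarrow> F \<subseteq> \<Gamma> \<longrightarrow>
      (\<Sum>\<gamma>\<in>F. if r \<le> norm (z - \<gamma>) then C * (1 + norm (z - \<gamma>)) powr (- s) else 0) \<le> \<tau>"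
    using relatively_separated_tail[OF sep s \<tau>(1) C] by (elim exE conjE) (rule that)
  define r where "r = max R1 R2"
  \<comment> \<open>\<open>near_far_estimate\<close> wants the points outside the block at distance
    \<open>2 * r\<close>, and \<open>grid_block_far\<close> gives the side as distance.\<close>
  define R where "R = 2 * r"
  have r: "r \<ge> R1" "r \<ge> R2" "R > 0" using R1(1) by (auto simp: r_def R_def)
  obtain N where N: "0 < N" "\<And>F w. finite F \<Longrightarrow> F \<subseteq> \<Gamma> \<Longrightarrow> real (card {\<gamma>\<in>F. norm (w - \<gamma>) \<le> 4 * R}) \<le> N"
    using relatively_separated_card[OF sep] by blast
  define Q where "Q = (\<lambda>\<gamma>. grid_block R (grid_cell R \<gamma>))"
  show ?thesis
  proof (intro exI[of _ N] conjI ballI N(1))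
    fix f :: "real \<Rightarrow> complex" assume f: "f \<in> L2 lborel"
    note [measurable] = L2_borel_measurable[OF f] L2_borel_measurable[OF g(1)]
    define W where "W z = ennreal ((cmod (stft g f z))\<^sup>2)" for z
    have [measurable]: "W \<in> borel_measurable borel" unfolding W_def by measurable
    have W: "(\<integral>\<^sup>+z. W z \<partial>lborel) = ennreal (sqnorm lborel f)"
      using Moyal[OF f g(1)] g(2) by (simp add: W_def)
    define U where "U j = loc_op (indicator (grid_block R j)) g f" for j
    have part: "stft_part g (grid_block R j) f (U j)" for j
      unfolding U_def by (intro stft_part_loc_op f g grid_block_finite_measure r) measurable
    then have UL: "U j \<in> L2 lborel" for j by (simp add: stft_part_def)
    have Usq: "ennreal (sqnorm lborel (U j)) \<le> (\<integral>\<^sup>+z. indicator (grid_block R j) z * W z \<partial>lborel)" for j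
      unfolding W_def by (rule stft_part_sqnorm[OF f g _ part]) measurable
    have sum_cells: "(\<Sum>j\<in>J. sqnorm lborel (U j)) \<le> 9 * sqnorm lborel f" if J: "finite J" for J
    proof -
      have "ennreal (\<Sum>j\<in>J. sqnorm lborel (U j)) = (\<Sum>j\<in>J. ennreal (sqnorm lborel (U j)))"
        by (simp add: sum_ennreal)
      also have "\<dots> \<le> (\<Sum>j\<in>J. \<integral>\<^sup>+z. indicator (grid_block R j) z * W z \<partial>lborel)"
        by (intro sum_mono Usq)
      also have "\<dots> = (\<integral>\<^sup>+z. (\<Sum>j\<in>J. indicator (grid_block R j) z) * W z \<partial>lborel)"
        by (simp add: nn_integral_sum sum_distrib_right)
      also have "\<dots> \<le> (\<integral>\<^sup>+z. 9 * W z \<partial>lborel)"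
        by (intro nn_integral_mono mult_right_mono grid_block_overlap J) auto
      also have "\<dots> = ennreal (9 * sqnorm lborel f)"
        by (simp add: nn_integral_cmult W ennreal_mult)
      finally show ?thesis by (subst (asm) ennreal_le_iff) auto
    qed
    show "localized_approximation I \<phi> \<Gamma> \<eta> \<delta> N f"
      unfolding localized_approximation_def
    proof (intro exI[of _ "\<lambda>\<gamma>. U (grid_cell R \<gamma>)"] conjI allI impI UL)
      fix F assume F: "finite F" "F \<subseteq> \<Gamma>"
      \<comment> \<open>Here every index counts, so the number of indices within
        \<open>4 * R\<close> takes the place of the overlap 9.\<close>
      have cnt: "(\<Sum>\<gamma>\<in>F. indicator (Q \<gamma>) z :: ennreal) \<le> ennreal N" for z
      proof -
        have "(\<Sum>\<gamma>\<in>F. indicator (Q \<gamma>) z :: ennreal) \<le> (\<Sum>\<gamma>\<in>F. if norm (z - \<gamma>) \<le> 4 * R then 1 else 0)"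
          using grid_block_near[OF r(3)] by (intro sum_mono) (auto simp: Q_def indicator_def)
        also have "\<dots> = of_nat (card {\<gamma>\<in>F. norm (z - \<gamma>) \<le> 4 * R})"
          using F by (simp add: sum.If_cases Int_def)
        also have "\<dots> \<le> ennreal N"
          using N(2)[OF F, of z] by (simp add: ennreal_of_nat_eq_real_of_nat ennreal_leI)
        finally show ?thesis .
      qed
      have "ennreal (\<Sum>\<gamma>\<in>F. sqnorm lborel (U (grid_cell R \<gamma>))) = (\<Sum>\<gamma>\<in>F. ennreal (sqnorm lborel (U (grid_cell R \<gamma>))))"
        by (simp add: sum_ennreal)
      also have "\<dots> \<le> (\<Sum>\<gamma>\<in>F. \<integral>\<^sup>+z. indicator (Q \<gamma>) z * W z \<partial>lborel)"
        unfolding Q_def by (intro sum_mono Usq)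
      also have "\<dots> = (\<integral>\<^sup>+z. (\<Sum>\<gamma>\<in>F. indicator (Q \<gamma>) z) * W z \<partial>lborel)"
        by (simp add: nn_integral_sum sum_distrib_right Q_def)
      also have "\<dots> \<le> (\<integral>\<^sup>+z. ennreal N * W z \<partial>lborel)"
        by (intro nn_integral_mono mult_right_mono cnt) auto
      also have "\<dots> = ennreal (N * sqnorm lborel f)"
        using N(1) by (simp add: nn_integral_cmult W ennreal_mult)
      finally show "(\<Sum>\<gamma>\<in>F. sqnorm lborel (U (grid_cell R \<gamma>))) \<le> N * sqnorm lborel f"
        using N(1) by (subst (asm) ennreal_le_iff) auto
    next
      fix F and \<iota> :: "real \<times> real \<Rightarrow> 'i"
      assume F: "finite F" "F \<subseteq> \<Gamma>" and \<iota>: "\<forall>\<gamma>\<in>F. \<iota> \<gamma> \<in> I"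
      let ?v = "\<lambda>\<gamma> t. f t - U (grid_cell R \<gamma>) t"
      let ?n = "sqnorm lborel f"
      have v: "?v \<gamma> \<in> L2 lborel" for \<gamma> by (intro L2_diff f UL)
      have nf: "(\<Sum>\<gamma>\<in>F. loc_form (\<eta> \<gamma>) (\<phi>' (\<iota> \<gamma>)) (?v \<gamma>)) \<le>
        (ennreal B * (\<integral>\<^sup>+u. K u * indicator {u. r \<le> norm u} u \<partial>lborel)\<^sup>2
          + ennreal \<tau> * (\<integral>\<^sup>+u. K u \<partial>lborel)\<^sup>2) * ennreal ?n"
      proof (rule near_far_estimate[where E="\<lambda>\<gamma>. - Q \<gamma>"])
        show "(\<Sum>\<gamma>\<in>F. if r \<le> norm (z - \<gamma>) then \<eta> \<gamma> z else 0) \<le> \<tau>" for z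
        proof -
          have "(\<Sum>\<gamma>\<in>F. if r \<le> norm (z - \<gamma>) then \<eta> \<gamma> z else 0) \<le>
              (\<Sum>\<gamma>\<in>F. if r \<le> norm (z - \<gamma>) then C * (1 + norm (z - \<gamma>)) powr (- s) else 0)"
          proof (intro sum_mono)
            fix \<gamma> assume "\<gamma> \<in> F"
            then show "(if r \<le> norm (z - \<gamma>) then \<eta> \<gamma> z else 0) \<le>
                (if r \<le> norm (z - \<gamma>) then C * (1 + norm (z - \<gamma>)) powr (- s) else 0)"
              using F decay[of \<gamma> z] by auto
          qed
          also have "\<dots> \<le> \<tau>" by (rule R2(2)[rule_format, OF r(2) F])
          finally show ?thesis .
        qed
        show "2 * r \<le> norm (w - \<gamma>)" if "w \<in> - Q \<gamma>" for w \<gamma>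
          using grid_block_far[OF r(3), of w \<gamma>] that by (simp add: Q_def R_def)
        show "stft_part g (- Q \<gamma>) f (?v \<gamma>)" for \<gamma>
          unfolding Q_def by (intro stft_part_Compl f g part) measurable
        show "- Q \<gamma> \<in> sets borel" for \<gamma> unfolding Q_def by measurable
      qed (use F meas nonneg sumB f g \<phi>' \<iota> in auto)
      also have "\<dots> \<le> (ennreal B * (ennreal c)\<^sup>2 + ennreal \<tau> * (ennreal k)\<^sup>2) * ennreal ?n"
        unfolding k using r by (intro mult_right_mono add_mono mult_left_mono power_mono R1) auto
      also have "\<dots> = ennreal ((B * c\<^sup>2 + \<tau> * k\<^sup>2) * ?n)"
        using B c(1) \<tau>(1) k(2) by (simp add: ennreal_mult ennreal_power)
      also have "\<dots> \<le> ennreal (\<delta> / 4 * ?n)"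
        using c(2) \<tau>(2) by (intro ennreal_leI mult_right_mono) auto
      finally have nf: "(\<Sum>\<gamma>\<in>F. loc_form (\<eta> \<gamma>) (\<phi>' (\<iota> \<gamma>)) (?v \<gamma>)) \<le> ennreal (\<delta> / 4 * ?n)" .
      have pe: "(\<Sum>\<gamma>\<in>F. loc_form (\<eta> \<gamma>) (\<lambda>t. \<phi> (\<iota> \<gamma>) t - \<phi>' (\<iota> \<gamma>) t) (?v \<gamma>)) \<le> ennreal (2 * B * \<delta>1 * (1 + 9) * ?n)"
      proof (rule perturbation_estimate[where E=E])
        show "(\<Sum>j\<in>grid_cell R ` F. sqnorm lborel (U j)) \<le> 9 * ?n"
          using F by (intro sum_cells) auto
      qed (use F meas nonneg sumB f UL E B \<delta>1 \<phi> \<phi>' \<iota> in \<open>auto intro: L2_diff\<close>)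
      have "(\<Sum>\<gamma>\<in>F. loc_form (\<eta> \<gamma>) (\<phi> (\<iota> \<gamma>)) (?v \<gamma>)) \<le>
        (\<Sum>\<gamma>\<in>F. 2 * loc_form (\<eta> \<gamma>) (\<phi>' (\<iota> \<gamma>)) (?v \<gamma>) + 2 * loc_form (\<eta> \<gamma>) (\<lambda>t. \<phi> (\<iota> \<gamma>) t - \<phi>' (\<iota> \<gamma>) t) (?v \<gamma>))"
        using F \<iota> by (intro sum_mono loc_form_add_windows_le v \<phi> \<phi>' meas) auto
      also have "\<dots> = 2 * (\<Sum>\<gamma>\<in>F. loc_form (\<eta> \<gamma>) (\<phi>' (\<iota> \<gamma>)) (?v \<gamma>))
          + 2 * (\<Sum>\<gamma>\<in>F. loc_form (\<eta> \<gamma>) (\<lambda>t. \<phi> (\<iota> \<gamma>) t - \<phi>' (\<iota> \<gamma>) t) (?v \<gamma>))"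
        by (simp add: sum.distrib sum_distrib_left)
      also have "\<dots> \<le> 2 * ennreal (\<delta> / 4 * ?n) + 2 * ennreal (2 * B * \<delta>1 * (1 + 9) * ?n)"
        by (intro add_mono mult_left_mono nf pe) auto
      also have "\<dots> = ennreal (2 * (\<delta> / 4 * ?n) + 2 * (2 * B * \<delta>1 * (1 + 9) * ?n))"
      proof -
        have "0 \<le> a \<Longrightarrow> 0 \<le> b \<Longrightarrow> 2 * ennreal a + 2 * ennreal b = ennreal (2 * a + 2 * b)" for a b
          by (simp add: ennreal_mult)
        then show ?thesis using \<delta> B \<delta>1 by simp
      qed
      also have "2 * (\<delta> / 4 * ?n) + 2 * (2 * B * \<delta>1 * (1 + 9) * ?n) = \<delta> * ?n"
        using B by (simp add: \<delta>1_def field_simps)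
      finally show "(\<Sum>\<gamma>\<in>F. loc_form (\<eta> \<gamma>) (\<phi> (\<iota> \<gamma>)) (?v \<gamma>)) \<le> ennreal (\<delta> * ?n)" .
    qed
  qed
qed

section \<open>Spectral decompositions and window families\<close>

lemma l2_norm_eq_sqrt: "l2_norm f = sqrt (sqnorm lborel f)"
  by (simp add: l2_norm_def sqnorm_def)

text \<open>Both sides are the pairing of the image of \<open>f\<close> with \<open>f\<close>: the
  left one by testing the expansion against \<open>f\<close>, the right one by
  \<open>loc_op_ip\<close>.\<close>

lemma spectral_quadratic_form:
  assumes sd: "spectral_decomposition (loc_op m \<phi>) \<mu> e" and \<phi>: "\<phi> \<in> L2 lborel" and f: "f \<in> L2 lborel"
    and m: "integrable lborel m" "\<And>z. 0 \<le> m z"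
  shows "(\<Sum>k. ennreal (\<mu> k * (cmod (ip lborel f (e k)))\<^sup>2)) = loc_form m \<phi> f"
proof -
  have [measurable]: "m \<in> borel_measurable borel" using m by auto
  note [measurable] = L2_borel_measurable[OF f] L2_borel_measurable[OF \<phi>]
  have e: "e k \<in> L2 lborel" for k
    using sd by (auto simp: spectral_decomposition_def square_integrable_eq_L2)
  have \<mu>: "0 \<le> \<mu> k" for k using sd by (simp add: spectral_decomposition_def)
  define S where "S n t = (\<Sum>k<n. of_real (\<mu> k) * ip lborel f (e k) * e k t)" for n t
  define T where "T = loc_op m \<phi> f"
  have "l2_sums (\<lambda>k t. of_real (\<mu> k) * l2_inner f (e k) * e k t) (loc_op m \<phi> f)"
    using sd f unfolding spectral_decomposition_def square_integrable_eq_L2 by blast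
  then have T: "T \<in> L2 lborel" and lim: "(\<lambda>n. sqrt (sqnorm lborel (\<lambda>t. T t - S n t))) \<longlonglongrightarrow> 0"
    by (auto simp: l2_sums_def T_def S_def square_integrable_eq_L2 l2_norm_eq_sqrt l2_inner_eq_ip)
  have SL: "S n \<in> L2 lborel" for n
    unfolding S_def[abs_def] by (intro L2_sum L2_cmult e)
  define q where "q = (LINT z|lborel. m z * (cmod (stft \<phi> f z))\<^sup>2)"
  define a where "a k = \<mu> k * (cmod (ip lborel f (e k)))\<^sup>2" for k
  have Sf: "ip lborel (S n) f = of_real (\<Sum>k<n. a k)" for n
  proof -
    have "ip lborel (S n) f = (\<Sum>k<n. of_real (\<mu> k) * (ip lborel f (e k) * cnj (ip lborel f (e k))))"
      unfolding S_def[abs_def] by (subst ip_sum_left) (auto simp: L2_cmult e f ip_cmult_left ip_commute mult.assoc)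
    also have "\<dots> = of_real (\<Sum>k<n. a k)"
      by (simp only: a_def of_real_sum of_real_mult complex_norm_square)
    finally show ?thesis .
  qed
  have Tf: "ip lborel T f = of_real q"
  proof -
    have "ip lborel T f = (LINT z|lborel. of_real (m z * (cmod (stft \<phi> f z))\<^sup>2))"
      unfolding T_def loc_op_ip[OF f \<phi> f m(1)]
      by (intro Bochner_Integration.integral_cong refl) (simp only: of_real_mult complex_norm_square mult_ac)
    also have "\<dots> = of_real q" unfolding q_def by (rule integral_complex_of_real)
    finally show ?thesis .
  qed
  \<comment> \<open>Pairing with \<open>f\<close> is continuous in L2, so convergence of the
    expansion in norm passes to the numbers.\<close>
  have "(\<lambda>n. of_real (\<Sum>k<n. a k) - complex_of_real q) \<longlonglongrightarrow> 0"
  proof (rule Lim_null_comparison)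
    show "(\<lambda>n. sqrt (sqnorm lborel (\<lambda>t. T t - S n t)) * sqrt (sqnorm lborel f)) \<longlonglongrightarrow> 0"
      using tendsto_mult_left_zero[OF lim] .
    have "norm (of_real (\<Sum>k<n. a k) - complex_of_real q) \<le> sqrt (sqnorm lborel (\<lambda>t. T t - S n t)) * sqrt (sqnorm lborel f)" for n
    proof -
      have "norm (of_real (\<Sum>k<n. a k) - complex_of_real q) = cmod (ip lborel (\<lambda>t. T t - S n t) f)"
        unfolding Sf[symmetric] Tf[symmetric] by (simp add: ip_diff_left T SL f norm_minus_commute)
      also have "\<dots> \<le> sqrt (sqnorm lborel (\<lambda>t. T t - S n t) * sqnorm lborel f)"
        by (intro ip_cmod_le L2_diff T SL f)
      finally show ?thesis by (simp add: real_sqrt_mult)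
    qed
    then show "\<forall>\<^sub>F n in sequentially. norm (of_real (\<Sum>k<n. a k) - complex_of_real q) \<le>
        sqrt (sqnorm lborel (\<lambda>t. T t - S n t)) * sqrt (sqnorm lborel f)"
      by (intro always_eventually allI)
  qed
  then have "(\<lambda>n. complex_of_real (\<Sum>k<n. a k)) \<longlonglongrightarrow> of_real q"
    by (rule Lim_null[THEN iffD2])
  then have "a sums q"
    unfolding sums_def by (rule tendsto_of_real_iff[THEN iffD1])
  then have "(\<Sum>k. ennreal (a k)) = ennreal q"
    by (intro suminf_ennreal_eq) (use \<mu> in \<open>simp add: a_def\<close>)
  also have "ennreal q = loc_form m \<phi> f"
  proof -
    have "integrable lborel (\<lambda>z. m z * (cmod (stft \<phi> f z))\<^sup>2)"
    proof (rule Bochner_Integration.integrable_bound)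
      show "integrable lborel (\<lambda>z. m z * (sqnorm lborel f * sqnorm lborel \<phi>))"
        using m by simp
      have "(cmod (stft \<phi> f z))\<^sup>2 \<le> sqnorm lborel f * sqnorm lborel \<phi>" for z
        using power_mono[OF stft_bound[OF f \<phi>, of z], of 2] by simp
      then show "AE z in lborel. norm (m z * (cmod (stft \<phi> f z))\<^sup>2) \<le> norm (m z * (sqnorm lborel f * sqnorm lborel \<phi>))"
        using m(2) by (intro AE_I2) (auto simp: abs_mult intro!: mult_left_mono)
    qed measurable
    then have "(\<integral>\<^sup>+z. ennreal (m z * (cmod (stft \<phi> f z))\<^sup>2) \<partial>lborel) = ennreal q"
      unfolding q_def using m(2) by (intro nn_integral_eq_integral) auto
    then show ?thesis using m(2) by (simp add: loc_form_def ennreal_mult)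
  qed
  finally show ?thesis by (simp add: a_def)
qed

lemma spectral_small_part:
  assumes sd: "spectral_decomposition (loc_op m \<phi>) \<mu> e" and \<phi>: "\<phi> \<in> L2 lborel"
    and f: "f \<in> L2 lborel" and u: "u \<in> L2 lborel"
    and m: "integrable lborel m" "\<And>z. 0 \<le> m z" and \<epsilon>: "0 \<le> \<epsilon>"
  shows "(\<Sum>k. ennreal (if \<mu> k \<le> \<epsilon> then \<mu> k * (cmod (ip lborel f (e k)))\<^sup>2 else 0)) \<le>
    ennreal (2 * \<epsilon> * sqnorm lborel u) + 2 * loc_form m \<phi> (\<lambda>t. f t - u t)"
proof -
  have e: "e k \<in> L2 lborel" for k
    using sd by (auto simp: spectral_decomposition_def square_integrable_eq_L2)
  have o: "ip lborel (e j) (e k) = (if j = k then 1 else 0)" for j k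
    using sd by (simp add: spectral_decomposition_def l2_inner_eq_ip)
  have \<mu>: "0 \<le> \<mu> k" for k using sd by (simp add: spectral_decomposition_def)
  let ?v = "\<lambda>t. f t - u t"
  have v: "?v \<in> L2 lborel" by (intro L2_diff f u)
  let ?a = "\<lambda>h k. (cmod (ip lborel h (e k)))\<^sup>2"
  have pt: "ennreal (if \<mu> k \<le> \<epsilon> then \<mu> k * ?a f k else 0) \<le>
      ennreal (2 * \<epsilon>) * ennreal (?a u k) + 2 * ennreal (\<mu> k * ?a ?v k)" for k
  proof -
    have "ip lborel f (e k) = ip lborel u (e k) + ip lborel ?v (e k)"
      by (simp add: ip_diff_left f u e)
    then have "?a f k \<le> 2 * ?a u k + 2 * ?a ?v k"
      using norm_add_power2_le by metis
    then have "\<mu> k * ?a f k \<le> \<mu> k * (2 * ?a u k + 2 * ?a ?v k)"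
      using \<mu> by (intro mult_left_mono)
    also have "\<dots> = \<mu> k * (2 * ?a u k) + 2 * (\<mu> k * ?a ?v k)" by (simp add: algebra_simps)
    finally have *: "\<mu> k * ?a f k \<le> \<mu> k * (2 * ?a u k) + 2 * (\<mu> k * ?a ?v k)" .
    \<comment> \<open>For the remainder the restriction to small eigenvalues is dropped, so that its
      terms sum to the full quadratic form.\<close>
    have "(if \<mu> k \<le> \<epsilon> then \<mu> k * ?a f k else 0) \<le> 2 * \<epsilon> * ?a u k + 2 * (\<mu> k * ?a ?v k)"
    proof (cases "\<mu> k \<le> \<epsilon>")
      case True
      then have "\<mu> k * (2 * ?a u k) \<le> \<epsilon> * (2 * ?a u k)" by (intro mult_right_mono) auto
      with * True show ?thesis by simp
    qed (use \<epsilon> \<mu> in simp)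
    then have "ennreal (if \<mu> k \<le> \<epsilon> then \<mu> k * ?a f k else 0) \<le> ennreal (2 * \<epsilon> * ?a u k + 2 * (\<mu> k * ?a ?v k))"
      by (rule ennreal_leI)
    also have "\<dots> = ennreal (2 * \<epsilon> * ?a u k) + ennreal (2 * (\<mu> k * ?a ?v k))"
      using \<epsilon> \<mu> by (intro ennreal_plus) auto
    finally show ?thesis using \<epsilon> by (simp add: ennreal_mult')
  qed
  have "(\<Sum>k. ennreal (if \<mu> k \<le> \<epsilon> then \<mu> k * ?a f k else 0)) \<le>
      (\<Sum>k. ennreal (2 * \<epsilon>) * ennreal (?a u k) + 2 * ennreal (\<mu> k * ?a ?v k))"
    by (intro suminf_le pt summableI)
  also have "\<dots> = ennreal (2 * \<epsilon>) * (\<Sum>k. ennreal (?a u k)) + 2 * (\<Sum>k. ennreal (\<mu> k * ?a ?v k))"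
    by (simp add: suminf_add[symmetric] ennreal_suminf_cmult)
  also have "(\<Sum>k. ennreal (\<mu> k * ?a ?v k)) = loc_form m \<phi> ?v"
    by (rule spectral_quadratic_form[OF sd \<phi> v m])
  also have "(\<Sum>k. ennreal (?a u k)) \<le> ennreal (sqnorm lborel u)"
  proof (rule suminf_le_const[OF summableI])
    fix n
    have "(\<Sum>k<n. ennreal (?a u k)) = ennreal (\<Sum>k<n. ?a u k)" by (rule sum_ennreal) auto
    also have "\<dots> \<le> ennreal (sqnorm lborel u)"
      by (intro ennreal_leI Bessel_inequality[OF e o u]) auto
    finally show "(\<Sum>k<n. ennreal (?a u k)) \<le> ennreal (sqnorm lborel u)" .
  qed
  finally show ?thesis
    using \<epsilon> by (simp add: ennreal_mult' mult_left_mono add_mono)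
qed

text \<open>Orthonormality leaves a single term of \<open>spectral_quadratic_form\<close> at an
  eigenfunction. In this way bounds on the forms become bounds on the eigenvalues.\<close>

lemma spectral_eigenvalue:
  assumes sd: "spectral_decomposition (loc_op m \<phi>) \<mu> e" and \<phi>: "\<phi> \<in> L2 lborel"
    and m: "integrable lborel m" "\<And>z. 0 \<le> m z"
  shows "loc_form m \<phi> (e k) = ennreal (\<mu> k)" and "sqnorm lborel (e k) = 1"
proof -
  have e: "e k \<in> L2 lborel" for k
    using sd by (auto simp: spectral_decomposition_def square_integrable_eq_L2)
  have o: "ip lborel (e j) (e k) = (if j = k then 1 else 0)" for j k
    using sd by (simp add: spectral_decomposition_def l2_inner_eq_ip)
  have "loc_form m \<phi> (e k) = (\<Sum>j. ennreal (\<mu> j * (cmod (ip lborel (e k) (e j)))\<^sup>2))"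
    by (rule spectral_quadratic_form[OF sd \<phi> e m, symmetric])
  also have "\<dots> = (\<Sum>j. if j = k then ennreal (\<mu> k) else 0)"
    by (intro suminf_cong) (auto simp: o)
  also have "\<dots> = (\<Sum>j\<in>{k}. if j = k then ennreal (\<mu> k) else 0)"
    by (rule suminf_finite) auto
  finally show "loc_form m \<phi> (e k) = ennreal (\<mu> k)" by simp
  show "sqnorm lborel (e k) = 1"
    using o[of k k] unfolding ip_self by (simp only: if_True refl) (metis of_real_eq_1_iff)
qed

text \<open>All windows lie near one normalized window \<open>\<psi>\<close>. The constant is the
  square of 1/2: in L2 the transforms deviate by at most half of the norm of \<open>f\<close>, which
  leaves a positive share of the transform of \<open>\<psi>\<close>.\<close>

definition clustered_windows :: "'i set \<Rightarrow> ('i \<Rightarrow> real \<Rightarrow> complex) \<Rightarrow> bool" where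
  "clustered_windows I \<phi> \<longleftrightarrow> (\<forall>i\<in>I. \<phi> i \<in> L2 lborel) \<and> (\<exists>\<psi>\<in>L2 lborel. sqnorm lborel \<psi> = 1 \<and>
     uniformly_small I (\<lambda>i t. \<psi> t - \<phi> i t) (1 / 4))"

text \<open>Bounds of the squared transforms that are the same for all windows:
  \<open>2 * V^2 + 2 * D^2\<close> above, and below the square of \<open>V - D\<close>, where
  subtraction of extended reals stops at 0. The constants come from \<open>2 + 2 / 4\<close> and
  from solving \<open>1 \<le> 2 * l + 2 / 4\<close> for \<open>l\<close>.\<close>

lemma clustered_windows_majorants:
  assumes "clustered_windows I \<phi>" and f: "f \<in> L2 lborel"
  obtains U L :: "real \<times> real \<Rightarrow> ennreal" where
    "U \<in> borel_measurable borel" "L \<in> borel_measurable borel"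
    "\<And>i z. i \<in> I \<Longrightarrow> ennreal ((cmod (stft (\<phi> i) f z))\<^sup>2) \<le> U z"
    "\<And>i z. i \<in> I \<Longrightarrow> L z \<le> ennreal ((cmod (stft (\<phi> i) f z))\<^sup>2)"
    "(\<integral>\<^sup>+z. U z \<partial>lborel) \<le> ennreal (5 / 2 * sqnorm lborel f)"
    "ennreal (1 / 4 * sqnorm lborel f) \<le> (\<integral>\<^sup>+z. L z \<partial>lborel)"
proof -
  have \<phi>: "\<phi> i \<in> L2 lborel" if "i \<in> I" for i
    using assms(1) that by (simp add: clustered_windows_def)
  obtain \<psi> where \<psi>: "\<psi> \<in> L2 lborel" "sqnorm lborel \<psi> = 1"
    and small: "uniformly_small I (\<lambda>i t. \<psi> t - \<phi> i t) (1 / 4)"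
    using assms(1) by (auto simp: clustered_windows_def)
  obtain D where D [measurable]: "D \<in> borel_measurable borel"
    and D0: "\<forall>i\<in>I. \<forall>z. ennreal (cmod (stft (\<lambda>t. \<psi> t - \<phi> i t) f z)) \<le> D z"
    and D2: "(\<integral>\<^sup>+z. (D z)\<^sup>2 \<partial>lborel) \<le> ennreal (1 / 4 * sqnorm lborel f)"
    using small f unfolding uniformly_small_def by blast
  have D1: "ennreal (cmod (stft \<psi> f z - stft (\<phi> i) f z)) \<le> D z" if "i \<in> I" for i z
    using D0[rule_format, OF that, of z] by (simp add: stft_diff_window f \<psi> \<phi> that)
  note [measurable] = L2_borel_measurable[OF f] L2_borel_measurable[OF \<psi>(1)]
  define V where "V z = ennreal (cmod (stft \<psi> f z))" for z
  have [measurable]: "V \<in> borel_measurable borel" unfolding V_def by measurable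
  have VV: "(\<integral>\<^sup>+z. (V z)\<^sup>2 \<partial>lborel) = ennreal (sqnorm lborel f)"
    using Moyal[OF f \<psi>(1)] \<psi>(2) by (simp add: V_def ennreal_power)
  have tri1: "ennreal (cmod (stft (\<phi> i) f z)) \<le> V z + D z" if "i \<in> I" for i z
  proof -
    have "ennreal (cmod (stft (\<phi> i) f z)) \<le> V z + ennreal (cmod (stft \<psi> f z - stft (\<phi> i) f z))"
      unfolding V_def using norm_triangle_ineq4[of "stft \<psi> f z" "stft \<psi> f z - stft (\<phi> i) f z"]
      by (simp add: ennreal_leI flip: ennreal_plus)
    also have "\<dots> \<le> V z + D z" using D1[OF that] by (intro add_left_mono)
    finally show ?thesis .
  qed
  have tri2: "V z \<le> ennreal (cmod (stft (\<phi> i) f z)) + D z" if "i \<in> I" for i z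
  proof -
    have "V z \<le> ennreal (cmod (stft (\<phi> i) f z)) + ennreal (cmod (stft \<psi> f z - stft (\<phi> i) f z))"
      unfolding V_def using norm_triangle_ineq[of "stft (\<phi> i) f z" "stft \<psi> f z - stft (\<phi> i) f z"]
      by (simp add: ennreal_leI flip: ennreal_plus)
    also have "\<dots> \<le> ennreal (cmod (stft (\<phi> i) f z)) + D z" using D1[OF that] by (intro add_left_mono)
    finally show ?thesis .
  qed
  show ?thesis
  proof (rule that[of "\<lambda>z. 2 * (V z)\<^sup>2 + 2 * (D z)\<^sup>2" "\<lambda>z. (V z - D z)\<^sup>2"])
    show "ennreal ((cmod (stft (\<phi> i) f z))\<^sup>2) \<le> 2 * (V z)\<^sup>2 + 2 * (D z)\<^sup>2" if "i \<in> I" for i z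
    proof -
      have "(ennreal (cmod (stft (\<phi> i) f z)))\<^sup>2 \<le> (V z + D z)\<^sup>2"
        by (intro power_mono tri1 that) auto
      also note ennreal_power2_add_le
      finally show ?thesis by (simp add: ennreal_power)
    qed
    show "(V z - D z)\<^sup>2 \<le> ennreal ((cmod (stft (\<phi> i) f z))\<^sup>2)" if "i \<in> I" for i z
    proof -
      have "V z - D z \<le> ennreal (cmod (stft (\<phi> i) f z))"
        using tri2[OF that, of z] by (simp add: ennreal_minus_le_iff add.commute V_def)
      then have "(V z - D z)\<^sup>2 \<le> (ennreal (cmod (stft (\<phi> i) f z)))\<^sup>2"
        by (intro power_mono) auto
      then show ?thesis by (simp add: ennreal_power)
    qed
    have "(\<integral>\<^sup>+z. 2 * (V z)\<^sup>2 + 2 * (D z)\<^sup>2 \<partial>lborel) = 2 * (\<integral>\<^sup>+z. (V z)\<^sup>2 \<partial>lborel) + 2 * (\<integral>\<^sup>+z. (D z)\<^sup>2 \<partial>lborel)"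
      by (simp add: nn_integral_add nn_integral_cmult)
    also have "\<dots> \<le> 2 * ennreal (sqnorm lborel f) + 2 * ennreal (1 / 4 * sqnorm lborel f)"
      unfolding VV by (intro add_mono mult_left_mono D2) auto
    also have "\<dots> = ennreal (2 * sqnorm lborel f + 2 * (1 / 4 * sqnorm lborel f))"
      by (simp only: ennreal_plus ennreal_mult ennreal_numeral sqnorm_nonneg mult_nonneg_nonneg zero_le_numeral zero_le_divide_1_iff)
    also have "2 * sqnorm lborel f + 2 * (1 / 4 * sqnorm lborel f) = 5 / 2 * sqnorm lborel f" by simp
    finally show "(\<integral>\<^sup>+z. 2 * (V z)\<^sup>2 + 2 * (D z)\<^sup>2 \<partial>lborel) \<le> ennreal (5 / 2 * sqnorm lborel f)" .
    show "ennreal (1 / 4 * sqnorm lborel f) \<le> (\<integral>\<^sup>+z. (V z - D z)\<^sup>2 \<partial>lborel)"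
    proof (cases "\<integral>\<^sup>+z. (V z - D z)\<^sup>2 \<partial>lborel")
      case (real l)
      have "ennreal (sqnorm lborel f) \<le> (\<integral>\<^sup>+z. 2 * (V z - D z)\<^sup>2 + 2 * (D z)\<^sup>2 \<partial>lborel)"
        unfolding VV[symmetric]
      proof (intro nn_integral_mono)
        fix z
        \<comment> \<open>Only an inequality, since the truncated difference is 0 where
          \<open>D z\<close> exceeds \<open>V z\<close>.\<close>
        have "V z \<le> (V z - D z) + D z"
          by (cases "D z \<le> V z") (auto simp: diff_add_cancel_ennreal not_le intro: order_less_imp_le add_increasing)
        then have "(V z)\<^sup>2 \<le> ((V z - D z) + D z)\<^sup>2" by (intro power_mono) auto
        also note ennreal_power2_add_le
        finally show "(V z)\<^sup>2 \<le> 2 * (V z - D z)\<^sup>2 + 2 * (D z)\<^sup>2" .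
      qed
      also have "\<dots> = 2 * (\<integral>\<^sup>+z. (V z - D z)\<^sup>2 \<partial>lborel) + 2 * (\<integral>\<^sup>+z. (D z)\<^sup>2 \<partial>lborel)"
        by (simp add: nn_integral_add nn_integral_cmult)
      also have "\<dots> \<le> 2 * ennreal l + 2 * ennreal (1 / 4 * sqnorm lborel f)"
        using real by (intro add_mono mult_left_mono D2) auto
      also have "\<dots> = ennreal (2 * l + 2 * (1 / 4 * sqnorm lborel f))"
        using real by (simp only: ennreal_plus ennreal_mult ennreal_numeral sqnorm_nonneg mult_nonneg_nonneg zero_le_numeral zero_le_divide_1_iff)
      finally have "sqnorm lborel f \<le> 2 * l + 2 * (1 / 4 * sqnorm lborel f)"
        using real by (subst (asm) ennreal_le_iff) auto
      then show ?thesis using real by (simp add: ennreal_leI)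
    qed simp
  qed measurable
qed

lemma loc_form_sum_le:
  fixes \<eta> :: "'a \<Rightarrow> real \<times> real \<Rightarrow> real"
  assumes cl: "clustered_windows I \<phi>" and f: "f \<in> L2 lborel"
    and meas: "\<And>\<gamma>. \<gamma> \<in> F \<Longrightarrow> \<eta> \<gamma> \<in> borel_measurable borel" and nonneg: "\<And>\<gamma> z. \<gamma> \<in> F \<Longrightarrow> 0 \<le> \<eta> \<gamma> z"
    and sumB: "\<And>z. (\<Sum>\<gamma>\<in>F. \<eta> \<gamma> z) \<le> B" and B: "0 \<le> B" and \<iota>: "\<And>\<gamma>. \<gamma> \<in> F \<Longrightarrow> \<iota> \<gamma> \<in> I"
  shows "(\<Sum>\<gamma>\<in>F. loc_form (\<eta> \<gamma>) (\<phi> (\<iota> \<gamma>)) f) \<le> ennreal (5 / 2 * B * sqnorm lborel f)"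
proof -
  obtain U L where U [measurable]: "U \<in> borel_measurable borel"
    and U1: "\<And>i z. i \<in> I \<Longrightarrow> ennreal ((cmod (stft (\<phi> i) f z))\<^sup>2) \<le> U z"
    and U2: "(\<integral>\<^sup>+z. U z \<partial>lborel) \<le> ennreal (5 / 2 * sqnorm lborel f)"
    using clustered_windows_majorants[OF cl f] by (metis (no_types))
  have "(\<Sum>\<gamma>\<in>F. loc_form (\<eta> \<gamma>) (\<phi> (\<iota> \<gamma>)) f) \<le> (\<Sum>\<gamma>\<in>F. \<integral>\<^sup>+z. ennreal (\<eta> \<gamma> z) * U z \<partial>lborel)"
    unfolding loc_form_def by (intro sum_mono nn_integral_mono mult_left_mono U1 \<iota>) auto
  also have "\<dots> = (\<integral>\<^sup>+z. (\<Sum>\<gamma>\<in>F. ennreal (\<eta> \<gamma> z) * U z) \<partial>lborel)"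
    using meas by (intro nn_integral_sum[symmetric]) auto
  also have "\<dots> \<le> (\<integral>\<^sup>+z. ennreal B * U z \<partial>lborel)"
    by (intro nn_integral_mono sum_ennreal_weights_le nonneg sumB)
  also have "\<dots> = ennreal B * (\<integral>\<^sup>+z. U z \<partial>lborel)"
    by (intro nn_integral_cmult) measurable
  also have "\<dots> \<le> ennreal B * ennreal (5 / 2 * sqnorm lborel f)"
    by (intro mult_left_mono U2) auto
  also have "\<dots> = ennreal (B * (5 / 2 * sqnorm lborel f))"
    using B by (intro ennreal_mult[symmetric]) auto
  also have "B * (5 / 2 * sqnorm lborel f) = 5 / 2 * B * sqnorm lborel f" by simp
  finally show ?thesis .
qed

text \<open>The infinite sum of the forms is never formed: \<open>T\<close> is any bound of the
  finite sums. Along an enumeration of \<open>\<Gamma>\<close> the weights reach at least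
  \<open>A\<close> in the supremum, and monotone convergence carries this under the integral against
  the common lower bound \<open>L\<close>.\<close>

lemma loc_form_sum_ge:
  fixes \<eta> :: "'a \<Rightarrow> real \<times> real \<Rightarrow> real"
  assumes cl: "clustered_windows I \<phi>" and f: "f \<in> L2 lborel"
    and \<Gamma>: "countable \<Gamma>"
    and meas: "\<And>\<gamma>. \<gamma> \<in> \<Gamma> \<Longrightarrow> \<eta> \<gamma> \<in> borel_measurable borel" and nonneg: "\<And>\<gamma> z. \<gamma> \<in> \<Gamma> \<Longrightarrow> 0 \<le> \<eta> \<gamma> z"
    and summable: "\<And>z. (\<lambda>\<gamma>. \<eta> \<gamma> z) summable_on \<Gamma>" and sumA: "\<And>z. A \<le> (\<Sum>\<^sub>\<infinity>\<gamma>\<in>\<Gamma>. \<eta> \<gamma> z)" and A: "0 \<le> A"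
    and \<iota>: "\<And>\<gamma>. \<gamma> \<in> \<Gamma> \<Longrightarrow> \<iota> \<gamma> \<in> I"
    and T: "\<And>F. finite F \<Longrightarrow> F \<subseteq> \<Gamma> \<Longrightarrow> (\<Sum>\<gamma>\<in>F. loc_form (\<eta> \<gamma>) (\<phi> (\<iota> \<gamma>)) f) \<le> T"
  shows "ennreal (A / 4 * sqnorm lborel f) \<le> T"
proof -
  obtain U L where L [measurable]: "L \<in> borel_measurable borel"
    and L1: "\<And>i z. i \<in> I \<Longrightarrow> L z \<le> ennreal ((cmod (stft (\<phi> i) f z))\<^sup>2)"
    and L2: "ennreal (1 / 4 * sqnorm lborel f) \<le> (\<integral>\<^sup>+z. L z \<partial>lborel)"
    using clustered_windows_majorants[OF cl f] by (metis (no_types))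
  define F where "F n = {\<gamma>\<in>\<Gamma>. to_nat_on \<Gamma> \<gamma> < n}" for n
  have F: "finite (F n)" "F n \<subseteq> \<Gamma>" for n
  proof -
    have "inj_on (to_nat_on \<Gamma>) (F n)"
      using inj_on_to_nat_on[OF \<Gamma>] by (rule inj_on_subset) (auto simp: F_def)
    moreover have "to_nat_on \<Gamma> ` F n \<subseteq> {..<n}" by (auto simp: F_def)
    ultimately show "finite (F n)" using finite_subset finite_imageD by blast
  qed (auto simp: F_def)
  \<comment> \<open>The initial segments eventually contain every finite subset, so the unordered
    sum is also the limit along them.\<close>
  have F_lim: "filterlim F (finite_subsets_at_top \<Gamma>) sequentially"
    unfolding filterlim_finite_subsets_at_top
  proof (intro allI impI)
    fix X assume X: "finite X \<and> X \<subseteq> \<Gamma>"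
    then have "finite (to_nat_on \<Gamma> ` X)" by auto
    then obtain N where "\<forall>x\<in>to_nat_on \<Gamma> ` X. x < N" using finite_nat_set_iff_bounded by auto
    then show "\<forall>\<^sub>F n in sequentially. finite (F n) \<and> X \<subseteq> F n \<and> F n \<subseteq> \<Gamma>"
      using X F by (intro eventually_sequentiallyI[of N]) (force simp: F_def)
  qed
  define G where "G n z = (\<Sum>\<gamma>\<in>F n. ennreal (\<eta> \<gamma> z))" for n z
  have Gm [measurable]: "G n \<in> borel_measurable borel" for n
    unfolding G_def
  proof (intro borel_measurable_sum)
    fix \<gamma> assume "\<gamma> \<in> F n"
    then have "\<gamma> \<in> \<Gamma>" using F by auto
    note [measurable] = meas[OF this]
    show "(\<lambda>z. ennreal (\<eta> \<gamma> z)) \<in> borel_measurable borel" by measurable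
  qed
  have G_inc: "incseq (\<lambda>n. G n z)" for z
    unfolding G_def incseq_def by (intro allI impI sum_mono2 F) (auto simp: F_def)
  have G_sup: "ennreal A \<le> (SUP n. G n z)" for z
  proof -
    have "((\<lambda>F. \<Sum>\<gamma>\<in>F. \<eta> \<gamma> z) \<longlongrightarrow> (\<Sum>\<^sub>\<infinity>\<gamma>\<in>\<Gamma>. \<eta> \<gamma> z)) (finite_subsets_at_top \<Gamma>)"
      using has_sum_infsum[OF summable] by (simp add: has_sum_def)
    then have "(\<lambda>n. \<Sum>\<gamma>\<in>F n. \<eta> \<gamma> z) \<longlonglongrightarrow> (\<Sum>\<^sub>\<infinity>\<gamma>\<in>\<Gamma>. \<eta> \<gamma> z)"
      by (rule filterlim_compose[OF _ F_lim])
    then have "(\<lambda>n. ennreal (\<Sum>\<gamma>\<in>F n. \<eta> \<gamma> z)) \<longlonglongrightarrow> ennreal (\<Sum>\<^sub>\<infinity>\<gamma>\<in>\<Gamma>. \<eta> \<gamma> z)"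
      by (rule tendsto_ennrealI)
    moreover have "ennreal (\<Sum>\<gamma>\<in>F n. \<eta> \<gamma> z) = G n z" for n
      unfolding G_def by (rule sum_ennreal[symmetric], rule nonneg) (use F in auto)
    ultimately have "(\<lambda>n. G n z) \<longlonglongrightarrow> ennreal (\<Sum>\<^sub>\<infinity>\<gamma>\<in>\<Gamma>. \<eta> \<gamma> z)" by simp
    moreover have "(\<lambda>n. G n z) \<longlonglongrightarrow> (SUP n. G n z)" by (rule LIMSEQ_SUP[OF G_inc])
    ultimately have "(SUP n. G n z) = ennreal (\<Sum>\<^sub>\<infinity>\<gamma>\<in>\<Gamma>. \<eta> \<gamma> z)" by (rule LIMSEQ_unique[symmetric])
    then show ?thesis using sumA[of z] by (simp add: ennreal_leI)
  qed
  have "A / 4 * sqnorm lborel f = A * (1 / 4 * sqnorm lborel f)" by simp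
  then have "ennreal (A / 4 * sqnorm lborel f) = ennreal A * ennreal (1 / 4 * sqnorm lborel f)"
    using A by (simp only: ennreal_mult sqnorm_nonneg mult_nonneg_nonneg zero_le_divide_1_iff zero_le_numeral)
  also have "\<dots> \<le> ennreal A * (\<integral>\<^sup>+z. L z \<partial>lborel)"
    by (intro mult_left_mono L2) auto
  also have "\<dots> = (\<integral>\<^sup>+z. ennreal A * L z \<partial>lborel)"
    by (intro nn_integral_cmult[symmetric]) measurable
  also have "\<dots> \<le> (\<integral>\<^sup>+z. (SUP n. G n z * L z) \<partial>lborel)"
    using G_sup by (intro nn_integral_mono) (simp add: SUP_mult_right_ennreal[symmetric] mult_right_mono)
  also have "\<dots> = (SUP n. \<integral>\<^sup>+z. G n z * L z \<partial>lborel)"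
    using G_inc by (intro nn_integral_monotone_convergence_SUP) (auto simp: incseq_def le_fun_def mult_right_mono)
  also have "\<dots> \<le> T"
  proof (intro SUP_least)
    fix n
    have "(\<integral>\<^sup>+z. G n z * L z \<partial>lborel) = (\<integral>\<^sup>+z. (\<Sum>\<gamma>\<in>F n. ennreal (\<eta> \<gamma> z) * L z) \<partial>lborel)"
      by (simp add: G_def sum_distrib_right)
    also have "\<dots> = (\<Sum>\<gamma>\<in>F n. \<integral>\<^sup>+z. ennreal (\<eta> \<gamma> z) * L z \<partial>lborel)"
    proof (rule nn_integral_sum)
      fix \<gamma> assume "\<gamma> \<in> F n"
      then have "\<gamma> \<in> \<Gamma>" using F by auto
      note [measurable] = meas[OF this]
      show "(\<lambda>z. ennreal (\<eta> \<gamma> z) * L z) \<in> borel_measurable lborel" by measurable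
    qed
    also have "\<dots> \<le> (\<Sum>\<gamma>\<in>F n. loc_form (\<eta> \<gamma>) (\<phi> (\<iota> \<gamma>)) f)"
      unfolding loc_form_def using F \<iota> by (intro sum_mono nn_integral_mono mult_left_mono L1) auto
    also have "\<dots> \<le> T" by (intro T F)
    finally show "(\<integral>\<^sup>+z. G n z * L z \<partial>lborel) \<le> T" .
  qed
  finally show ?thesis .
qed

section \<open>Frames of eigenfunctions\<close>

lemma suminf_add_ennreal: "(\<Sum>k. f k + g k) = (\<Sum>k. f k) + (\<Sum>k. g k :: ennreal)"
  by (rule suminf_add[symmetric]) auto

text \<open>On the retained pairs the eigenvalues lie between \<open>\<epsilon>\<close> and
  \<open>M\<close>, so the weighted and the unweighted sums of the coefficients are comparable. The
  lower bound survives because the discarded part takes only \<open>c\<close> out of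
  \<open>2 * c\<close>.\<close>

lemma eigenfunction_frame_bounds:
  fixes \<mu> :: "'a \<Rightarrow> nat \<Rightarrow> real" and e :: "'a \<Rightarrow> nat \<Rightarrow> real \<Rightarrow> complex" and \<eta> :: "'a \<Rightarrow> real \<times> real \<Rightarrow> real"
    and \<psi> :: "'a \<Rightarrow> real \<Rightarrow> complex"
  defines "a \<equiv> \<lambda>f (\<gamma>, k). (cmod (ip lborel f (e \<gamma> k)))\<^sup>2"
  assumes \<epsilon>: "0 < \<epsilon>" and M: "0 < M"
    and sd: "\<And>\<gamma>. \<gamma> \<in> \<Gamma> \<Longrightarrow> spectral_decomposition (loc_op (\<eta> \<gamma>) (\<psi> \<gamma>)) (\<mu> \<gamma>) (e \<gamma>)"
    and \<eta>: "\<And>\<gamma>. \<gamma> \<in> \<Gamma> \<Longrightarrow> integrable lborel (\<eta> \<gamma>)" "\<And>\<gamma> z. \<gamma> \<in> \<Gamma> \<Longrightarrow> 0 \<le> \<eta> \<gamma> z"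
    and \<psi>: "\<And>\<gamma>. \<gamma> \<in> \<Gamma> \<Longrightarrow> \<psi> \<gamma> \<in> L2 lborel"
    and upper: "\<And>f F. f \<in> L2 lborel \<Longrightarrow> finite F \<Longrightarrow> F \<subseteq> \<Gamma> \<Longrightarrow> (\<Sum>\<gamma>\<in>F. loc_form (\<eta> \<gamma>) (\<psi> \<gamma>) f) \<le> ennreal (M * sqnorm lborel f)"
    and lower: "\<And>f T. f \<in> L2 lborel \<Longrightarrow> (\<And>F. finite F \<Longrightarrow> F \<subseteq> \<Gamma> \<Longrightarrow> (\<Sum>\<gamma>\<in>F. loc_form (\<eta> \<gamma>) (\<psi> \<gamma>) f) \<le> T) \<Longrightarrow>
      ennreal (2 * c * sqnorm lborel f) \<le> T"
    and small: "\<And>f F. f \<in> L2 lborel \<Longrightarrow> finite F \<Longrightarrow> F \<subseteq> \<Gamma> \<Longrightarrow>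
      (\<Sum>\<gamma>\<in>F. \<Sum>k. ennreal (if \<mu> \<gamma> k \<le> \<epsilon> then \<mu> \<gamma> k * a f (\<gamma>, k) else 0)) \<le> ennreal (c * sqnorm lborel f)"
    and c: "0 < c" and f: "f \<in> L2 lborel"
  defines "J \<equiv> {(\<gamma>, k). \<gamma> \<in> \<Gamma> \<and> \<mu> \<gamma> k > \<epsilon>}"
  shows "a f summable_on J"
    and "c / M * sqnorm lborel f \<le> (\<Sum>\<^sub>\<infinity>p\<in>J. a f p)"
    and "(\<Sum>\<^sub>\<infinity>p\<in>J. a f p) \<le> M / \<epsilon> * sqnorm lborel f"
proof -
  let ?b = "\<lambda>\<gamma> k. (if \<mu> \<gamma> k \<le> \<epsilon> then 0 else \<mu> \<gamma> k * a f (\<gamma>, k))"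
  have \<mu>: "0 \<le> \<mu> \<gamma> k" if "\<gamma> \<in> \<Gamma>" for \<gamma> k using sd[OF that] by (simp add: spectral_decomposition_def)
  have eL: "e \<gamma> k \<in> L2 lborel" if "\<gamma> \<in> \<Gamma>" for \<gamma> k
    using sd[OF that] by (auto simp: spectral_decomposition_def square_integrable_eq_L2)
  have quad: "(\<Sum>k. ennreal (\<mu> \<gamma> k * a f (\<gamma>, k))) = loc_form (\<eta> \<gamma>) (\<psi> \<gamma>) f" if "\<gamma> \<in> \<Gamma>" for \<gamma>
    unfolding a_def prod.case using that by (intro spectral_quadratic_form sd \<psi> \<eta> f)
  have a0: "0 \<le> a f p" for p by (simp add: a_def split: prod.split)
  let ?n = "sqnorm lborel f"
  have fin_le: "sum (a f) X \<le> M / \<epsilon> * ?n" if X: "finite X" "X \<subseteq> J" for X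
  proof -
    \<comment> \<open>A rectangle that contains the finite set \<open>X\<close> links its sum with
      the series over \<open>k\<close>.\<close>
    obtain n where n: "\<And>p. p \<in> X \<Longrightarrow> snd p < n"
      using finite_nat_set_iff_bounded[of "snd ` X"] X by auto
    have G: "finite (fst ` X)" "fst ` X \<subseteq> \<Gamma>" using X by (auto simp: J_def)
    have "ennreal (\<epsilon> * sum (a f) X) = (\<Sum>p\<in>X. ennreal (\<epsilon> * a f p))"
      using \<epsilon> a0 by (simp add: sum_ennreal sum_distrib_left)
    also have "\<dots> \<le> (\<Sum>p\<in>X. ennreal (\<mu> (fst p) (snd p) * a f p))"
      using X a0 by (intro sum_mono ennreal_leI mult_right_mono) (auto simp: J_def)
    also have "\<dots> \<le> (\<Sum>p\<in>fst ` X \<times> {..<n}. ennreal (\<mu> (fst p) (snd p) * a f p))"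
      using X n by (intro sum_mono2) (auto simp: image_iff, force)
    also have "\<dots> = (\<Sum>\<gamma>\<in>fst ` X. \<Sum>k<n. ennreal (\<mu> \<gamma> k * a f (\<gamma>, k)))"
      by (subst sum.cartesian_product) (intro sum.cong refl, auto)
    also have "\<dots> \<le> (\<Sum>\<gamma>\<in>fst ` X. \<Sum>k. ennreal (\<mu> \<gamma> k * a f (\<gamma>, k)))"
      by (intro sum_mono sum_le_suminf) auto
    also have "\<dots> = (\<Sum>\<gamma>\<in>fst ` X. loc_form (\<eta> \<gamma>) (\<psi> \<gamma>) f)"
      using G by (intro sum.cong refl quad) auto
    also have "\<dots> \<le> ennreal (M * ?n)" by (intro upper f G)
    finally have "\<epsilon> * sum (a f) X \<le> M * ?n"
      using M by (subst (asm) ennreal_le_iff) auto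
    then show ?thesis using \<epsilon> by (simp add: field_simps)
  qed
  show summ: "a f summable_on J"
  proof (rule nonneg_bdd_above_summable_on)
    show "bdd_above (sum (a f) ` {F. F \<subseteq> J \<and> finite F})"
      by (rule bdd_aboveI2[of _ _ "M / \<epsilon> * ?n"]) (use fin_le in blast)
  qed (rule a0)
  show "(\<Sum>\<^sub>\<infinity>p\<in>J. a f p) \<le> M / \<epsilon> * ?n"
    by (rule infsum_le_finite_sums[OF summ fin_le])
  define T where "T = (\<Sum>\<^sub>\<infinity>p\<in>J. a f p)"
  have T0: "T \<ge> 0" unfolding T_def using a0 by (rule infsum_nonneg)
  \<comment> \<open>An eigenvalue is the value of one form at a unit vector, to which
    \<open>upper\<close> applies with a single index.\<close>
  have \<mu>_le: "\<mu> \<gamma> k \<le> M" if \<gamma>: "\<gamma> \<in> \<Gamma>" for \<gamma> k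
  proof -
    have "ennreal (\<mu> \<gamma> k) = (\<Sum>\<gamma>\<in>{\<gamma>}. loc_form (\<eta> \<gamma>) (\<psi> \<gamma>) (e \<gamma> k))"
      using spectral_eigenvalue(1)[OF sd \<psi> \<eta>] \<gamma> by simp
    also have "\<dots> \<le> ennreal (M * sqnorm lborel (e \<gamma> k))"
      using upper[OF eL[OF \<gamma>], of "{\<gamma>}" k] \<gamma> by simp
    also have "sqnorm lborel (e \<gamma> k) = 1"
      using \<gamma> by (intro spectral_eigenvalue(2)[OF sd \<psi> \<eta>])
    finally show ?thesis using M by (simp add: ennreal_le_iff)
  qed
  \<comment> \<open>\<open>lower\<close> asks for an upper bound of all finite sums; the retained
    and the discarded eigenvalues supply its two summands.\<close>
  have "ennreal (2 * c * ?n) \<le> ennreal (M * T + c * ?n)"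
  proof (rule lower[OF f])
    fix F assume F: "finite F" "F \<subseteq> \<Gamma>"
    have big: "(\<Sum>\<gamma>\<in>F. \<Sum>k. ennreal (?b \<gamma> k)) \<le> ennreal (M * T)"
    proof -
      \<comment> \<open>Exchanging the sums makes every partial sum a sum over a finite set of
        pairs, which \<open>T\<close> bounds.\<close>
      have "(\<Sum>\<gamma>\<in>F. \<Sum>k. ennreal (?b \<gamma> k)) =
          (\<Sum>k. \<Sum>\<gamma>\<in>F. ennreal (?b \<gamma> k))"
        by (rule suminf_sum[symmetric]) auto
      also have "\<dots> \<le> ennreal (M * T)"
      proof (rule suminf_le_const)
        fix n
        let ?X = "{p \<in> F \<times> {..<n}. p \<in> J}"
        have "(\<Sum>k<n. \<Sum>\<gamma>\<in>F. ennreal (?b \<gamma> k)) =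
          (\<Sum>\<gamma>\<in>F. \<Sum>k<n. ennreal (?b \<gamma> k))"
          by (rule sum.swap)
        also have "\<dots> = (\<Sum>p\<in>F \<times> {..<n}. ennreal (if \<mu> (fst p) (snd p) \<le> \<epsilon> then 0 else \<mu> (fst p) (snd p) * a f p))"
          by (subst sum.cartesian_product) (intro sum.cong refl, auto)
        also have "\<dots> = (\<Sum>p\<in>?X. ennreal (\<mu> (fst p) (snd p) * a f p))"
          using F by (intro sum.mono_neutral_cong_right) (auto simp: J_def)
        also have "\<dots> \<le> (\<Sum>p\<in>?X. ennreal (M * a f p))"
          using F a0 by (intro sum_mono ennreal_leI mult_right_mono \<mu>_le) auto
        also have "\<dots> = ennreal (M * sum (a f) ?X)"
          using M a0 by (simp add: sum_ennreal sum_distrib_left)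
        also have "\<dots> \<le> ennreal (M * T)"
          unfolding T_def using F M a0 by (intro ennreal_leI mult_left_mono finite_sum_le_infsum summ) auto
        finally show "(\<Sum>k<n. \<Sum>\<gamma>\<in>F. ennreal (?b \<gamma> k)) \<le> ennreal (M * T)" .
      qed auto
      finally show ?thesis .
    qed
    have "(\<Sum>\<gamma>\<in>F. loc_form (\<eta> \<gamma>) (\<psi> \<gamma>) f) =
      (\<Sum>\<gamma>\<in>F. (\<Sum>k. ennreal (?b \<gamma> k))
         + (\<Sum>k. ennreal (if \<mu> \<gamma> k \<le> \<epsilon> then \<mu> \<gamma> k * a f (\<gamma>, k) else 0)))"
    proof (intro sum.cong refl)
      fix \<gamma> assume "\<gamma> \<in> F"
      then have \<gamma>: "\<gamma> \<in> \<Gamma>" using F by auto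
      show "loc_form (\<eta> \<gamma>) (\<psi> \<gamma>) f = (\<Sum>k. ennreal (?b \<gamma> k))
         + (\<Sum>k. ennreal (if \<mu> \<gamma> k \<le> \<epsilon> then \<mu> \<gamma> k * a f (\<gamma>, k) else 0))"
        unfolding quad[OF \<gamma>, symmetric] suminf_add_ennreal[symmetric] by (intro suminf_cong) auto
    qed
    also have "\<dots> \<le> ennreal (M * T) + ennreal (c * ?n)"
      unfolding sum.distrib by (intro add_mono big small f F)
    also have "\<dots> = ennreal (M * T + c * ?n)"
      using M T0 c by (intro ennreal_plus[symmetric]) auto
    finally show "(\<Sum>\<gamma>\<in>F. loc_form (\<eta> \<gamma>) (\<psi> \<gamma>) f) \<le> ennreal (M * T + c * ?n)" .
  qed
  then have "2 * c * ?n \<le> M * T + c * ?n"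
    using M T0 c by (subst (asm) ennreal_le_iff) auto
  then show "c / M * ?n \<le> (\<Sum>\<^sub>\<infinity>p\<in>J. a f p)"
    using M unfolding T_def[symmetric] by (simp add: field_simps)
qed

lemma woven_eigenfunction_frames:
  fixes \<Gamma> :: "(real \<times> real) set" and \<eta> :: "real \<times> real \<Rightarrow> real \<times> real \<Rightarrow> real"
    and \<phi> :: "'i \<Rightarrow> real \<Rightarrow> complex" and \<mu> :: "'i \<Rightarrow> real \<times> real \<Rightarrow> nat \<Rightarrow> real"
  assumes ws: "well_spread \<Gamma> \<eta>" and nonneg: "\<And>\<gamma> z. \<gamma> \<in> \<Gamma> \<Longrightarrow> 0 \<le> \<eta> \<gamma> z"
    and A: "0 < A" and B: "0 < B" and summable: "\<And>z. (\<lambda>\<gamma>. \<eta> \<gamma> z) summable_on \<Gamma>"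
    and sumA: "\<And>z. A \<le> (\<Sum>\<^sub>\<infinity>\<gamma>\<in>\<Gamma>. \<eta> \<gamma> z)" and sumB: "\<And>z. (\<Sum>\<^sub>\<infinity>\<gamma>\<in>\<Gamma>. \<eta> \<gamma> z) \<le> B"
    and g: "g \<in> L2 lborel" "sqnorm lborel g = 1"
    and cl: "clustered_windows I \<phi>" and loc: "uniformly_localized g I \<phi>"
    and sd: "\<And>i \<gamma>. i \<in> I \<Longrightarrow> \<gamma> \<in> \<Gamma> \<Longrightarrow> spectral_decomposition (loc_op (\<eta> \<gamma>) (\<phi> i)) (\<mu> i \<gamma>) (e i \<gamma>)"
  shows "\<exists>\<epsilon>>0. \<forall>\<iota>. (\<forall>\<gamma>\<in>\<Gamma>. \<iota> \<gamma> \<in> I) \<longrightarrow>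
    l2_frame {(\<gamma>, k). \<gamma> \<in> \<Gamma> \<and> \<mu> (\<iota> \<gamma>) \<gamma> k > \<epsilon>} (\<lambda>(\<gamma>, k). e (\<iota> \<gamma>) \<gamma> k)"
proof -
  have \<phi>: "\<phi> i \<in> L2 lborel" if "i \<in> I" for i
    using cl that by (simp add: clustered_windows_def)
  have sep: "relatively_separated \<Gamma>" and int: "\<And>\<gamma>. \<gamma> \<in> \<Gamma> \<Longrightarrow> integrable lborel (\<eta> \<gamma>)"
    using ws by (auto simp: well_spread_def)
  then have meas: "\<And>\<gamma>. \<gamma> \<in> \<Gamma> \<Longrightarrow> \<eta> \<gamma> \<in> borel_measurable borel"
    using borel_measurable_integrable by fastforce
  obtain G where G: "polynomial_decay G" "\<And>\<gamma> \<xi>. \<gamma> \<in> \<Gamma> \<Longrightarrow> \<bar>\<eta> \<gamma> \<xi>\<bar> \<le> G (\<xi> - \<gamma>)"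
    using ws unfolding well_spread_def by (elim conjE exE) (rule that, assumption, blast)
  obtain C s where Cs: "2 < s" "\<And>z. \<bar>G z\<bar> \<le> C * (1 + norm z) powr (- s)"
    using G(1) by (auto simp: polynomial_decay_def)
  have C: "0 \<le> C" using Cs(2)[of 0] by simp
  have decay: "\<eta> \<gamma> z \<le> C * (1 + norm (z - \<gamma>)) powr (- s)" if "\<gamma> \<in> \<Gamma>" for \<gamma> z
    using G(2)[OF that, of z] Cs(2)[of "z - \<gamma>"] by linarith
  have fsum: "(\<Sum>\<gamma>\<in>F. \<eta> \<gamma> z) \<le> B" if F: "finite F" "F \<subseteq> \<Gamma>" for F z
  proof -
    have "(\<Sum>\<gamma>\<in>F. \<eta> \<gamma> z) \<le> (\<Sum>\<^sub>\<infinity>\<gamma>\<in>\<Gamma>. \<eta> \<gamma> z)"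
      using nonneg by (intro finite_sum_le_infsum summable F) auto
    then show ?thesis using sumB[of z] by linarith
  qed
  \<comment> \<open>The lower bound \<open>A / 4\<close> of \<open>loc_form_sum_ge\<close> is
    \<open>2 * c\<close>.\<close>
  define c where "c = A / 8"
  have c: "c > 0" using A by (simp add: c_def)
  define M where "M = 5 / 2 * B"
  have M: "M > 0" using B by (simp add: M_def)
  have c4: "0 < c / 4" using c by simp
  have "\<exists>N>0. \<forall>f\<in>L2 lborel. localized_approximation I \<phi> \<Gamma> \<eta> (c / 4) N f"
    by (rule ex_localized_approximation[OF sep _ _ _ B _ C Cs(1) g _ loc c4]) (fact meas nonneg fsum decay \<phi>)+
  then obtain N where N: "N > 0" and L: "\<And>f. f \<in> L2 lborel \<Longrightarrow> localized_approximation I \<phi> \<Gamma> \<eta> (c / 4) N f"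
    by blast
  \<comment> \<open>\<open>spectral_small_part\<close> then costs
    \<open>2 * \<epsilon> * N = c / 2\<close> for the approximants and \<open>2 * (c / 4)\<close>
    for the remainders, together \<open>c\<close>.\<close>
  define \<epsilon> where "\<epsilon> = c / (4 * N)"
  have \<epsilon>: "\<epsilon> > 0" using c N by (simp add: \<epsilon>_def)
  show ?thesis
  proof (intro exI[of _ \<epsilon>] conjI allI impI \<epsilon>)
    fix \<iota> :: "real \<times> real \<Rightarrow> 'i" assume \<iota>: "\<forall>\<gamma>\<in>\<Gamma>. \<iota> \<gamma> \<in> I"
    have sd': "spectral_decomposition (loc_op (\<eta> \<gamma>) (\<phi> (\<iota> \<gamma>))) (\<mu> (\<iota> \<gamma>) \<gamma>) (e (\<iota> \<gamma>) \<gamma>)" if "\<gamma> \<in> \<Gamma>" for \<gamma>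
      using sd \<iota> that by auto
    have upper: "(\<Sum>\<gamma>\<in>F. loc_form (\<eta> \<gamma>) (\<phi> (\<iota> \<gamma>)) f) \<le> ennreal (M * sqnorm lborel f)"
      if "f \<in> L2 lborel" "finite F" "F \<subseteq> \<Gamma>" for f F
      unfolding M_def using that \<iota> B by (intro loc_form_sum_le[OF cl] meas nonneg fsum) auto
    have lower: "ennreal (2 * c * sqnorm lborel f) \<le> T"
      if f: "f \<in> L2 lborel" and T: "\<And>F. finite F \<Longrightarrow> F \<subseteq> \<Gamma> \<Longrightarrow> (\<Sum>\<gamma>\<in>F. loc_form (\<eta> \<gamma>) (\<phi> (\<iota> \<gamma>)) f) \<le> T" for f T
    proof -
      have "ennreal (A / 4 * sqnorm lborel f) \<le> T"
        using A \<iota> by (intro loc_form_sum_ge[OF cl f relatively_separated_countable[OF sep] meas nonneg summable sumA _ _ T]) auto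
      then show ?thesis by (simp add: c_def)
    qed
    have small: "(\<Sum>\<gamma>\<in>F. \<Sum>k. ennreal (if \<mu> (\<iota> \<gamma>) \<gamma> k \<le> \<epsilon> then \<mu> (\<iota> \<gamma>) \<gamma> k * (case (\<gamma>, k) of (\<gamma>, k) \<Rightarrow> (cmod (ip lborel f (e (\<iota> \<gamma>) \<gamma> k)))\<^sup>2) else 0))
        \<le> ennreal (c * sqnorm lborel f)"
      if f: "f \<in> L2 lborel" and F: "finite F" "F \<subseteq> \<Gamma>" for f F
    proof -
      let ?n = "sqnorm lborel f"
      obtain u where u: "\<forall>\<gamma>. u \<gamma> \<in> L2 lborel"
        and u1: "\<forall>F. finite F \<longrightarrow> F \<subseteq> \<Gamma> \<longrightarrow> (\<Sum>\<gamma>\<in>F. sqnorm lborel (u \<gamma>)) \<le> N * ?n"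
        and u2: "\<forall>F \<iota>. finite F \<longrightarrow> F \<subseteq> \<Gamma> \<longrightarrow> (\<forall>\<gamma>\<in>F. \<iota> \<gamma> \<in> I) \<longrightarrow>
          (\<Sum>\<gamma>\<in>F. loc_form (\<eta> \<gamma>) (\<phi> (\<iota> \<gamma>)) (\<lambda>t. f t - u \<gamma> t)) \<le> ennreal (c / 4 * ?n)"
        using L[OF f] unfolding localized_approximation_def by (elim exE conjE) (rule that)
      have u2': "(\<Sum>\<gamma>\<in>F. loc_form (\<eta> \<gamma>) (\<phi> (\<iota> \<gamma>)) (\<lambda>t. f t - u \<gamma> t)) \<le> ennreal (c / 4 * ?n)"
        using F \<iota> by (intro u2[rule_format]) auto
      have "(\<Sum>\<gamma>\<in>F. \<Sum>k. ennreal (if \<mu> (\<iota> \<gamma>) \<gamma> k \<le> \<epsilon> then \<mu> (\<iota> \<gamma>) \<gamma> k * (cmod (ip lborel f (e (\<iota> \<gamma>) \<gamma> k)))\<^sup>2 else 0)) \<le>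
        (\<Sum>\<gamma>\<in>F. ennreal (2 * \<epsilon> * sqnorm lborel (u \<gamma>)) + 2 * loc_form (\<eta> \<gamma>) (\<phi> (\<iota> \<gamma>)) (\<lambda>t. f t - u \<gamma> t))"
        using F \<iota> u \<epsilon> by (intro sum_mono spectral_small_part sd' f int nonneg \<phi>) auto
      also have "\<dots> = ennreal (2 * \<epsilon> * (\<Sum>\<gamma>\<in>F. sqnorm lborel (u \<gamma>))) + 2 * (\<Sum>\<gamma>\<in>F. loc_form (\<eta> \<gamma>) (\<phi> (\<iota> \<gamma>)) (\<lambda>t. f t - u \<gamma> t))"
        using \<epsilon> by (simp add: sum.distrib sum_distrib_left sum_ennreal)
      also have "\<dots> \<le> ennreal (2 * \<epsilon> * (N * ?n)) + 2 * ennreal (c / 4 * ?n)"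
        using \<epsilon> F by (intro add_mono ennreal_leI mult_left_mono u1[rule_format] u2') auto
      also have "2 * ennreal (c / 4 * ?n) = ennreal (2 * (c / 4 * ?n))"
        using ennreal_mult[of 2 "c / 4 * ?n"] c by simp
      also have "ennreal (2 * \<epsilon> * (N * ?n)) + \<dots> = ennreal (2 * \<epsilon> * (N * ?n) + 2 * (c / 4 * ?n))"
        using c \<epsilon> N by (intro ennreal_plus[symmetric]) auto
      also have "2 * \<epsilon> * (N * ?n) + 2 * (c / 4 * ?n) = c * ?n"
        using N by (simp add: \<epsilon>_def)
      finally show ?thesis unfolding prod.case .
    qed
    have \<phi>': "\<phi> (\<iota> \<gamma>) \<in> L2 lborel" if "\<gamma> \<in> \<Gamma>" for \<gamma> using \<phi> \<iota> that by auto
    let ?J = "{(\<gamma>, k). \<gamma> \<in> \<Gamma> \<and> \<mu> (\<iota> \<gamma>) \<gamma> k > \<epsilon>}"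
    show "l2_frame ?J (\<lambda>(\<gamma>, k). e (\<iota> \<gamma>) \<gamma> k)"
      unfolding l2_frame_def
    proof (intro conjI exI ballI)
      have "?J \<subseteq> \<Gamma> \<times> UNIV" by auto
      then show "countable ?J"
        by (rule countable_subset) (use relatively_separated_countable[OF sep] in auto)
      show "(case p of (\<gamma>, k) \<Rightarrow> e (\<iota> \<gamma>) \<gamma> k) \<in> square_integrable" if "p \<in> ?J" for p
        using sd' that by (auto simp: spectral_decomposition_def)
      show "0 < c / M" using c M by simp
      \<comment> \<open>A frame asks for ordered bounds; the maximum makes the order
        immediate.\<close>
      show "c / M \<le> max (c / M) (M / \<epsilon>)" by simp
      fix f :: "real \<Rightarrow> complex" assume "f \<in> square_integrable"
      then have f: "f \<in> L2 lborel" by (simp add: square_integrable_eq_L2)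
      have eq: "(\<lambda>n. (cmod (l2_inner f (case n of (\<gamma>, k) \<Rightarrow> e (\<iota> \<gamma>) \<gamma> k)))\<^sup>2) =
          (\<lambda>(\<gamma>, k). (cmod (ip lborel f (e (\<iota> \<gamma>) \<gamma> k)))\<^sup>2)"
        by (auto simp: l2_inner_eq_ip fun_eq_iff)
      note bounds = eigenfunction_frame_bounds[where \<Gamma>=\<Gamma> and \<eta>=\<eta> and \<psi>="\<lambda>\<gamma>. \<phi> (\<iota> \<gamma>)"
          and \<mu>="\<lambda>\<gamma>. \<mu> (\<iota> \<gamma>) \<gamma>" and e="\<lambda>\<gamma>. e (\<iota> \<gamma>) \<gamma>", OF \<epsilon> M _ _ _ _ _ _ _ c f]
      show "(\<lambda>n. (cmod (l2_inner f (case n of (\<gamma>, k) \<Rightarrow> e (\<iota> \<gamma>) \<gamma> k)))\<^sup>2) summable_on ?J"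
        unfolding eq by (rule bounds(1)) (fact sd' int nonneg \<phi>' upper lower small)+
      show "c / M * (l2_norm f)\<^sup>2 \<le> (\<Sum>\<^sub>\<infinity>n\<in>?J. (cmod (l2_inner f (case n of (\<gamma>, k) \<Rightarrow> e (\<iota> \<gamma>) \<gamma> k)))\<^sup>2)"
        unfolding eq sqnorm_l2_norm by (rule bounds(2)) (fact sd' int nonneg \<phi>' upper lower small)+
      have "(\<Sum>\<^sub>\<infinity>n\<in>?J. (cmod (l2_inner f (case n of (\<gamma>, k) \<Rightarrow> e (\<iota> \<gamma>) \<gamma> k)))\<^sup>2) \<le> M / \<epsilon> * (l2_norm f)\<^sup>2"
        unfolding eq sqnorm_l2_norm by (rule bounds(3)) (fact sd' int nonneg \<phi>' upper lower small)+
      also have "\<dots> \<le> max (c / M) (M / \<epsilon>) * (l2_norm f)\<^sup>2"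
        by (intro mult_right_mono) auto
      finally show "(\<Sum>\<^sub>\<infinity>n\<in>?J. (cmod (l2_inner f (case n of (\<gamma>, k) \<Rightarrow> e (\<iota> \<gamma>) \<gamma> k)))\<^sup>2) \<le> max (c / M) (M / \<epsilon>) * (l2_norm f)\<^sup>2" .
    qed
  qed
qed

section \<open>Admissible windows\<close>

text \<open>The reproducing formula as an inequality: the full plane in
  \<open>stft_part_pointwise\<close>.\<close>

lemma stft_pointwise_le:
  assumes "f \<in> L2 lborel" "g \<in> L2 lborel" "sqnorm lborel g = 1" "\<psi> \<in> L2 lborel"
  shows "ennreal (cmod (stft \<psi> f z)) \<le>
    (\<integral>\<^sup>+w. ennreal (cmod (stft g f w)) * ennreal (cmod (stft g \<psi> (w - z))) \<partial>lborel)"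
  using stft_part_pointwise[OF assms(1,2,4) _ stft_part_UNIV[OF assms(1-3)], of z] by simp

text \<open>The pointwise Euclidean norm over \<open>I\<close> of the transforms is a common
  majorant, and Moyal's identity adds up the squared norms.\<close>

lemma finite_uniformly_small:
  assumes I: "finite I" and \<kappa>: "\<And>i. i \<in> I \<Longrightarrow> \<kappa> i \<in> L2 lborel"
    and \<delta>: "(\<Sum>i\<in>I. sqnorm lborel (\<kappa> i)) \<le> \<delta>"
  shows "uniformly_small I \<kappa> \<delta>"
  unfolding uniformly_small_def
proof
  fix h :: "real \<Rightarrow> complex" assume h: "h \<in> L2 lborel"
  let ?W = "\<lambda>i z. (cmod (stft (\<kappa> i) h z))\<^sup>2"
  have Wm: "?W i \<in> borel_measurable borel" if i: "i \<in> I" for i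
  proof -
    note [measurable] = L2_borel_measurable[OF h] L2_borel_measurable[OF \<kappa>[OF i]]
    show ?thesis by measurable
  qed
  let ?E = "\<lambda>z. ennreal (sqrt (\<Sum>i\<in>I. ?W i z))"
  show "\<exists>E\<in>borel_measurable borel. (\<forall>i\<in>I. \<forall>z. ennreal (cmod (stft (\<kappa> i) h z)) \<le> E z) \<and>
      (\<integral>\<^sup>+z. (E z)\<^sup>2 \<partial>lborel) \<le> ennreal (\<delta> * sqnorm lborel h)"
  proof (intro bexI[of _ ?E] conjI ballI allI)
    have "(\<lambda>z. \<Sum>i\<in>I. ?W i z) \<in> borel_measurable borel" by (intro borel_measurable_sum Wm)
    then show "?E \<in> borel_measurable borel" by measurable
    show "ennreal (cmod (stft (\<kappa> i) h z)) \<le> ?E z" if "i \<in> I" for i z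
      using member_le_sum[OF that, of "\<lambda>i. ?W i z"] I by (intro ennreal_leI real_le_rsqrt) auto
    have "(\<integral>\<^sup>+z. (?E z)\<^sup>2 \<partial>lborel) = (\<integral>\<^sup>+z. (\<Sum>i\<in>I. ennreal (?W i z)) \<partial>lborel)"
      by (intro nn_integral_cong) (simp add: ennreal_power sum_nonneg sum_ennreal)
    also have "\<dots> = (\<Sum>i\<in>I. \<integral>\<^sup>+z. ennreal (?W i z) \<partial>lborel)"
      using Wm by (intro nn_integral_sum) auto
    also have "\<dots> = (\<Sum>i\<in>I. ennreal (sqnorm lborel h * sqnorm lborel (\<kappa> i)))"
      by (intro sum.cong refl Moyal h \<kappa>)
    also have "\<dots> = ennreal (sqnorm lborel h * (\<Sum>i\<in>I. sqnorm lborel (\<kappa> i)))"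
      by (simp add: sum_ennreal sum_distrib_left)
    also have "\<dots> \<le> ennreal (\<delta> * sqnorm lborel h)"
      using mult_left_mono[OF \<delta> sqnorm_nonneg[of lborel h]] by (intro ennreal_leI) (simp only: mult.commute)
    finally show "(\<integral>\<^sup>+z. (?E z)\<^sup>2 \<partial>lborel) \<le> ennreal (\<delta> * sqnorm lborel h)" .
  qed
qed

text \<open>The first window serves as the common one, so that only the second contributes a
  deviation.\<close>

lemma close_pair_clustered:
  assumes \<phi>: "\<phi> i1 \<in> L2 lborel" "\<phi> i2 \<in> L2 lborel" and n: "sqnorm lborel (\<phi> i1) = 1"
    and d: "sqnorm lborel (\<lambda>t. \<phi> i1 t - \<phi> i2 t) \<le> 1 / 4"
  shows "clustered_windows {i1, i2} \<phi>"
  unfolding clustered_windows_def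
proof (intro bexI[of _ "\<phi> i1"] conjI n \<phi> finite_uniformly_small)
  show "(\<Sum>i\<in>{i1, i2}. sqnorm lborel (\<lambda>t. \<phi> i1 t - \<phi> i t)) \<le> 1 / 4"
    using d by (cases "i1 = i2") (auto simp: sqnorm_def)
qed (use \<phi> in \<open>auto intro: L2_diff\<close>)

text \<open>\<open>\<phi>'\<close> keeps the part of the transform inside a large ball. Its
  transform is at most the convolution of a bounded function, supported in that ball, with the
  integrable transform of the Gaussian, hence below an integrable kernel; what is cut off is small
  in norm. The kernels and errors of finitely many windows are added.\<close>

lemma finite_windows_uniformly_localized:
  assumes I: "finite I" and \<phi>: "\<And>i. i \<in> I \<Longrightarrow> \<phi> i \<in> L2 lborel"
  shows "uniformly_localized std_gaussian I \<phi>"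
  unfolding uniformly_localized_def
proof (intro allI impI)
  fix \<delta> :: real assume \<delta>: "\<delta> > 0"
  let ?g = std_gaussian
  note g = std_gaussian_L2 sqnorm_std_gaussian
  \<comment> \<open>The error is shared among the windows; the \<open>+ 1\<close> covers an empty
    \<open>I\<close>.\<close>
  define \<delta>' where "\<delta>' = \<delta> / (real (card I) + 1)"
  have \<delta>': "\<delta>' > 0" using \<delta> by (auto simp: \<delta>'_def intro!: divide_pos_pos add_nonneg_pos)
  have "\<exists>\<rho>. (\<integral>\<^sup>+z. ennreal ((cmod (stft ?g (\<phi> i) z))\<^sup>2) * indicator {z. \<rho> \<le> norm z} z \<partial>lborel) \<le> ennreal \<delta>'"
    if i: "i \<in> I" for i
  proof -
    note [measurable] = L2_borel_measurable[OF \<phi>[OF i]]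
    have "(\<integral>\<^sup>+z. ennreal ((cmod (stft ?g (\<phi> i) z))\<^sup>2) \<partial>lborel) < \<infinity>"
      by (simp add: Moyal \<phi> i g)
    from nn_integral_tail_small[OF _ this \<delta>'] show ?thesis by auto
  qed
  then obtain \<rho> where \<rho>: "\<And>i. i \<in> I \<Longrightarrow>
      (\<integral>\<^sup>+z. ennreal ((cmod (stft ?g (\<phi> i) z))\<^sup>2) * indicator {z. \<rho> i \<le> norm z} z \<partial>lborel) \<le> ennreal \<delta>'"
    by metis
  define \<phi>' where "\<phi>' i = loc_op (indicator (ball 0 (\<rho> i))) ?g (\<phi> i)" for i
  have part: "stft_part ?g (ball 0 (\<rho> i)) (\<phi> i) (\<phi>' i)" if "i \<in> I" for i
    unfolding \<phi>'_def using that by (intro stft_part_loc_op \<phi> g emeasure_lborel_ball_finite) measurable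
  then have \<phi>'L: "\<phi>' i \<in> L2 lborel" if "i \<in> I" for i using that by (auto simp: stft_part_def)
  have diffL: "(\<lambda>t. \<phi> i t - \<phi>' i t) \<in> L2 lborel" if "i \<in> I" for i
    using that by (intro L2_diff \<phi> \<phi>'L)
  have diff_small: "sqnorm lborel (\<lambda>t. \<phi> i t - \<phi>' i t) \<le> \<delta>'" if i: "i \<in> I" for i
  proof -
    have "ennreal (sqnorm lborel (\<lambda>t. \<phi> i t - \<phi>' i t)) \<le>
        (\<integral>\<^sup>+z. indicator (- ball 0 (\<rho> i)) z * ennreal ((cmod (stft ?g (\<phi> i) z))\<^sup>2) \<partial>lborel)"
      by (rule stft_part_sqnorm[OF \<phi>[OF i] g _ stft_part_Compl[OF \<phi>[OF i] g _ part[OF i]]]) measurable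
    also have "\<dots> = (\<integral>\<^sup>+z. ennreal ((cmod (stft ?g (\<phi> i) z))\<^sup>2) * indicator {z. \<rho> i \<le> norm z} z \<partial>lborel)"
      by (intro nn_integral_cong) (auto simp: indicator_def)
    also have "\<dots> \<le> ennreal \<delta>'" by (rule \<rho>[OF i])
    finally show ?thesis using \<delta>' by (simp add: ennreal_le_iff)
  qed
  define k where "k i z = (\<integral>\<^sup>+w. indicator (ball 0 (\<rho> i)) w * ennreal (cmod (stft ?g (\<phi> i) w)) *
      ennreal (cmod (stft ?g ?g (w - z))) \<partial>lborel)" for i z
  have km: "k i \<in> borel_measurable borel" if i: "i \<in> I" for i
  proof -
    note [measurable] = L2_borel_measurable[OF \<phi>[OF i]]
    show ?thesis unfolding k_def[abs_def] by measurable
  qed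
  have kfin: "(\<integral>\<^sup>+z. k i z \<partial>lborel) < \<infinity>" if i: "i \<in> I" for i
  proof -
    note [measurable] = L2_borel_measurable[OF \<phi>[OF i]]
    let ?V = "\<lambda>w. indicator (ball 0 (\<rho> i)) w * ennreal (cmod (stft ?g (\<phi> i) w))"
    let ?c = "sqrt (sqnorm lborel (\<phi> i))"
    have "(\<integral>\<^sup>+z. k i z \<partial>lborel) = (\<integral>\<^sup>+w. (\<integral>\<^sup>+z. ?V w * ennreal (cmod (stft ?g ?g (w - z))) \<partial>lborel) \<partial>lborel)"
      unfolding k_def by (rule lborel_pair.Fubini') measurable
    also have "\<dots> = (\<integral>\<^sup>+w. ?V w * (\<integral>\<^sup>+z. ennreal (cmod (stft ?g ?g z)) \<partial>lborel) \<partial>lborel)"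
      using nn_integral_lborel_reflect[of "\<lambda>z. ennreal (cmod (stft ?g ?g z))"]
      by (subst nn_integral_cmult) auto
    also have "\<dots> = (\<integral>\<^sup>+w. ?V w \<partial>lborel) * (\<integral>\<^sup>+z. ennreal (cmod (stft ?g ?g z)) \<partial>lborel)"
      by (intro nn_integral_multc) measurable
    also have "\<dots> < \<infinity>"
    proof -
      have "(\<integral>\<^sup>+w. ?V w \<partial>lborel) \<le> (\<integral>\<^sup>+w. ennreal ?c * indicator (ball (0 :: real \<times> real) (\<rho> i)) w \<partial>lborel)"
        using stft_bound[OF \<phi>[OF i] g(1)] g(2)
        by (intro nn_integral_mono) (auto simp: indicator_def intro: ennreal_leI)
      also have "\<dots> = ennreal ?c * emeasure lborel (ball (0 :: real \<times> real) (\<rho> i))"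
        by (intro nn_integral_cmult_indicator) measurable
      also have "\<dots> < \<infinity>"
        using emeasure_lborel_ball_finite[of "0 :: real \<times> real" "\<rho> i"] by (simp add: ennreal_mult_less_top)
      finally show ?thesis
        using nn_integral_stft_std_gaussian by (simp add: ennreal_mult_less_top)
    qed
    finally show ?thesis .
  qed
  have kle: "ennreal (cmod (stft ?g (\<phi>' i) z)) \<le> k i z" if i: "i \<in> I" for i z
    unfolding k_def by (rule stft_part_pointwise[OF \<phi>[OF i] g(1) g(1) _ part[OF i]]) measurable
  have small: "uniformly_small I (\<lambda>i t. \<phi> i t - \<phi>' i t) \<delta>"
  proof (intro finite_uniformly_small I diffL)
    have "(\<Sum>i\<in>I. sqnorm lborel (\<lambda>t. \<phi> i t - \<phi>' i t)) \<le> real (card I) * \<delta>'"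
      using sum_bounded_above[of I "\<lambda>i. sqnorm lborel (\<lambda>t. \<phi> i t - \<phi>' i t)" \<delta>'] diff_small by simp
    also have "\<dots> \<le> (real (card I) + 1) * \<delta>'" using \<delta>' by (intro mult_right_mono) auto
    also have "\<dots> = \<delta>" by (simp add: \<delta>'_def add_nonneg_eq_0_iff)
    finally show "(\<Sum>i\<in>I. sqnorm lborel (\<lambda>t. \<phi> i t - \<phi>' i t)) \<le> \<delta>" .
  qed
  show "\<exists>K \<phi>'. K \<in> borel_measurable borel \<and> (\<integral>\<^sup>+z. K z \<partial>lborel) < \<infinity> \<and>
     (\<forall>i\<in>I. \<phi>' i \<in> L2 lborel \<and> (\<forall>z. ennreal (cmod (stft ?g (\<phi>' i) z)) \<le> K z)) \<and>
     uniformly_small I (\<lambda>i t. \<phi> i t - \<phi>' i t) \<delta>"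
  proof (intro exI[of _ "\<lambda>z. \<Sum>i\<in>I. k i z"] exI[of _ \<phi>'] conjI ballI allI small \<phi>'L)
    show "(\<lambda>z. \<Sum>i\<in>I. k i z) \<in> borel_measurable borel"
      by (intro borel_measurable_sum km)
    show "(\<integral>\<^sup>+z. (\<Sum>i\<in>I. k i z) \<partial>lborel) < \<infinity>"
      using km kfin I by (subst nn_integral_sum) auto
    show "ennreal (cmod (stft ?g (\<phi>' i) z)) \<le> (\<Sum>i\<in>I. k i z)" if "i \<in> I" for i z
      using kle[OF that, of z] member_le_sum[OF that, of "\<lambda>i. k i z"] I by (auto intro: order_trans)
  qed
qed

section \<open>Windows close to the Gaussian in phase space\<close>

context
  fixes I :: "'i set" and \<phi> :: "'i \<Rightarrow> real \<Rightarrow> complex" and C0 :: real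
  assumes windows: "\<And>i. i \<in> I \<Longrightarrow> \<phi> i \<in> L2 lborel"
    and close: "\<And>i z. i \<in> I \<Longrightarrow>
      cmod (stft std_gaussian std_gaussian z - stft std_gaussian (\<phi> i) z) < C0 * cmod (stft std_gaussian std_gaussian z)"
begin

text \<open>The strict inequality at a single point, for any index, makes the product on its right
  side positive.\<close>

lemma gaussian_close_windows_nonneg: "I \<noteq> {} \<Longrightarrow> 0 \<le> C0"
proof -
  assume "I \<noteq> {}"
  then obtain i where "i \<in> I" by blast
  then have "0 < C0 * cmod (stft std_gaussian std_gaussian 0)"
    by (rule le_less_trans[OF norm_ge_zero close])
  then show ?thesis by (auto simp: zero_less_mult_iff)
qed

text \<open>The transforms lie below a multiple of the integrable transform of the Gaussian, so
  \<open>\<phi>\<close> can be its own approximation, with perturbation 0.\<close>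

lemma gaussian_close_windows_uniformly_localized: "uniformly_localized std_gaussian I \<phi>"
  unfolding uniformly_localized_def
proof (intro allI impI exI[of _ \<phi>] exI[of _ "\<lambda>z. ennreal (1 + \<bar>C0\<bar>) * ennreal (cmod (stft std_gaussian std_gaussian z))"] conjI ballI)
  let ?V = "stft std_gaussian std_gaussian"
  show "(\<lambda>z. ennreal (1 + \<bar>C0\<bar>) * ennreal (cmod (?V z))) \<in> borel_measurable borel" by measurable
  show "(\<integral>\<^sup>+z. ennreal (1 + \<bar>C0\<bar>) * ennreal (cmod (?V z)) \<partial>lborel) < \<infinity>"
    using nn_integral_stft_std_gaussian by (simp add: nn_integral_cmult ennreal_mult_less_top)
  show "\<phi> i \<in> L2 lborel" if "i \<in> I" for i by (rule windows[OF that])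
  show "ennreal (cmod (stft std_gaussian (\<phi> i) z)) \<le> ennreal (1 + \<bar>C0\<bar>) * ennreal (cmod (?V z))" if i: "i \<in> I" for i z
  proof -
    have "cmod (stft std_gaussian (\<phi> i) z) \<le> cmod (?V z) + cmod (?V z - stft std_gaussian (\<phi> i) z)"
      using norm_triangle_ineq4[of "?V z" "?V z - stft std_gaussian (\<phi> i) z"] by simp
    also have "\<dots> \<le> cmod (?V z) + C0 * cmod (?V z)" using close[OF i, of z] by simp
    also have "\<dots> \<le> cmod (?V z) + \<bar>C0\<bar> * cmod (?V z)" by (intro add_left_mono mult_right_mono) auto
    also have "\<dots> = (1 + \<bar>C0\<bar>) * cmod (?V z)" by (simp add: distrib_right)
    finally show ?thesis by (subst ennreal_mult[symmetric]) (auto intro: ennreal_leI)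
  qed
  have "stft (\<lambda>t. \<phi> i t - \<phi> i t) h z = 0" for i h z
    by (simp add: stft_def l2_inner_def tf_shift_def split: prod.split)
  then show "uniformly_small I (\<lambda>i t. \<phi> i t - \<phi> i t) \<delta>" for \<delta>
    unfolding uniformly_small_def by (intro ballI bexI[of _ "\<lambda>_. 0"]) auto
qed

lemma gaussian_close_windows_clustered:
  assumes C0: "2 * C0 * (LINT z|lborel. cmod (stft std_gaussian std_gaussian z)) < 1" and I: "I \<noteq> {}"
  shows "clustered_windows I \<phi>"
  unfolding clustered_windows_def uniformly_small_def
proof (intro bexI[of _ std_gaussian] conjI ballI sqnorm_std_gaussian std_gaussian_L2 windows)
  let ?V = "stft std_gaussian std_gaussian"
  note g = std_gaussian_L2 sqnorm_std_gaussian
  have C0n: "0 \<le> C0" by (rule gaussian_close_windows_nonneg[OF I])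
  define l where "l = (LINT z|lborel. cmod (?V z))"
  have l0: "0 \<le> l" by (simp add: l_def)
  have "integrable lborel (\<lambda>z. cmod (?V z))"
    using nn_integral_stft_std_gaussian by (auto simp: integrable_iff_bounded)
  then have l: "(\<integral>\<^sup>+z. ennreal (cmod (?V z)) \<partial>lborel) = ennreal l"
    unfolding l_def by (intro nn_integral_eq_integral) auto
  fix f :: "real \<Rightarrow> complex" assume f: "f \<in> L2 lborel"
  note [measurable] = L2_borel_measurable[OF f]
  let ?K = "\<lambda>z. ennreal (C0 * cmod (?V z))"
  let ?F = "\<lambda>z. ennreal (cmod (stft std_gaussian f z))"
  show "\<exists>D\<in>borel_measurable borel.
        (\<forall>i\<in>I. \<forall>z. ennreal (cmod (stft (\<lambda>t. std_gaussian t - \<phi> i t) f z)) \<le> D z) \<and>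
        (\<integral>\<^sup>+z. (D z)\<^sup>2 \<partial>lborel) \<le> ennreal (1 / 4 * sqnorm lborel f)"
  proof (intro bexI[of _ "\<lambda>z. \<integral>\<^sup>+w. ?F w * ?K (w - z) \<partial>lborel"] conjI ballI allI)
    fix i z assume i: "i \<in> I"
    have "ennreal (cmod (stft (\<lambda>t. std_gaussian t - \<phi> i t) f z)) \<le>
        (\<integral>\<^sup>+w. ?F w * ennreal (cmod (stft std_gaussian (\<lambda>t. std_gaussian t - \<phi> i t) (w - z))) \<partial>lborel)"
      by (intro stft_pointwise_le f g L2_diff windows i)
    also have "\<dots> \<le> (\<integral>\<^sup>+w. ?F w * ?K (w - z) \<partial>lborel)"
    proof (intro nn_integral_mono mult_left_mono ennreal_leI)
      fix w
      show "cmod (stft std_gaussian (\<lambda>t. std_gaussian t - \<phi> i t) (w - z)) \<le> C0 * cmod (?V (w - z))"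
        using close[OF i, of "w - z"] by (simp add: stft_diff g windows i)
    qed auto
    finally show "ennreal (cmod (stft (\<lambda>t. std_gaussian t - \<phi> i t) f z)) \<le> (\<integral>\<^sup>+w. ?F w * ?K (w - z) \<partial>lborel)" .
  next
    have K: "(\<integral>\<^sup>+w. ?K w \<partial>lborel) = ennreal (C0 * l)"
      using C0n l by (simp add: ennreal_mult' nn_integral_cmult)
    \<comment> \<open>\<open>2 * C0 * l < 1\<close> gives the kernel a mass of at most 1/2, and
      Young's inequality squares it to the constant in \<open>clustered_windows\<close>.\<close>
    have "(C0 * l)\<^sup>2 \<le> (1 / 2)\<^sup>2"
      using C0 C0n l0 by (intro power_mono) (auto simp: l_def)
    then have Cl: "(C0 * l)\<^sup>2 * sqnorm lborel f \<le> 1 / 4 * sqnorm lborel f"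
      by (intro mult_right_mono) (auto simp: power_divide)
    have "(\<integral>\<^sup>+z. (\<integral>\<^sup>+w. ?F w * ?K (w - z) \<partial>lborel)\<^sup>2 \<partial>lborel) \<le> (\<integral>\<^sup>+w. ?K w \<partial>lborel)\<^sup>2 * (\<integral>\<^sup>+w. (?F w)\<^sup>2 \<partial>lborel)"
      by (rule Young_convolution_L2) measurable
    also have "(\<integral>\<^sup>+w. (?F w)\<^sup>2 \<partial>lborel) = ennreal (sqnorm lborel f)"
      using Moyal[OF f g(1)] g(2) by (simp add: ennreal_power)
    also have "(\<integral>\<^sup>+w. ?K w \<partial>lborel)\<^sup>2 * ennreal (sqnorm lborel f) = ennreal ((C0 * l)\<^sup>2 * sqnorm lborel f)"
    proof -
      have "(ennreal (C0 * l))\<^sup>2 = ennreal ((C0 * l)\<^sup>2)"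
        using C0n l0 by (intro ennreal_power) simp
      then show ?thesis unfolding K by (simp only: ennreal_mult zero_le_power2 sqnorm_nonneg)
    qed
    also have "\<dots> \<le> ennreal (1 / 4 * sqnorm lborel f)" by (rule ennreal_leI[OF Cl])
    finally show "(\<integral>\<^sup>+z. (\<integral>\<^sup>+w. ?F w * ?K (w - z) \<partial>lborel)\<^sup>2 \<partial>lborel) \<le> ennreal (1 / 4 * sqnorm lborel f)" .
  qed measurable
qed

end

text \<open>Serves to pass from pairs to the triples that also record the window; unordered sums are
  invariant under bijections.\<close>

lemma l2_frame_reindex:
  assumes b: "bij_betw \<pi> J J'" and fr: "l2_frame J (\<lambda>n. h (\<pi> n))"
  shows "l2_frame J' h"
proof -
  have J': "J' = \<pi> ` J" and inj: "inj_on \<pi> J" using b by (auto simp: bij_betw_def)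
  have s: "(\<lambda>n. (cmod (l2_inner f (h n)))\<^sup>2) summable_on J' \<longleftrightarrow> (\<lambda>n. (cmod (l2_inner f (h (\<pi> n))))\<^sup>2) summable_on J" for f
    using summable_on_reindex_bij_betw[OF b, of "\<lambda>n. (cmod (l2_inner f (h n)))\<^sup>2"] by simp
  have i: "(\<Sum>\<^sub>\<infinity>n\<in>J'. (cmod (l2_inner f (h n)))\<^sup>2) = (\<Sum>\<^sub>\<infinity>n\<in>J. (cmod (l2_inner f (h (\<pi> n))))\<^sup>2)" for f
    using infsum_reindex_bij_betw[OF b, of "\<lambda>n. (cmod (l2_inner f (h n)))\<^sup>2"] by simp
  show ?thesis
    using fr unfolding l2_frame_def s i by (auto simp: J')
qed

theorem theorem3p7:
  fixes \<Gamma> :: "(real \<times> real) set"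
    and \<eta> :: "real \<times> real \<Rightarrow> real \<times> real \<Rightarrow> real"
    and I :: "'i set"
    and \<phi> :: "'i \<Rightarrow> real \<Rightarrow> complex"
    and \<mu> :: "'i \<Rightarrow> real \<times> real \<Rightarrow> nat \<Rightarrow> real"
    and e :: "'i \<Rightarrow> real \<times> real \<Rightarrow> nat \<Rightarrow> real \<Rightarrow> complex"
  assumes "well_spread \<Gamma> \<eta>"
    and "\<forall>\<gamma>\<in>\<Gamma>. \<forall>z. 0 \<le> \<eta> \<gamma> z"
    and "\<exists>A B. 0 < A \<and> A \<le> B \<and>
           (\<forall>z. (\<lambda>\<gamma>. \<eta> \<gamma> z) summable_on \<Gamma> \<and>
                A \<le> (\<Sum>\<^sub>\<infinity>\<gamma>\<in>\<Gamma>. \<eta> \<gamma> z) \<and> (\<Sum>\<^sub>\<infinity>\<gamma>\<in>\<Gamma>. \<eta> \<gamma> z) \<le> B)"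
    and "\<forall>i\<in>I. \<phi> i \<in> square_integrable"
    and "(\<exists>i1 i2. i1 \<noteq> i2 \<and> I = {i1, i2} \<and> l2_norm (\<phi> i1) = 1 \<and> l2_norm (\<phi> i2) = 1 \<and>
             l2_norm (\<lambda>t. \<phi> i1 t - \<phi> i2 t) < 1 / 2)
         \<or> ((\<exists>C s. C > 0 \<and> s > 1 \<and>
               (\<forall>i\<in>I. \<forall>z. plane_conv (\<lambda>w. cmod (stft std_gaussian (\<phi> i) w))
                                    (\<lambda>w. cmod (stft std_gaussian (\<phi> i) w)) z
                          \<le> C * (1 + (norm z)\<^sup>2) powr (- s)))
            \<and> (\<exists>C0. 2 * C0 * (LINT z|lborel. cmod (stft std_gaussian std_gaussian z)) < 1 \<and>
               (\<forall>i\<in>I. \<forall>z. cmod (stft std_gaussian std_gaussian z - stft std_gaussian (\<phi> i) z)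
                          < C0 * cmod (stft std_gaussian std_gaussian z))))"
    and "\<forall>i\<in>I. \<forall>\<gamma>\<in>\<Gamma>. spectral_decomposition (loc_op (\<eta> \<gamma>) (\<phi> i)) (\<mu> i \<gamma>) (e i \<gamma>)"
  shows "\<exists>\<epsilon>>0.
           (\<forall>i\<in>I. l2_frame {(\<gamma>, k). \<gamma> \<in> \<Gamma> \<and> \<mu> i \<gamma> k > \<epsilon>} (\<lambda>(\<gamma>, k). e i \<gamma> k)) \<and>
           (\<forall>\<sigma>. indexed_partition I \<sigma> \<Gamma> \<longrightarrow>
              l2_frame {(i, \<gamma>, k). i \<in> I \<and> \<gamma> \<in> \<sigma> i \<and> \<mu> i \<gamma> k > \<epsilon>} (\<lambda>(i, \<gamma>, k). e i \<gamma> k))"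
proof -
  have \<phi>: "\<And>i. i \<in> I \<Longrightarrow> \<phi> i \<in> L2 lborel"
    using assms(4) by (simp add: square_integrable_eq_L2)
  obtain A B where A: "0 < A" "A \<le> B" and summ: "\<And>z. (\<lambda>\<gamma>. \<eta> \<gamma> z) summable_on \<Gamma>"
    and sumA: "\<And>z. A \<le> (\<Sum>\<^sub>\<infinity>\<gamma>\<in>\<Gamma>. \<eta> \<gamma> z)" and sumB: "\<And>z. (\<Sum>\<^sub>\<infinity>\<gamma>\<in>\<Gamma>. \<eta> \<gamma> z) \<le> B"
    using assms(3) by (elim exE conjE) (rule that, assumption, assumption, blast+)
  have B: "0 < B" using A by simp
  show ?thesis
  proof (cases "I = {}")
    case True
    \<comment> \<open>An empty sum would be below \<open>A\<close>. An empty \<open>I\<close> cannot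
      partition a nonempty \<open>\<Gamma>\<close>, so both claims are vacuous.\<close>
    have "\<Gamma> \<noteq> {}" using sumA[of 0] A by auto
    with True show ?thesis by (intro exI[of _ 1]) (auto simp: indexed_partition_def)
  next
    case False
    have "clustered_windows I \<phi> \<and> uniformly_localized std_gaussian I \<phi>"
      using assms(5)
    proof (elim disjE exE conjE)
      fix i1 i2 assume I: "I = {i1, i2}" and n: "l2_norm (\<phi> i1) = 1" and d: "l2_norm (\<lambda>t. \<phi> i1 t - \<phi> i2 t) < 1 / 2"
      have "(l2_norm (\<lambda>t. \<phi> i1 t - \<phi> i2 t))\<^sup>2 \<le> (1 / 2)\<^sup>2"
        using d by (intro power_mono) (auto simp: l2_norm_eq_sqrt)
      then have "sqnorm lborel (\<lambda>t. \<phi> i1 t - \<phi> i2 t) \<le> 1 / 4"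
        by (simp add: sqnorm_l2_norm power_divide)
      moreover have "sqnorm lborel (\<phi> i1) = 1" using n by (simp add: l2_norm_eq_sqrt)
      ultimately have "clustered_windows {i1, i2} \<phi>"
        using \<phi> I by (intro close_pair_clustered) auto
      moreover have "uniformly_localized std_gaussian I \<phi>"
        using I by (intro finite_windows_uniformly_localized \<phi>) auto
      ultimately show ?thesis using I by simp
    next
      fix C0 assume C0: "2 * C0 * (LINT z|lborel. cmod (stft std_gaussian std_gaussian z)) < 1"
        and cl: "\<forall>i\<in>I. \<forall>z. cmod (stft std_gaussian std_gaussian z - stft std_gaussian (\<phi> i) z)
                          < C0 * cmod (stft std_gaussian std_gaussian z)"
      have cl': "cmod (stft std_gaussian std_gaussian z - stft std_gaussian (\<phi> i) z)
          < C0 * cmod (stft std_gaussian std_gaussian z)" if "i \<in> I" for i z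
        using cl that by blast
      show ?thesis
      proof
        show "clustered_windows I \<phi>"
          by (rule gaussian_close_windows_clustered[OF _ _ C0 False]) (fact \<phi> cl')+
        show "uniformly_localized std_gaussian I \<phi>"
          by (rule gaussian_close_windows_uniformly_localized) (fact \<phi> cl')+
      qed
    qed
    then have cl: "clustered_windows I \<phi>" and loc: "uniformly_localized std_gaussian I \<phi>" by auto
    have "\<exists>\<epsilon>>0. \<forall>\<iota>. (\<forall>\<gamma>\<in>\<Gamma>. \<iota> \<gamma> \<in> I) \<longrightarrow>
        l2_frame {(\<gamma>, k). \<gamma> \<in> \<Gamma> \<and> \<mu> (\<iota> \<gamma>) \<gamma> k > \<epsilon>} (\<lambda>(\<gamma>, k). e (\<iota> \<gamma>) \<gamma> k)"
      using assms(2,6) by (intro woven_eigenfunction_frames[OF assms(1) _ A(1) B summ sumA sumB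
            std_gaussian_L2 sqnorm_std_gaussian cl loc]) auto
    then obtain \<epsilon> where \<epsilon>: "\<epsilon> > 0" and fr: "\<And>\<iota>. (\<And>\<gamma>. \<gamma> \<in> \<Gamma> \<Longrightarrow> \<iota> \<gamma> \<in> I) \<Longrightarrow>
        l2_frame {(\<gamma>, k). \<gamma> \<in> \<Gamma> \<and> \<mu> (\<iota> \<gamma>) \<gamma> k > \<epsilon>} (\<lambda>(\<gamma>, k). e (\<iota> \<gamma>) \<gamma> k)"
      by blast
    show ?thesis
    proof (intro exI[of _ \<epsilon>] conjI ballI allI impI \<epsilon>)
      show "l2_frame {(\<gamma>, k). \<gamma> \<in> \<Gamma> \<and> \<mu> i \<gamma> k > \<epsilon>} (\<lambda>(\<gamma>, k). e i \<gamma> k)" if "i \<in> I" for i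
        by (rule fr[of "\<lambda>_. i"]) (rule that)
      fix \<sigma> assume \<sigma>: "indexed_partition I \<sigma> \<Gamma>"
      then have "\<forall>\<gamma>\<in>\<Gamma>. \<exists>i. i \<in> I \<and> \<gamma> \<in> \<sigma> i" by (auto simp: indexed_partition_def)
      from bchoice[OF this] obtain \<iota> where \<iota>: "\<And>\<gamma>. \<gamma> \<in> \<Gamma> \<Longrightarrow> \<iota> \<gamma> \<in> I" "\<And>\<gamma>. \<gamma> \<in> \<Gamma> \<Longrightarrow> \<gamma> \<in> \<sigma> (\<iota> \<gamma>)"
        by blast
      \<comment> \<open>Disjointness makes the window recorded in a triple redundant, so that
        dropping it is a bijection onto the pairs.\<close>
      have uniq: "i = \<iota> \<gamma>" if "i \<in> I" "\<gamma> \<in> \<sigma> i" for i \<gamma>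
      proof (rule ccontr)
        assume ne: "i \<noteq> \<iota> \<gamma>"
        have \<gamma>: "\<gamma> \<in> \<Gamma>" using that \<sigma> by (auto simp: indexed_partition_def)
        have "\<sigma> i \<inter> \<sigma> (\<iota> \<gamma>) = {}"
          using \<sigma> that(1) \<iota>(1)[OF \<gamma>] ne by (auto simp: indexed_partition_def dest: disjoint_family_onD)
        then show False using that(2) \<iota>(2)[OF \<gamma>] by blast
      qed
      have sub: "\<gamma> \<in> \<Gamma>" if "i \<in> I" "\<gamma> \<in> \<sigma> i" for i \<gamma> using that \<sigma> by (auto simp: indexed_partition_def)
      show "l2_frame {(i, \<gamma>, k). i \<in> I \<and> \<gamma> \<in> \<sigma> i \<and> \<mu> i \<gamma> k > \<epsilon>} (\<lambda>(i, \<gamma>, k). e i \<gamma> k)"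
      proof (rule l2_frame_reindex)
        show "bij_betw (\<lambda>(\<gamma>, k). (\<iota> \<gamma>, \<gamma>, k)) {(\<gamma>, k). \<gamma> \<in> \<Gamma> \<and> \<mu> (\<iota> \<gamma>) \<gamma> k > \<epsilon>}
            {(i, \<gamma>, k). i \<in> I \<and> \<gamma> \<in> \<sigma> i \<and> \<mu> i \<gamma> k > \<epsilon>}"
        proof (rule bij_betwI[where g="\<lambda>(i, \<gamma>, k). (\<gamma>, k)"])
          show "(\<lambda>(i, \<gamma>, k). (\<gamma>, k)) \<in> {(i, \<gamma>, k). i \<in> I \<and> \<gamma> \<in> \<sigma> i \<and> \<mu> i \<gamma> k > \<epsilon>} \<rightarrow>
              {(\<gamma>, k). \<gamma> \<in> \<Gamma> \<and> \<mu> (\<iota> \<gamma>) \<gamma> k > \<epsilon>}"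
            using uniq sub by fastforce
          show "(\<lambda>(\<gamma>, k). (\<iota> \<gamma>, \<gamma>, k)) ((\<lambda>(i, \<gamma>, k). (\<gamma>, k)) y) = y"
            if "y \<in> {(i, \<gamma>, k). i \<in> I \<and> \<gamma> \<in> \<sigma> i \<and> \<mu> i \<gamma> k > \<epsilon>}" for y
            using that uniq by fastforce
        qed (use \<iota> in auto)
        have "(\<lambda>n. (\<lambda>(i, \<gamma>, k). e i \<gamma> k) ((\<lambda>(\<gamma>, k). (\<iota> \<gamma>, \<gamma>, k)) n)) = (\<lambda>(\<gamma>, k). e (\<iota> \<gamma>) \<gamma> k)"
          by (auto simp: fun_eq_iff)
        then show "l2_frame {(\<gamma>, k). \<gamma> \<in> \<Gamma> \<and> \<mu> (\<iota> \<gamma>) \<gamma> k > \<epsilon>}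
            (\<lambda>n. case case n of (\<gamma>, k) \<Rightarrow> (\<iota> \<gamma>, \<gamma>, k) of (i, \<gamma>, k) \<Rightarrow> e i \<gamma> k)"
          using fr[OF \<iota>(1)] by simp
      qed
    qed
  qed
qed

end
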